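(* Let $n\ge 2$, $N\ge 1$ and $0<\alpha<1$. Let $a(x,p,q,r)=(a_1,\dots,a_N)(x,p,q,r)$ be of class $C^2_{loc}$ in $x\in\mathbb{R}^n$, $p\in\mathbb{R}^N$, $q\in\mathbb{R}^n\otimes\mathbb{R}^N$, $r\in\mathrm{Sym}(n)\otimes\mathbb{R}^N$. Assume $a(0)=0$, $\nabla_ra(0)=0$ and $\nabla_r^2a(0)=0$. Then for all sufficiently small $R>0$ the system for $u=(u_1,\dots,u_N):\{|x|\le R\}\to\mathbb{R}^N$ $$\Delta u(x)=a(x,u(x),\nabla u(x),\nabla^2u(x))$$ has infinitely many solutions in $C^{2+\alpha}(\{|x|\le R\})$ of vanishing order two at the origin. Moreover, all these solutions are not radially symmetric.
   Context: $\mathrm{Sym}(n)$ is the set of real symmetric $n\times n$ matrices; $\nabla_r$ denotes derivatives with respect to the variables $r$; $a(0)$, $\nabla_ra(0)$, $\nabla_r^2a(0)$ mean values at $(x,p,q,r)=(0,0,0,0)$. A solution $u$ is of vanishing order two at the origin if $u(0)=0$, $\nabla u(0)=0$ and $\nabla^2u(0)\ne0$. A map $u$ on the ball is radially symmetric if $u(x)$ depends only on $|x|$. $C^{2+\alpha}$ denotes functions whose second order partial derivatives exist and are Hölder continuous with exponent $\alpha$. *)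

theory Defs
  imports "HOL-Analysis.Analysis"
begin

text \<open>
  Index conventions, for \<open>u : \<real>\<^sup>n \<rightarrow> \<real>\<^sup>N\<close>: the component \<open>(\<nabla>u) $ j $ i\<close> is the partial derivative
  \<open>\<partial>\<^sub>i u\<^sub>j\<close>, and \<open>(\<nabla>\<^sup>2u) $ j\<close> is the Hessian matrix of \<open>u\<^sub>j\<close>.

  Derivatives of maps on a closed ball are taken within the ball. A closed ball of positive
  radius is convex with nonempty interior, so these are unique; for maps of class
  \<open>C\<^sup>2\<^sup>+\<^sup>\<alpha>\<close> they are, at boundary points, the continuous extensions of the interior derivatives.
\<close>

definition grad_on :: "(real^'n) set \<Rightarrow> (real^'n \<Rightarrow> real^'m) \<Rightarrow> real^'n \<Rightarrow> real^'n^'m" where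
  "grad_on S u x = jacobian u (at x within S)"

definition hess_on :: "(real^'n) set \<Rightarrow> (real^'n \<Rightarrow> real^'m) \<Rightarrow> real^'n \<Rightarrow> real^'n^'n^'m" where
  "hess_on S u x = (\<chi> j. jacobian (\<lambda>y. grad_on S u y $ j) (at x within S))"

definition laplacian_on :: "(real^'n) set \<Rightarrow> (real^'n \<Rightarrow> real^'m) \<Rightarrow> real^'n \<Rightarrow> real^'m" where
  "laplacian_on S u x = (\<chi> j. trace (hess_on S u x $ j))"

definition hoelder_on ::
  "real \<Rightarrow> 'a::metric_space set \<Rightarrow> ('a \<Rightarrow> 'b::metric_space) \<Rightarrow> bool" where
  "hoelder_on \<alpha> S f \<longleftrightarrow> (\<exists>C. \<forall>x\<in>S. \<forall>y\<in>S. dist (f x) (f y) \<le> C * dist x y powr \<alpha>)"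

definition C2_hoelder_on :: "real \<Rightarrow> (real^'n) set \<Rightarrow> (real^'n \<Rightarrow> real^'m) \<Rightarrow> bool" where
  "C2_hoelder_on \<alpha> S u \<longleftrightarrow>
     u differentiable_on S \<and>
     (\<forall>j. (\<lambda>x. grad_on S u x $ j) differentiable_on S) \<and>
     hoelder_on \<alpha> S (hess_on S u)"

definition vanishing_order_two_on :: "(real^'n) set \<Rightarrow> (real^'n \<Rightarrow> real^'m) \<Rightarrow> bool" where
  "vanishing_order_two_on S u \<longleftrightarrow> u 0 = 0 \<and> grad_on S u 0 = 0 \<and> hess_on S u 0 \<noteq> 0"

definition radially_symmetric_on :: "(real^'n) set \<Rightarrow> (real^'n \<Rightarrow> real^'m) \<Rightarrow> bool" where
  "radially_symmetric_on S u \<longleftrightarrow> (\<forall>x\<in>S. \<forall>y\<in>S. norm x = norm y \<longrightarrow> u x = u y)"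

text \<open>
  \<open>Sym(n) \<otimes> \<real>\<^sup>N\<close> as a linear subspace of all \<open>N\<close>-tuples of matrices. A map defined on it is
  represented by a total function, only whose values on the subspace matter.
\<close>

definition sym_tuples :: "(real^'n^'n^'m) set" where
  "sym_tuples = {r. \<forall>j. transpose (r $ j) = r $ j}"

definition jets ::
  "((real^'n) \<times> (real^'m) \<times> (real^'n^'m) \<times> (real^'n^'n^'m)) set" where
  "jets = UNIV \<times> UNIV \<times> UNIV \<times> sym_tuples"

text \<open>
  Class \<open>C\<^sup>2\<close>, meant for a set \<open>S\<close> that is a linear subspace. Only the restrictions of \<open>f'\<close> and
  \<open>f''\<close> to directions in \<open>S\<close> are determined by \<open>f\<close>; in the other directions they can always be
  chosen to vanish (precompose with a projection onto \<open>S\<close>), so their existence is no additional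
  requirement.
\<close>

definition C2_on :: "'a::real_normed_vector set \<Rightarrow> ('a \<Rightarrow> 'b::real_normed_vector) \<Rightarrow> bool" where
  "C2_on S f \<longleftrightarrow>
     (\<exists>(f' :: 'a \<Rightarrow> 'a \<Rightarrow>\<^sub>L 'b) (f'' :: 'a \<Rightarrow> 'a \<Rightarrow>\<^sub>L 'a \<Rightarrow>\<^sub>L 'b).
        (\<forall>z\<in>S. (f has_derivative blinfun_apply (f' z)) (at z within S)) \<and>
        (\<forall>z\<in>S. (f' has_derivative blinfun_apply (f'' z)) (at z within S)) \<and>
        continuous_on S f'')"

text \<open>
  \<open>\<nabla>\<^sub>r a(0) = 0\<close> and \<open>\<nabla>\<^sub>r\<^sup>2 a(0) = 0\<close>, the derivatives being those of \<open>r \<mapsto> a(0,0,0,r)\<close> on the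
  vector space \<open>sym_tuples\<close>. The value of \<open>frechet_derivative\<close> within a linear subspace is
  well determined in directions \<open>h\<close> of that subspace.
\<close>

definition grad_r_zero ::
  "((real^'n) \<times> (real^'m) \<times> (real^'n^'m) \<times> (real^'n^'n^'m) \<Rightarrow> real^'m) \<Rightarrow> bool" where
  "grad_r_zero a \<longleftrightarrow>
     ((\<lambda>r. a (0, 0, 0, r)) has_derivative (\<lambda>_. 0)) (at 0 within sym_tuples)"

definition hess_r_zero ::
  "((real^'n) \<times> (real^'m) \<times> (real^'n^'m) \<times> (real^'n^'n^'m) \<Rightarrow> real^'m) \<Rightarrow> bool" where
  "hess_r_zero a \<longleftrightarrow>
     (\<forall>h\<in>sym_tuples.
        ((\<lambda>r. frechet_derivative (\<lambda>s. a (0, 0, 0, s)) (at r within sym_tuples) h)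
           has_derivative (\<lambda>_. 0)) (at 0 within sym_tuples))"

definition solves_on ::
  "((real^'n) \<times> (real^'m) \<times> (real^'n^'m) \<times> (real^'n^'n^'m) \<Rightarrow> real^'m) \<Rightarrow>
   (real^'n) set \<Rightarrow> (real^'n \<Rightarrow> real^'m) \<Rightarrow> bool" where
  "solves_on a S u \<longleftrightarrow>
     (\<forall>x\<in>S. laplacian_on S u x = a (x, u x, grad_on S u x, hess_on S u x))"

end

theory Submission
  imports Defs
begin

text \<open>
  Writing \<open>u(x) = R\<^sup>2 v(x/R)\<close> turns the system into \<open>\<Delta>v = a(Ry, R\<^sup>2v, R\<nabla>v, \<nabla>\<^sup>2v)\<close> on the unit
  ball. We look for \<open>v = \<epsilon> y\<^sub>i y\<^sub>k e\<^sub>l + T f\<close> with \<open>i \<noteq> k\<close>, where \<open>T\<close> is a right inverse of the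
  Laplacian, bounded from \<open>C\<^sup>\<alpha>\<close> to \<open>C\<^sup>2\<^sup>+\<^sup>\<alpha>\<close> up to the boundary and normalised so that \<open>T f\<close> and
  \<open>\<nabla>(T f)\<close> vanish at the origin. As \<open>\<nabla>\<^sub>r a(0) = 0\<close>, the map \<open>f \<mapsto> a(Ry, R\<^sup>2v, R\<nabla>v, \<nabla>\<^sup>2v)\<close> is a
  contraction of a small ball of \<open>C\<^sup>\<alpha>\<close> with small values, so \<open>\<nabla>\<^sup>2v(0)\<close> is dominated by the quadratic
  polynomial. Its mixed entry is nonzero, which excludes radial symmetry, and distinct \<open>\<epsilon>\<close> give
  distinct solutions.

  The operator \<open>T\<close> is the limit of convolutions with \<open>G\<^sub>s(z) = s\<^sup>n\<^sup>-\<^sup>2 g(s\<^sup>2|z|\<^sup>2)\<close> for \<open>s = 2\<^sup>k\<close>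
  (\<open>ker0\<close> below, with gradient \<open>ker1\<close> and Hessian \<open>ker2\<close>; \<open>g, g', g''\<close> are \<open>prof0, prof1, prof2\<close>), where
  \<open>g'(t) = t\<^sup>-\<^sup>n\<^sup>/\<^sup>2\<close> for \<open>t \<ge> 1\<close> is continued linearly to \<open>t \<le> 1\<close>. Then \<open>\<Delta>G\<^sub>s\<close> is a positive multiple of
  \<open>s\<^sup>n (1 - s\<^sup>2|z|\<^sup>2)\<^sub>+\<close>, an approximate identity, and the Hessians of consecutive kernels differ by a
  function of integral zero supported in \<open>|z| \<le> 2\<^sup>-\<^sup>k\<close>. Summing these dyadic pieces gives the Schauder
  estimate without singular integrals. Every \<open>f\<close> is extended from the ball by the nearest point
  projection, so no boundary estimate is needed.
\<close>


section \<open>The regularised fundamental solution\<close>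

text \<open>The equation is fully nonlinear, so each iteration step must recover exactly the two
  derivatives that the right-hand side consumes. Continuous functions do not allow this, since
  \<open>T f\<close> need not have second derivatives; Hoelder functions do. The unknown is
  therefore the Laplacian f and not v. The price is that composition with a must be Lipschitz in the
  Hoelder norm, which takes one derivative more than in the supremum norm: this is where a being C^2
  enters. The factor R^2 is the one that leaves the Hessian unscaled. Shrinking the ball damps the
  dependence on x, v and the gradient, but never that on r, which must be tamed by small jets. Hence
  two small parameters: \<delta> bounds the jets and is chosen first, then R is small relative to
  \<delta>. No boundary condition is imposed, so any right inverse of the Laplacian will do.
  Subtracting an affine function changes no second derivative, which makes the normalisation at the
  origin free of charge.\<close>

definition prof1 :: "real \<Rightarrow> real \<Rightarrow> real" where
  "prof1 p s = (if s \<le> 1 then 1 - p * (s - 1) else s powr (- p))"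

text \<open>The maximum merges both branches of the derivative: the constant -p up to s = 1, the
  derivative of the power beyond. It also displays the continuity at the junction.\<close>

definition prof2 :: "real \<Rightarrow> real \<Rightarrow> real" where
  "prof2 p s = - p * max s 1 powr (- p - 1)"

text \<open>The lower limit -1 puts s = 0, the argument that occurs at z = 0, inside the interval of
  integration, so the derivative there is two-sided. Another limit would only add a
  constant.\<close>

definition prof0 :: "real \<Rightarrow> real \<Rightarrow> real" where
  "prof0 p s = integral {-1..s} (prof1 p)"

lemma prof1_ge1: "s \<ge> 1 \<Longrightarrow> prof1 p s = s powr (- p)"
  by (auto simp: prof1_def)

lemma has_derivative_prof1: "(prof1 p has_real_derivative prof2 p s) (at s)"
proof -
  have A: "((\<lambda>s. 1 - p * (s - 1)) has_real_derivative prof2 p s) (at s within S)" if "s \<le> 1" for S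
    using that by (auto intro!: derivative_eq_intros simp: prof2_def max_def)
  have B: "((\<lambda>s. s powr (- p)) has_real_derivative prof2 p s) (at s within S)" if "s \<ge> 1" for S
    using that by (auto intro!: derivative_eq_intros simp: prof2_def max_def)
  \<comment> \<open>The two branches have the same value and the same slope at s = 1, so they may be
    glued along closed half-lines.\<close>
  have "((\<lambda>s. if s \<in> {..1} then 1 - p * (s - 1) else s powr (- p)) has_vector_derivative
     (if s \<in> {..1} then prof2 p s else prof2 p s)) (at s within UNIV)"
    by (rule has_vector_derivative_If_within_closures[where T = "{1..}"])
      (use A B in \<open>auto simp: has_real_derivative_iff_has_vector_derivative [symmetric]\<close>)
  then show ?thesis
    by (simp add: has_real_derivative_iff_has_vector_derivative prof1_def [abs_def])
qed

lemma continuous_prof1: "continuous_on S (prof1 p)"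
  using has_derivative_prof1 DERIV_isCont continuous_at_imp_continuous_on by blast

lemma continuous_prof2: "continuous_on S (prof2 p)"
  unfolding prof2_def [abs_def] by (intro continuous_intros) auto

lemma has_derivative_prof0:
  assumes "s \<ge> 0"
  shows "(prof0 p has_real_derivative prof1 p s) (at s)"
proof -
  have "((\<lambda>x. integral {-1..x} (prof1 p)) has_real_derivative prof1 p s) (at s within {-1..s+1})"
    by (rule integral_has_real_derivative) (use assms continuous_prof1 in auto)
  moreover have "at s within {-1..s+1} = at s"
    using assms by (intro at_within_interior) auto
  ultimately show ?thesis by (simp add: prof0_def [abs_def])
qed

lemma prof2_bound:
  assumes "p > 0" shows "\<bar>prof2 p s\<bar> \<le> p"
proof -
  have "max s 1 powr (- p - 1) \<le> 1"
    using assms powr_mono2'[of "- p - 1" 1 "max s 1"] by auto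
  then show ?thesis
    using assms by (auto simp: prof2_def abs_mult)
qed

lemma prof1_Lipschitz:
  assumes "p > 0" shows "\<bar>prof1 p s - prof1 p t\<bar> \<le> p * \<bar>s - t\<bar>"
proof -
  have "norm (prof1 p s - prof1 p t) \<le> p * norm (s - t)"
    by (rule field_differentiable_bound[of UNIV _ "prof2 p"])
      (use prof2_bound assms has_derivative_prof1 in auto)
  then show ?thesis by simp
qed

text \<open>This is the last degree of smoothness of the profile, and the linear continuation is
  chosen to have it: it makes \<open>ker2\<close> Lipschitz, which the Hoelder estimate of the
  increments uses.\<close>

lemma prof2_Lipschitz:
  assumes "p > 0" shows "\<bar>prof2 p s - prof2 p t\<bar> \<le> p * (p + 1) * \<bar>s - t\<bar>"
proof -
  have *: "norm (x powr (- p - 1) - y powr (- p - 1)) \<le> (p + 1) * norm (x - y)"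
    if "x \<in> {1..}" "y \<in> {1..}" for x y :: real
  proof (rule field_differentiable_bound[of "{1..}" _ "\<lambda>x. (- p - 1) * x powr (- p - 2)"])
    fix x :: real assume x: "x \<in> {1..}"
    show "((\<lambda>x. x powr (- p - 1)) has_field_derivative (- p - 1) * x powr (- p - 2)) (at x within {1..})"
      using x by (auto intro!: derivative_eq_intros arg_cong[where f = "(powr) x"])
    have "x powr (- p - 2) \<le> 1"
      using x assms powr_mono2'[of "- p - 2" 1 x] by auto
    then have "(p + 1) * x powr (- p - 2) \<le> (p + 1) * 1"
      using assms by (intro mult_left_mono) auto
    moreover have "norm ((- p - 1) * x powr (- p - 2)) = (p + 1) * x powr (- p - 2)"
      using assms by (simp add: abs_mult)
    ultimately show "norm ((- p - 1) * x powr (- p - 2)) \<le> p + 1"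
      by simp
  qed (use that in auto)
  have "\<bar>prof2 p s - prof2 p t\<bar> = p * \<bar>max s 1 powr (- p - 1) - max t 1 powr (- p - 1)\<bar>"
    using assms by (simp add: prof2_def abs_mult flip: right_diff_distrib)
  also have "\<dots> \<le> p * ((p + 1) * \<bar>max s 1 - max t 1\<bar>)"
    using *[of "max s 1" "max t 1"] assms by (intro mult_left_mono) auto
  also have "\<dots> \<le> p * ((p + 1) * \<bar>s - t\<bar>)"
    using assms by (intro mult_left_mono) auto
  finally show ?thesis by (simp add: mult.assoc)
qed

text \<open>The quotient is the power of s with exponent n - 2, and remains so for n = 1, where
  subtraction of natural numbers would truncate. The chain rule cancels the denominator in
  \<open>ker1\<close>.\<close>

definition ker0 :: "real \<Rightarrow> real^'n \<Rightarrow> real" where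
  "ker0 s z = s ^ CARD('n) / s\<^sup>2 * prof0 (real CARD('n) / 2) (s\<^sup>2 * (z \<bullet> z))"

definition ker1 :: "real \<Rightarrow> real^'n \<Rightarrow> real^'n" where
  "ker1 s z = (2 * s ^ CARD('n) * prof1 (real CARD('n) / 2) (s\<^sup>2 * (z \<bullet> z))) *\<^sub>R z"

text \<open>Grouping s with each coordinate shows that, up to the factor
  \<open>s ^ CARD('n)\<close>, only \<open>s *\<^sub>R z\<close> occurs; \<open>ker2_scale\<close>
  rests on this.\<close>

definition ker2 :: "real \<Rightarrow> real^'n \<Rightarrow> real^'n^'n" where
  "ker2 s z = s ^ CARD('n) *\<^sub>R (\<chi> i j. (if i = j then 2 * prof1 (real CARD('n) / 2) (s\<^sup>2 * (z \<bullet> z)) else 0)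
      + 4 * prof2 (real CARD('n) / 2) (s\<^sup>2 * (z \<bullet> z)) * (s * z $ i) * (s * z $ j))"

lemma has_derivative_ker0:
  fixes z :: "real^'n"
  assumes "s > 0"
  shows "(ker0 s has_derivative (\<lambda>h. ker1 s z \<bullet> h)) (at z)"
proof -
  have d: "((\<lambda>z. s\<^sup>2 * (z \<bullet> z)) has_derivative (\<lambda>h. s\<^sup>2 * (z \<bullet> h + h \<bullet> z))) (at z)"
    by (auto intro!: derivative_eq_intros simp: fun_eq_iff)
  have e: "(prof0 p has_derivative (\<lambda>t. prof1 p (s\<^sup>2 * (z \<bullet> z)) * t)) (at (s\<^sup>2 * (z \<bullet> z)))" for p
    using has_derivative_prof0[of "s\<^sup>2 * (z \<bullet> z)" p] by (simp add: has_field_derivative_def)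
  show ?thesis
    unfolding ker0_def [abs_def] ker1_def
    apply (rule has_derivative_eq_rhs)
     apply (rule has_derivative_mult_right)
     apply (rule has_derivative_compose[OF d e])
    using assms apply (simp add: fun_eq_iff inner_commute)
    done
qed

lemma has_derivative_ker1:
  fixes z :: "real^'n"
  assumes "s > 0"
  shows "((\<lambda>z. ker1 s z $ i) has_derivative (\<lambda>h. ker2 s z $ i \<bullet> h)) (at z)"
proof -
  let ?p = "real CARD('n) / 2"
  have d: "((\<lambda>z. s\<^sup>2 * (z \<bullet> z)) has_derivative (\<lambda>h. s\<^sup>2 * (z \<bullet> h + h \<bullet> z))) (at z)"
    by (auto intro!: derivative_eq_intros simp: fun_eq_iff)
  have e: "(prof1 p has_derivative (\<lambda>t. prof2 p (s\<^sup>2 * (z \<bullet> z)) * t)) (at (s\<^sup>2 * (z \<bullet> z)))" for p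
    using has_derivative_prof1[of p "s\<^sup>2 * (z \<bullet> z)"] by (simp add: has_field_derivative_def)
  have f: "((\<lambda>z. z $ i) has_derivative (\<lambda>h. h $ i)) (at z)"
    by (simp add: bounded_linear_imp_has_derivative bounded_linear_vec_nth)
  have *: "((\<lambda>z. 2 * s ^ CARD('n) * (prof1 ?p (s\<^sup>2 * (z \<bullet> z)) * (z $ i))) has_derivative
     (\<lambda>h. 2 * s ^ CARD('n) * (prof1 ?p (s\<^sup>2 * (z \<bullet> z)) * h $ i +
      (prof2 ?p (s\<^sup>2 * (z \<bullet> z)) * (s\<^sup>2 * (z \<bullet> h + h \<bullet> z))) * z $ i))) (at z)"
    by (rule has_derivative_mult_right has_derivative_mult has_derivative_compose[OF d e] f)+
  have eq: "ker2 s z $ i \<bullet> h = 2 * s ^ CARD('n) * (prof1 ?p (s\<^sup>2 * (z \<bullet> z)) * h $ i +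
      (prof2 ?p (s\<^sup>2 * (z \<bullet> z)) * (s\<^sup>2 * (z \<bullet> h + h \<bullet> z))) * z $ i)" for h
  proof -
    define P where "P = prof1 ?p (s\<^sup>2 * (z \<bullet> z))"
    define P' where "P' = prof2 ?p (s\<^sup>2 * (z \<bullet> z))"
    have "(\<Sum>j\<in>UNIV. ((if i = j then 2 * P else 0) + 4 * P' * (s * z $ i) * (s * z $ j)) * h $ j)
      = (\<Sum>j\<in>UNIV. (if i = j then 2 * P * h $ j else 0)) + 4 * P' * (s * z $ i) * s * (z \<bullet> h)"
      unfolding inner_vec_def [of z h] sum_distrib_left sum.distrib [symmetric]
      by (intro sum.cong) (auto simp: algebra_simps)
    also have "\<dots> = 2 * P * h $ i + 4 * P' * (s * z $ i) * s * (z \<bullet> h)"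
      by simp
    finally show ?thesis
      unfolding ker2_def P_def [symmetric] P'_def [symmetric]
      by (simp add: inner_vec_def [of "_ *\<^sub>R _" h] inner_vec_def [of "vec_lambda _" h] mult.assoc flip: sum_distrib_left)
        (simp add: inner_commute algebra_simps power2_eq_square)
  qed
  show ?thesis
    by (rule has_derivative_eq_rhs[OF has_derivative_transform[OF _ _ *]])
       (auto simp: ker1_def eq)
qed

lemma continuous_ker2: "continuous_on S (ker2 s :: real^'n \<Rightarrow> _)"
proof -
  have a: "continuous_on S (\<lambda>z::real^'n. prof1 p (s\<^sup>2 * (z \<bullet> z)))" for p
    by (rule continuous_on_compose2[OF continuous_prof1[of UNIV]]) (auto intro!: continuous_intros)
  have b: "continuous_on S (\<lambda>z::real^'n. prof2 p (s\<^sup>2 * (z \<bullet> z)))" for p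
    by (rule continuous_on_compose2[OF continuous_prof2[of UNIV]]) (auto intro!: continuous_intros)
  have c: "continuous_on S (\<lambda>z::real^'n. (if i = j then 2 * prof1 p (s\<^sup>2 * (z \<bullet> z)) else 0))" for p and i j :: 'n
    by (cases "i = j") (auto intro!: continuous_intros a)
  show ?thesis unfolding ker2_def [abs_def]
    by (intro continuous_intros a b c)
qed

lemma continuous_ker1: "continuous_on S (ker1 s :: real^'n \<Rightarrow> _)"
proof -
  have a: "continuous_on S (\<lambda>z::real^'n. prof1 p (s\<^sup>2 * (z \<bullet> z)))" for p
    by (rule continuous_on_compose2[OF continuous_prof1[of UNIV]]) (auto intro!: continuous_intros)
  show ?thesis unfolding ker1_def [abs_def]
    by (intro continuous_intros a)
qed

lemma continuous_ker0: "s > 0 \<Longrightarrow> continuous_on S (ker0 s :: real^'n \<Rightarrow> _)"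
  by (intro continuous_at_imp_continuous_on ballI has_derivative_continuous[OF has_derivative_ker0])

text \<open>On the power branch the weight s^n cancels the power of s^2, so s disappears. This is
  why kernels of different scales agree away from the origin.\<close>

lemma powr_half_card:
  assumes "s > 0" "t > 0" "s\<^sup>2 * t \<ge> 1"
  shows "s ^ n * prof1 (real n / 2) (s\<^sup>2 * t) = t powr (- (real n / 2))"
proof -
  have "s ^ n = (s\<^sup>2) powr (real n / 2)"
    using assms by (simp add: powr_powr powr_realpow flip: powr_numeral)
  moreover have "prof1 (real n / 2) (s\<^sup>2 * t) = (s\<^sup>2) powr (- (real n / 2)) * t powr (- (real n / 2))"
    using assms by (simp add: prof1_ge1 powr_mult)
  moreover have "(s\<^sup>2) powr (real n / 2) * (s\<^sup>2) powr (- (real n / 2)) = 1"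
    using assms by (simp flip: powr_add)
  ultimately show ?thesis by (metis mult.assoc mult_1)
qed

lemma powr_half_card2:
  assumes "s > 0" "t > 0" "s\<^sup>2 * t \<ge> 1"
  shows "s ^ n * s\<^sup>2 * prof2 (real n / 2) (s\<^sup>2 * t) = - (real n / 2) * t powr (- (real n / 2) - 1)"
proof -
  have "s ^ n * s\<^sup>2 = (s\<^sup>2) powr (real n / 2 + 1)"
    using assms by (simp add: powr_powr powr_realpow powr_add flip: powr_numeral)
  moreover have "prof2 (real n / 2) (s\<^sup>2 * t) = - (real n / 2) * ((s\<^sup>2) powr (- (real n / 2 + 1)) * t powr (- (real n / 2) - 1))"
    using assms by (simp add: prof2_def powr_mult max_def)
  moreover have "(s\<^sup>2) powr (real n / 2 + 1) * (s\<^sup>2) powr (- (real n / 2 + 1)) = 1"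
    using assms by (simp flip: powr_add)
  ultimately have "s ^ n * s\<^sup>2 * prof2 (real n / 2) (s\<^sup>2 * t) = - (real n / 2) * t powr (- (real n / 2) - 1) *
      ((s\<^sup>2) powr (real n / 2 + 1) * (s\<^sup>2) powr (- (real n / 2 + 1)))"
    by simp
  with \<open>(s\<^sup>2) powr (real n / 2 + 1) * (s\<^sup>2) powr (- (real n / 2 + 1)) = 1\<close> show ?thesis by simp
qed

lemma ker1_far:
  fixes z :: "real^'n"
  assumes "s > 0" "s * norm z \<ge> 1"
  shows "ker1 s z = (2 * (z \<bullet> z) powr (- (real CARD('n) / 2))) *\<^sub>R z"
proof -
  have "(s * norm z)\<^sup>2 \<ge> 1" using assms by (metis one_le_power)
  then have 1: "s\<^sup>2 * (z \<bullet> z) \<ge> 1" by (simp add: power_mult_distrib dot_square_norm)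
  then have "z \<bullet> z > 0" using assms by (metis inner_gt_zero_iff inner_zero_left mult_zero_right norm_zero not_one_le_zero)
  with powr_half_card[OF assms(1) this 1] show ?thesis by (simp add: ker1_def)
qed

lemma ker2_far:
  fixes z :: "real^'n"
  assumes "s > 0" "s * norm z \<ge> 1"
  shows "ker2 s z $ i $ j = (if i = j then 2 * (z \<bullet> z) powr (- (real CARD('n) / 2)) else 0)
    - 2 * real CARD('n) * (z \<bullet> z) powr (- (real CARD('n) / 2) - 1) * z $ i * z $ j"
proof -
  have "(s * norm z)\<^sup>2 \<ge> 1" using assms by (metis one_le_power)
  then have 1: "s\<^sup>2 * (z \<bullet> z) \<ge> 1" by (simp add: power_mult_distrib dot_square_norm)
  then have "z \<bullet> z > 0" using assms by (metis inner_gt_zero_iff inner_zero_left mult_zero_right norm_zero not_one_le_zero)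
  note a = powr_half_card[OF assms(1) this 1] powr_half_card2[OF assms(1) this 1]
  have "ker2 s z $ i $ j = (if i = j then 2 * (s ^ CARD('n) * prof1 (real CARD('n) / 2) (s\<^sup>2 * (z \<bullet> z))) else 0)
    + 4 * (s ^ CARD('n) * s\<^sup>2 * prof2 (real CARD('n) / 2) (s\<^sup>2 * (z \<bullet> z))) * z $ i * z $ j"
    by (simp add: ker2_def algebra_simps power2_eq_square)
  then show ?thesis unfolding a by simp
qed

lemma ker2_symmetric: "transpose (ker2 s z) = ker2 s z"
  by (vector transpose_def ker2_def)

text \<open>With p = n/2 the two contributions cancel on the power branch, where the kernel is
  harmonic. On the linear branch 2n(1 + p - pt) - 4pt factors as n(n + 2)(1 - t), so the Laplacian
  is nonnegative and concentrated in the ball of radius 1/s.\<close>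

lemma trace_ker2:
  fixes z :: "real^'n"
  assumes "s > 0"
  shows "trace (ker2 s z) = s ^ CARD('n) * real CARD('n) * (real CARD('n) + 2) * max (1 - s\<^sup>2 * (z \<bullet> z)) 0"
proof -
  let ?p = "real CARD('n) / 2"
  define t where "t = s\<^sup>2 * (z \<bullet> z)"
  have "t \<ge> 0" by (simp add: t_def)
  define P where "P = prof1 ?p t"
  define P' where "P' = prof2 ?p t"
  have "(\<Sum>i\<in>UNIV. 4 * P' * (s * z $ i) * (s * z $ i)) = 4 * P' * t"
    unfolding t_def inner_vec_def sum_distrib_left
    by (intro sum.cong) (auto simp: power2_eq_square algebra_simps)
  then have "trace (ker2 s z) = s ^ CARD('n) * (2 * real CARD('n) * P + 4 * P' * t)"
    unfolding trace_def ker2_def t_def [symmetric] P_def [symmetric] P'_def [symmetric]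
    by (simp add: sum.distrib flip: sum_distrib_left)
  then have "trace (ker2 s z) = s ^ CARD('n) * (2 * real CARD('n) * prof1 ?p t + 4 * prof2 ?p t * t)"
    by (simp add: P_def P'_def)
  also have "2 * real CARD('n) * prof1 ?p t + 4 * prof2 ?p t * t = real CARD('n) * (real CARD('n) + 2) * max (1 - t) 0"
  proof (cases "t \<le> 1")
    case True
    then show ?thesis by (simp add: prof1_def prof2_def max_def field_simps)
  next
    case False
    then have "t powr (- ?p - 1) * t = t powr (- ?p)"
      by (metis add.commute diff_add_cancel less_eq_real_def nle_le not_le order.strict_trans1 powr_mult_base zero_less_one mult.commute \<open>0 \<le> t\<close>)
    with False show ?thesis by (simp add: prof1_def prof2_def)
  qed
  finally show ?thesis by (simp add: t_def)
qed

section \<open>Bounded Lipschitz functions and the regularity of the Hessian kernel\<close>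

definition bdd_lipschitz :: "'a::metric_space set \<Rightarrow> ('a \<Rightarrow> real) \<Rightarrow> bool" where
  "bdd_lipschitz S f \<longleftrightarrow> (\<exists>B. (\<forall>x\<in>S. \<bar>f x\<bar> \<le> B) \<and> (\<forall>x\<in>S. \<forall>y\<in>S. \<bar>f x - f y\<bar> \<le> B * dist x y))"

lemma bdd_lipschitzI:
  assumes "\<And>x. x \<in> S \<Longrightarrow> \<bar>f x\<bar> \<le> B" "\<And>x y. x \<in> S \<Longrightarrow> y \<in> S \<Longrightarrow> \<bar>f x - f y\<bar> \<le> C * dist x y"
  shows "bdd_lipschitz S f"
proof -
  have "\<bar>f x - f y\<bar> \<le> max B C * dist x y" if "x \<in> S" "y \<in> S" for x y
    using assms(2)[OF that] mult_right_mono[of C "max B C" "dist x y"] by auto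
  then show ?thesis
    unfolding bdd_lipschitz_def by (intro exI[of _ "max B C"]) (use assms in \<open>auto simp: le_max_iff_disj\<close>)
qed

lemma bdd_lipschitz_const: "bdd_lipschitz S (\<lambda>_. c)"
  by (rule bdd_lipschitzI[of _ _ "\<bar>c\<bar>" 0]) auto

lemma bdd_lipschitz_add:
  assumes "bdd_lipschitz S f" "bdd_lipschitz S g"
  shows "bdd_lipschitz S (\<lambda>x. f x + g x)"
proof -
  obtain B C where B: "\<And>x. x \<in> S \<Longrightarrow> \<bar>f x\<bar> \<le> B" "\<And>x y. x \<in> S \<Longrightarrow> y \<in> S \<Longrightarrow> \<bar>f x - f y\<bar> \<le> B * dist x y"
    and C: "\<And>x. x \<in> S \<Longrightarrow> \<bar>g x\<bar> \<le> C" "\<And>x y. x \<in> S \<Longrightarrow> y \<in> S \<Longrightarrow> \<bar>g x - g y\<bar> \<le> C * dist x y"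
    using assms unfolding bdd_lipschitz_def by metis
  show ?thesis
  proof (rule bdd_lipschitzI[of _ _ "B + C" "B + C"])
    show "\<bar>f x + g x\<bar> \<le> B + C" if "x \<in> S" for x using B(1)[OF that] C(1)[OF that] by linarith
    show "\<bar>f x + g x - (f y + g y)\<bar> \<le> (B + C) * dist x y" if "x \<in> S" "y \<in> S" for x y
      using B(2)[OF that] C(2)[OF that] unfolding distrib_right by linarith
  qed
qed

text \<open>Lipschitz functions are closed under products only together with bounds, which is why
  \<open>bdd_lipschitz\<close> asks for both and is used on balls.\<close>

lemma bdd_lipschitz_mult:
  assumes "bdd_lipschitz S f" "bdd_lipschitz S g"
  shows "bdd_lipschitz S (\<lambda>x. f x * g x)"
proof -
  obtain B C where B: "\<And>x. x \<in> S \<Longrightarrow> \<bar>f x\<bar> \<le> B" "\<And>x y. x \<in> S \<Longrightarrow> y \<in> S \<Longrightarrow> \<bar>f x - f y\<bar> \<le> B * dist x y"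
    and C: "\<And>x. x \<in> S \<Longrightarrow> \<bar>g x\<bar> \<le> C" "\<And>x y. x \<in> S \<Longrightarrow> y \<in> S \<Longrightarrow> \<bar>g x - g y\<bar> \<le> C * dist x y"
    using assms unfolding bdd_lipschitz_def by metis
  show ?thesis
  proof (rule bdd_lipschitzI[of _ _ "B * C" "2 * (B * C)"])
    show "\<bar>f x * g x\<bar> \<le> B * C" if "x \<in> S" for x
      using mult_mono[OF B(1)[OF that] C(1)[OF that]] B(1)[OF that] by (simp add: abs_mult)
    show "\<bar>f x * g x - f y * g y\<bar> \<le> 2 * (B * C) * dist x y" if "x \<in> S" "y \<in> S" for x y
    proof -
      have "f x * g x - f y * g y = f x * (g x - g y) + (f x - f y) * g y" by (simp add: algebra_simps)
      then have "\<bar>f x * g x - f y * g y\<bar> \<le> \<bar>f x\<bar> * \<bar>g x - g y\<bar> + \<bar>f x - f y\<bar> * \<bar>g y\<bar>"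
        by (metis abs_mult abs_triangle_ineq)
      also have "\<dots> \<le> B * (C * dist x y) + (B * dist x y) * C"
        using B(1)[OF that(1)] B(2)[OF that] C(1)[OF that(2)] C(2)[OF that] that
        by (intro add_mono mult_mono) (auto intro: order_trans[OF abs_ge_zero])
      finally show ?thesis by (simp add: algebra_simps)
    qed
  qed
qed

lemma bdd_lipschitz_compose:
  assumes "bdd_lipschitz S f" and g: "\<And>s t. \<bar>g s - g t\<bar> \<le> L * \<bar>s - t\<bar>" and "L \<ge> 0"
  shows "bdd_lipschitz S (\<lambda>x. g (f x))"
proof -
  obtain B where B: "\<And>x. x \<in> S \<Longrightarrow> \<bar>f x\<bar> \<le> B" "\<And>x y. x \<in> S \<Longrightarrow> y \<in> S \<Longrightarrow> \<bar>f x - f y\<bar> \<le> B * dist x y"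
    using assms unfolding bdd_lipschitz_def by metis
  show ?thesis
  proof (rule bdd_lipschitzI[of _ _ "L * B + \<bar>g 0\<bar>" "L * B"])
    show "\<bar>g (f x)\<bar> \<le> L * B + \<bar>g 0\<bar>" if "x \<in> S" for x
      using g[of "f x" 0] mult_left_mono[OF B(1)[OF that] \<open>L \<ge> 0\<close>] by simp
    show "\<bar>g (f x) - g (f y)\<bar> \<le> L * B * dist x y" if "x \<in> S" "y \<in> S" for x y
      using g[of "f x" "f y"] mult_left_mono[OF B(2)[OF that] \<open>L \<ge> 0\<close>] by (simp add: mult.assoc)
  qed
qed

lemma bdd_lipschitz_nth: "bdd_lipschitz (cball 0 r :: (real^'n) set) (\<lambda>z. z $ i)"
proof (rule bdd_lipschitzI[of _ _ r 1])
  show "\<bar>x $ i\<bar> \<le> r" if "x \<in> cball 0 r" for x :: "real^'n"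
    using component_le_norm_cart[of x i] that by simp
  show "\<bar>x $ i - y $ i\<bar> \<le> 1 * dist x y" for x y :: "real^'n"
    using component_le_norm_cart[of "x - y" i] by (simp add: dist_norm)
qed

lemma bdd_lipschitz_inner: "bdd_lipschitz (cball 0 r :: (real^'n) set) (\<lambda>z. z \<bullet> z)"
proof (cases "r \<ge> 0")
  case True
  show ?thesis
  proof (rule bdd_lipschitzI[of _ _ "r * r" "2 * r"])
    show "\<bar>x \<bullet> x\<bar> \<le> r * r" if "x \<in> cball 0 r" for x :: "real^'n"
      using that True by (auto simp: dot_square_norm power2_eq_square intro!: mult_mono)
    show "\<bar>x \<bullet> x - y \<bullet> y\<bar> \<le> 2 * r * dist x y" if "x \<in> cball 0 r" "y \<in> cball 0 r" for x y :: "real^'n"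
    proof -
      have "x \<bullet> x - y \<bullet> y = (x + y) \<bullet> (x - y)" by (simp add: algebra_simps inner_commute)
      then have "\<bar>x \<bullet> x - y \<bullet> y\<bar> \<le> norm (x + y) * norm (x - y)" by (metis Cauchy_Schwarz_ineq2)
      also have "\<dots> \<le> (2 * r) * norm (x - y)"
        using that norm_triangle_ineq[of x y] by (intro mult_right_mono) auto
      finally show ?thesis by (simp add: dist_norm)
    qed
  qed
qed (simp add: bdd_lipschitz_def)

lemma ker2_scale:
  fixes z :: "real^'n"
  shows "ker2 (s * t) z = s ^ CARD('n) *\<^sub>R ker2 t (s *\<^sub>R z)"
  by (simp add: ker2_def vec_eq_iff power_mult_distrib mult_ac power2_eq_square)

lemma bdd_lipschitz_ker2:
  "bdd_lipschitz (cball 0 r :: (real^'n) set) (\<lambda>z. ker2 s z $ i $ j)"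
proof -
  have p: "real CARD('n) / 2 > 0" by simp
  have t: "bdd_lipschitz (cball 0 r :: (real^'n) set) (\<lambda>z. s\<^sup>2 * (z \<bullet> z))"
    by (intro bdd_lipschitz_mult bdd_lipschitz_const bdd_lipschitz_inner)
  have a: "bdd_lipschitz (cball 0 r :: (real^'n) set) (\<lambda>z. prof1 (real CARD('n) / 2) (s\<^sup>2 * (z \<bullet> z)))"
    by (rule bdd_lipschitz_compose[OF t prof1_Lipschitz[OF p]]) auto
  have b: "bdd_lipschitz (cball 0 r :: (real^'n) set) (\<lambda>z. prof2 (real CARD('n) / 2) (s\<^sup>2 * (z \<bullet> z)))"
    by (rule bdd_lipschitz_compose[OF t prof2_Lipschitz[OF p]]) auto
  have c: "bdd_lipschitz (cball 0 r :: (real^'n) set) (\<lambda>z. if i = j then 2 * prof1 (real CARD('n) / 2) (s\<^sup>2 * (z \<bullet> z)) else 0)"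
    by (cases "i = j") (auto intro!: bdd_lipschitz_mult bdd_lipschitz_const a)
  have "bdd_lipschitz (cball 0 r :: (real^'n) set) (\<lambda>z. s ^ CARD('n) * ((if i = j then 2 * prof1 (real CARD('n) / 2) (s\<^sup>2 * (z \<bullet> z)) else 0)
      + 4 * prof2 (real CARD('n) / 2) (s\<^sup>2 * (z \<bullet> z)) * (s * z $ i) * (s * z $ j)))"
    by (intro bdd_lipschitz_mult bdd_lipschitz_const bdd_lipschitz_add b c bdd_lipschitz_nth)
  then show ?thesis by (simp add: ker2_def)
qed

section \<open>Differences of consecutive dyadic kernels\<close>

definition incr2 :: "nat \<Rightarrow> real^'n \<Rightarrow> real^'n^'n" where
  "incr2 k z = ker2 (2 ^ Suc k) z - ker2 (2 ^ k) z"

definition incr1 :: "nat \<Rightarrow> real^'n \<Rightarrow> real^'n" where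
  "incr1 k z = ker1 (2 ^ Suc k) z - ker1 (2 ^ k) z"

lemma far_Suc:
  assumes "2 ^ k * norm z \<ge> 1"
  shows "2 ^ Suc k * norm z \<ge> 1"
  using assms mult_right_mono[of 1 "2::real" "2 ^ k * norm z"] by simp

lemma incr1_far: "2 ^ k * norm z \<ge> 1 \<Longrightarrow> incr1 k z = 0"
  using far_Suc[of k z] by (simp add: incr1_def ker1_far)

lemma incr2_far: "2 ^ k * norm z \<ge> 1 \<Longrightarrow> incr2 k z = 0"
  using far_Suc[of k z] by (simp add: incr2_def ker2_far vec_eq_iff)

lemma incr2_scale:
  fixes z :: "real^'n"
  shows "incr2 k z = (2 ^ k) ^ CARD('n) *\<^sub>R incr2 0 (2 ^ k *\<^sub>R z)"
  using ker2_scale[of "2 ^ k" 2 z] ker2_scale[of "2 ^ k" 1 z]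
  by (simp add: incr2_def scaleR_diff_right mult.commute)

text \<open>The increment vanishes outside the unit ball, so a Lipschitz bound on the ball of radius
  2 is already global: a point of the unit ball and one beyond radius 2 are at distance at least 1,
  and then the bound on the values suffices.\<close>

lemma incr2_0_bound:
  "\<exists>B. \<forall>z w :: real^'n. \<bar>incr2 0 z $ i $ j\<bar> \<le> B \<and> \<bar>incr2 0 z $ i $ j - incr2 0 w $ i $ j\<bar> \<le> B * norm (z - w)"
proof -
  let ?f = "\<lambda>z::real^'n. incr2 0 z $ i $ j"
  have "bdd_lipschitz (cball 0 2 :: (real^'n) set) (\<lambda>z. ker2 2 z $ i $ j + (-1) * ker2 1 z $ i $ j)"
    by (intro bdd_lipschitz_mult bdd_lipschitz_const bdd_lipschitz_add bdd_lipschitz_ker2)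
  then have "bdd_lipschitz (cball 0 2) ?f"
    by (simp add: incr2_def)
  then obtain B where B: "\<And>x. x \<in> cball 0 2 \<Longrightarrow> \<bar>?f x\<bar> \<le> B"
     "\<And>x y. x \<in> cball 0 2 \<Longrightarrow> y \<in> cball 0 2 \<Longrightarrow> \<bar>?f x - ?f y\<bar> \<le> B * norm (x - y)"
    unfolding bdd_lipschitz_def dist_norm by metis
  have B0: "B \<ge> 0" using B(1)[of 0] by simp
  have far: "?f z = 0" if "norm z \<ge> 1" for z
    using incr2_far[of 0 z] that by simp
  have bd: "\<bar>?f z\<bar> \<le> B" for z
    using B(1)[of z] far[of z] B0 by (cases "norm z \<ge> 1") auto
  have key: "\<bar>?f z - ?f w\<bar> \<le> B * norm (z - w)" if "norm z < 1" for z w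
  proof (cases "norm w \<le> 2")
    case True
    then show ?thesis using B(2)[of z w] that by simp
  next
    case False
    have "norm (z - w) \<ge> 1" using norm_triangle_ineq2[of w z] False that by (simp add: norm_minus_commute)
    then have "B * 1 \<le> B * norm (z - w)" using B0 by (intro mult_left_mono) auto
    then show ?thesis using bd[of z] far[of w] False by simp
  qed
  have "\<bar>?f z - ?f w\<bar> \<le> B * norm (z - w)" for z w
  proof (cases "norm z < 1 \<or> norm w < 1")
    case True
    then show ?thesis using key[of z w] key[of w z] by (auto simp: norm_minus_commute abs_minus_commute)
  next
    case False
    then show ?thesis using far[of z] far[of w] B0 by simp
  qed
  with bd show ?thesis by blast
qed

lemma incr2_bounds:
  obtains B where "B > 0" 
    "\<And>k (z :: real^'n) i j. \<bar>incr2 k z $ i $ j\<bar> \<le> B * (2 ^ k) ^ CARD('n)"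
    "\<And>k (z :: real^'n) w i j. \<bar>incr2 k z $ i $ j - incr2 k w $ i $ j\<bar> \<le> B * (2 ^ k) ^ CARD('n) * (2 ^ k * norm (z - w))"
proof -
  obtain b where b: "\<And>i j (z::real^'n). \<bar>incr2 0 z $ i $ j\<bar> \<le> b i j"
    "\<And>i j (z::real^'n) w. \<bar>incr2 0 z $ i $ j - incr2 0 w $ i $ j\<bar> \<le> b i j * norm (z - w)"
    using incr2_0_bound by metis
  define B where "B = 1 + (\<Sum>i\<in>UNIV. \<Sum>j\<in>UNIV. \<bar>b i j\<bar>)"
  have B: "b i j \<le> B" for i j
  proof -
    have "b i j \<le> \<bar>b i j\<bar>" by simp
    also have "\<dots> \<le> (\<Sum>j\<in>UNIV. \<bar>b i j\<bar>)" by (rule member_le_sum) auto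
    also have "\<dots> \<le> (\<Sum>i\<in>UNIV. \<Sum>j\<in>UNIV. \<bar>b i j\<bar>)"
      by (rule member_le_sum[where f = "\<lambda>i. \<Sum>j\<in>UNIV. \<bar>b i j\<bar>"]) (auto intro: sum_nonneg)
    finally show ?thesis by (simp add: B_def)
  qed
  show ?thesis
  proof
    show "B > 0" unfolding B_def by (intro add_pos_nonneg sum_nonneg) auto
    fix k :: nat and z w :: "real^'n" and i j
    have "\<bar>incr2 0 (2 ^ k *\<^sub>R z) $ i $ j\<bar> \<le> B" using b(1)[of "2 ^ k *\<^sub>R z" i j] B[of i j] by linarith
    then show "\<bar>incr2 k z $ i $ j\<bar> \<le> B * (2 ^ k) ^ CARD('n)"
      by (simp add: incr2_scale[of k z] abs_mult mult.commute[of B])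
    have "\<bar>incr2 0 (2 ^ k *\<^sub>R z) $ i $ j - incr2 0 (2 ^ k *\<^sub>R w) $ i $ j\<bar> \<le> B * norm (2 ^ k *\<^sub>R z - 2 ^ k *\<^sub>R w)"
      using b(2)[of "2 ^ k *\<^sub>R z" i j "2 ^ k *\<^sub>R w"] mult_right_mono[OF B[of i j], of "norm (2 ^ k *\<^sub>R z - 2 ^ k *\<^sub>R w)"]
      by simp
    also have "norm (2 ^ k *\<^sub>R z - 2 ^ k *\<^sub>R w) = 2 ^ k * norm (z - w)"
      by (simp flip: scaleR_diff_right)
    finally show "\<bar>incr2 k z $ i $ j - incr2 k w $ i $ j\<bar> \<le> B * (2 ^ k) ^ CARD('n) * (2 ^ k * norm (z - w))"
      by (simp add: incr2_scale[of k z] incr2_scale[of k w] abs_mult mult.commute[of B] mult.assoc flip: right_diff_distrib)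
  qed
qed

section \<open>Convolution over a fixed box\<close>

text \<open>Half-width 3 leaves a margin of 1 around every point of norm below 2, so a kernel
  supported in the unit ball and centred there is integrated over its whole support. A box is taken
  since \<open>leibniz_rule\<close> and the integrability of continuous functions are formulated for
  \<open>cbox\<close>.\<close>

definition box3 :: "(real^'n) set" where
  "box3 = cbox (vec (-3)) (vec 3)"

definition conv :: "(real^'n \<Rightarrow> 'a::euclidean_space) \<Rightarrow> (real^'n \<Rightarrow> real) \<Rightarrow> real^'n \<Rightarrow> 'a" where
  "conv k f x = integral box3 (\<lambda>y. f y *\<^sub>R k (x - y))"

lemma integrable_box3:
  fixes F :: "real^'n \<Rightarrow> 'a::euclidean_space"
  shows "continuous_on UNIV F \<Longrightarrow> F integrable_on box3"
  unfolding box3_def by (rule integrable_continuous) (rule continuous_on_subset, auto)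

lemma continuous_conv_integrand:
  assumes "continuous_on UNIV k" "continuous_on UNIV f"
  shows "continuous_on UNIV (\<lambda>y::real^'n. f y *\<^sub>R (k (x - y) :: 'a::euclidean_space))"
  by (intro continuous_intros assms continuous_on_compose2[OF assms(1)]) auto

lemmas conv_integrable = integrable_box3[OF continuous_conv_integrand]

text \<open>All derivatives fall on the kernel because f is merely continuous.
  \<open>leibniz_rule\<close> wants the derivative as a bounded linear function, hence the detour
  through \<open>blinfun_inner_right\<close>.\<close>

lemma has_derivative_conv:
  fixes k :: "real^'n \<Rightarrow> real" and k' :: "real^'n \<Rightarrow> real^'n"
  assumes k: "\<And>z. (k has_derivative (\<lambda>h. k' z \<bullet> h)) (at z)"
    and k': "continuous_on UNIV k'" and f: "continuous_on UNIV f"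
  shows "(conv k f has_derivative (\<lambda>h. conv k' f x \<bullet> h)) (at x)"
proof -
  have kc: "continuous_on UNIV k"
    by (intro continuous_at_imp_continuous_on ballI has_derivative_continuous[OF k])
  define fx where "fx x y = blinfun_inner_right (f y *\<^sub>R k' (x - y))" for x y
  have fx: "fx x = blinfun_inner_right \<circ> (\<lambda>y. f y *\<^sub>R k' (x - y))" for x
    by (simp add: fx_def fun_eq_iff)
  have "((\<lambda>x. integral (cbox (vec (-3)) (vec 3)) (\<lambda>y. f y *\<^sub>R k (x - y))) has_derivative
     blinfun_apply (integral (cbox (vec (-3)) (vec 3)) (fx x))) (at x within UNIV)"
  proof (rule leibniz_rule)
    fix x y :: "real^'n"
    have "((\<lambda>x. x - y) has_derivative (\<lambda>h. h)) (at x)"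
      by (auto intro!: derivative_eq_intros)
    from has_derivative_scaleR_right[OF has_derivative_compose[OF this k], of "f y"]
    show "((\<lambda>x. f y *\<^sub>R k (x - y)) has_derivative blinfun_apply (fx x y)) (at x within UNIV)"
      by (rule has_derivative_eq_rhs) (auto simp: fx_def fun_eq_iff)
  next
    show "(\<lambda>y. f y *\<^sub>R k (x - y)) integrable_on cbox (vec (-3)) (vec 3)" for x
      using conv_integrable[OF kc f] by (simp add: box3_def)
    show "continuous_on (UNIV \<times> cbox (vec (-3)) (vec 3)) (\<lambda>(x, t). fx x t)"
      unfolding fx_def split_beta
      by (intro bounded_linear.continuous_on[OF bounded_linear_blinfun_inner_right] continuous_intros
          continuous_on_compose2[OF k'] continuous_on_compose2[OF f]) auto
  qed auto
  moreover have "integral (cbox (vec (-3)) (vec 3)) (fx x) = blinfun_inner_right (conv k' f x)"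
    unfolding fx conv_def box3_def
    by (rule integral_linear[OF _ bounded_linear_blinfun_inner_right])
      (use conv_integrable[OF k' f] in \<open>simp add: box3_def\<close>)
  ultimately show ?thesis
    by (simp add: conv_def [abs_def] box3_def)
qed

lemma conv_nth:
  fixes k :: "real^'n \<Rightarrow> 'a::euclidean_space^'m"
  assumes "continuous_on UNIV k" "continuous_on UNIV f"
  shows "conv k f x $ i = conv (\<lambda>z. k z $ i) f x"
proof -
  have "integral box3 ((\<lambda>v. v $ i) \<circ> (\<lambda>y. f y *\<^sub>R k (x - y))) = integral box3 (\<lambda>y. f y *\<^sub>R k (x - y)) $ i"
    by (rule integral_linear[OF conv_integrable[OF assms] bounded_linear_vec_nth])
  then show ?thesis by (simp add: conv_def o_def)
qed

lemma conv_kernel_diff: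
  assumes "continuous_on UNIV k" "continuous_on UNIV l" "continuous_on UNIV f"
  shows "conv (\<lambda>z. k z - l z) f x = conv k f x - conv l f x"
  unfolding conv_def scaleR_diff_right
  by (rule integral_diff conv_integrable assms)+

lemma conv_kernel_sum:
  assumes "finite I" "\<And>i. i \<in> I \<Longrightarrow> continuous_on UNIV (k i)" "continuous_on UNIV f"
  shows "conv (\<lambda>z. \<Sum>i\<in>I. k i z) f x = (\<Sum>i\<in>I. conv (k i) f x)"
  unfolding conv_def scaleR_sum_right
  by (rule integral_sum[OF assms(1) conv_integrable]) (use assms in auto)

lemma conv_diff:
  assumes "continuous_on UNIV k" "continuous_on UNIV f" "continuous_on UNIV g"
  shows "conv k (\<lambda>y. f y - g y) x = conv k f x - conv k g x"
  unfolding conv_def scaleR_diff_left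
  by (rule integral_diff conv_integrable assms)+

text \<open>The ball that carries the integrand lies in a cube of side 2r. With r of order 2^(-k),
  the volume of that cube absorbs the size 2^(kn) of the k-th increment.\<close>

lemma integral_local_bound:
  fixes F :: "real^'n \<Rightarrow> real"
  assumes F: "continuous_on UNIV F" and "r \<ge> 0"
    and far: "\<And>y. norm (x - y) \<ge> r \<Longrightarrow> F y = 0" and B: "\<And>y. \<bar>F y\<bar> \<le> B"
  shows "\<bar>integral box3 F\<bar> \<le> B * (2 * r) ^ CARD('n)"
proof -
  let ?C = "cbox (x - vec r) (x + vec r)"
  have B0: "B \<ge> 0" using B[of x] by linarith
  have c: "measure lborel ?C = (2 * r) ^ CARD('n)"
    using \<open>r \<ge> 0\<close> by (subst content_cbox_cart) (auto simp: interval_ne_empty_cart)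
  have "((\<lambda>_. B) has_integral (measure lborel ?C *\<^sub>R B)) ?C"
    by (rule has_integral_const)
  then have g: "((\<lambda>y. if y \<in> ?C then B else 0) has_integral (measure lborel ?C *\<^sub>R B)) UNIV"
    by (subst has_integral_restrict_UNIV)
  have gi: "(\<lambda>y. if y \<in> ?C then B else 0) integrable_on box3"
    unfolding box3_def by (rule integrable_on_subcbox[OF has_integral_integrable[OF g]]) auto
  have bd: "norm (F y) \<le> (if y \<in> ?C then B else 0)" for y
  proof (cases "y \<in> ?C")
    case True then show ?thesis using B by simp
  next
    case False
    then obtain i where "\<not> (x $ i - r \<le> y $ i \<and> y $ i \<le> x $ i + r)"
      by (auto simp: mem_box_cart)
    then have "\<bar>(x - y) $ i\<bar> > r" unfolding vector_minus_component by linarith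
    then have "norm (x - y) \<ge> r" using component_le_norm_cart[of "x - y" i] by linarith
    with far False show ?thesis by simp
  qed
  have "norm (integral box3 F) \<le> integral box3 (\<lambda>y. if y \<in> ?C then B else 0)"
    by (rule integral_norm_bound_integral[OF integrable_box3[OF F] gi bd])
  also have "\<dots> \<le> integral UNIV (\<lambda>y. if y \<in> ?C then B else 0)"
    by (rule integral_subset_le[OF _ gi has_integral_integrable[OF g]]) (use B0 in auto)
  also have "\<dots> = B * (2 * r) ^ CARD('n)"
    using g c by (simp add: integral_unique)
  finally show ?thesis by simp
qed

text \<open>After the substitution of x - y for y, the translated box still contains the support of
  the kernel. What matters is that the right-hand side does not depend on x.\<close>

lemma conv_one_near:
  fixes k :: "real^'n \<Rightarrow> 'a::euclidean_space"
  assumes far: "\<And>z. norm z \<ge> 1 \<Longrightarrow> k z = 0" and k: "continuous_on UNIV k" and x: "norm x < 2"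
  shows "conv k (\<lambda>_. 1) x = integral (cbox (vec (-1)) (vec 1)) k"
proof -
  have "integral box3 (\<lambda>y. k (x - y)) = integral (cbox (- vec 3) (- vec (-3))) (\<lambda>y. k (x + y))"
    unfolding box3_def by (subst integral_reflect[symmetric]) simp
  also have "\<dots> = integral (cbox (- vec 3 + x) (- vec (-3) + x)) k"
    using integral_shift_cbox_plus[where a = "- vec 3" and b = "- vec (-3)" and c = x and f = k]
    by (simp only: o_def)
  also have "\<dots> = integral (cbox (vec (-1)) (vec 1)) k"
  proof (rule integral_unique)
    have "(k has_integral integral (cbox (vec (-1)) (vec 1)) k) (cbox (vec (-1)) (vec 1))"
      by (rule integrable_integral, rule integrable_continuous, rule continuous_on_subset[OF k]) auto
    then show "(k has_integral integral (cbox (vec (-1)) (vec 1)) k) (cbox (- vec 3 + x) (- vec (-3) + x))"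
    proof (rule has_integral_on_superset)
      fix z assume z: "z \<notin> cbox (vec (-1)) (vec 1 :: real^'n)"
      then obtain i where "\<not> (-1 \<le> z $ i \<and> z $ i \<le> 1)" by (auto simp: mem_box_cart)
      then have "\<bar>z $ i\<bar> > 1" by linarith
      then show "k z = 0" using component_le_norm_cart[of z i] by (intro far) linarith
    next
      have "\<bar>x $ i\<bar> \<le> 2" for i using component_le_norm_cart[of x i] x by linarith
      then have "-2 \<le> x $ i" "x $ i \<le> 2" for i by (auto simp: abs_le_iff minus_le_iff)
      then have a: "-3 + x $ i \<le> -1" "1 \<le> 3 + x $ i" for i by (smt (verit))+
      show "cbox (vec (-1)) (vec 1) \<subseteq> cbox (- vec 3 + x) (- vec (-3) + x)"
      proof
        fix z :: "real^'n" assume "z \<in> cbox (vec (-1)) (vec 1)"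
        then have "-1 \<le> z $ i" "z $ i \<le> 1" for i by (auto simp: mem_box_cart)
        then have "-3 + x $ i \<le> z $ i" "z $ i \<le> 3 + x $ i" for i
          using a order_trans by blast+
        then show "z \<in> cbox (- vec 3 + x) (- vec (-3) + x)"
          by (simp add: mem_box_cart add.commute)
      qed
    qed
  qed
  finally show ?thesis by (simp add: conv_def)
qed

text \<open>The gradient of a compactly supported function has integral zero. Integration by parts
  is avoided: convolving k with 1 gives a constant on the ball of radius 2, and the derivative of
  that constant is the convolution with \<open>k'\<close>.\<close>

lemma conv_one_derivative_zero:
  fixes k :: "real^'n \<Rightarrow> real" and k' :: "real^'n \<Rightarrow> real^'n"
  assumes k: "\<And>z. (k has_derivative (\<lambda>h. k' z \<bullet> h)) (at z)"
    and k': "continuous_on UNIV k'" and far: "\<And>z. norm z \<ge> 1 \<Longrightarrow> k z = 0" and x: "norm x < 2"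
  shows "conv k' (\<lambda>_. 1) x = 0"
proof -
  have kc: "continuous_on UNIV k"
    by (intro continuous_at_imp_continuous_on ballI has_derivative_continuous[OF k])
  have "(conv k (\<lambda>_. 1) has_derivative (\<lambda>h. conv k' (\<lambda>_. 1) x \<bullet> h)) (at x)"
    by (rule has_derivative_conv[OF k k']) auto
  moreover have "(conv k (\<lambda>_. 1) has_derivative (\<lambda>h. 0)) (at x)"
  proof (rule has_derivative_transform_within_open[OF has_derivative_const])
    show "x \<in> ball 0 2" "open (ball (0::real^'n) 2)" using x by auto
    show "integral (cbox (vec (-1)) (vec 1)) k = conv k (\<lambda>_. 1) y" if "y \<in> ball 0 2" for y
      using that conv_one_near[OF far kc, of y] by simp
  qed
  ultimately have "(\<lambda>h. conv k' (\<lambda>_. 1) x \<bullet> h) = (\<lambda>h. 0)"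
    by (rule has_derivative_unique)
  then show ?thesis by (metis inner_eq_zero_iff)
qed

lemma continuous_incr2: "continuous_on S (incr2 k)"
  unfolding incr2_def [abs_def] by (intro continuous_intros continuous_ker2)

text \<open>This cancellation is what the Schauder estimate lives on. Each row of
  \<open>incr2\<close> is the gradient of a component of \<open>incr1\<close>, which is itself
  compactly supported.\<close>

lemma conv_incr2_one:
  assumes "norm x < 2"
  shows "conv (incr2 k) (\<lambda>_. 1) x = 0"
proof -
  have "conv (\<lambda>z. incr2 k z $ i) (\<lambda>_. 1) x = 0" for i
  proof (rule conv_one_derivative_zero[OF _ _ _ assms, of "\<lambda>z. incr1 k z $ i"])
    show "((\<lambda>z. incr1 k z $ i) has_derivative (\<lambda>h. incr2 k z $ i \<bullet> h)) (at z)" for z :: "real^'a"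
      by (auto simp: incr1_def incr2_def inner_diff_left intro!: has_derivative_diff has_derivative_ker1)
    show "continuous_on UNIV (\<lambda>z. incr2 k z $ i)"
      by (intro continuous_intros continuous_incr2)
    show "incr1 k z $ i = 0" if "norm z \<ge> 1" for z :: "real^'a"
      using mult_mono[of 1 "2 ^ k" 1 "norm z"] that by (simp add: incr1_far)
  qed
  then show ?thesis
    by (simp add: vec_eq_iff[of _ 0] conv_nth[OF continuous_incr2 continuous_on_const])
qed

lemma has_derivative_cart:
  fixes f :: "'a::real_normed_vector \<Rightarrow> real^'m"
  assumes "\<And>i. ((\<lambda>x. f x $ i) has_derivative (\<lambda>h. f' h $ i)) (at x within S)"
  shows "(f has_derivative f') (at x within S)"
  unfolding has_derivative_componentwise_within[of f]
  using assms by (auto simp: Basis_vec_def inner_axis)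

section \<open>Dyadic increments of the second derivatives\<close>

lemma powr_dyadic: "((1::real) / 2 ^ k) powr \<alpha> = (2 powr - \<alpha>) ^ k"
proof -
  have "(2 powr - \<alpha>) ^ k = 2 powr (- \<alpha> * k)" by (simp add: powr_powr flip: powr_realpow)
  also have "\<dots> = (2 powr (- real k)) powr \<alpha>" by (simp add: powr_powr mult.commute)
  also have "2 powr (- real k) = 1 / 2 ^ k" by (simp add: powr_minus powr_realpow field_simps)
  finally show ?thesis by simp
qed

text \<open>The sum is cut at the first K with 2^(-K) at most d. Before K the bound
  \<open>D2\<close> grows geometrically and its last term dominates; from K on the bound
  \<open>D1\<close> decays and its first term dominates. Both are of order
  \<open>d powr \<alpha>\<close>. The two ratios are different from 1 exactly because 0 < \<alpha> <
  1.\<close>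

lemma sum_min_powr_bound:
  fixes D :: "nat \<Rightarrow> real"
  assumes "0 < \<alpha>" "\<alpha> < 1" "C \<ge> 0" "d > 0"
    and D1: "\<And>k. D k \<le> C * (2 powr - \<alpha>) ^ k"
    and D2: "\<And>k. D k \<le> C * ((2 powr - \<alpha>) ^ k * (2 ^ k * d))"
  shows "(\<Sum>k<m. D k) \<le> C * (2 / (2 powr (1 - \<alpha>) - 1) + 1 / (1 - 2 powr - \<alpha>)) * d powr \<alpha>"
proof -
  define q where "q = 2 powr - \<alpha>"
  define p where "p = 2 powr (1 - \<alpha>)"
  have p: "p = 2 * q" by (simp add: p_def q_def powr_diff powr_minus field_simps)
  have q01: "0 < q" "q < 1" using assms by (auto simp: q_def powr_less_one)
  have p1: "p > 1" using assms by (auto simp: p_def)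
  have qpow: "q ^ k = (1 / 2 ^ k) powr \<alpha>" for k
    by (simp add: q_def powr_dyadic)
  have "\<exists>k. 1 / 2 ^ k \<le> d"
    using real_arch_pow_inv[of d "1/2"] assms by (auto simp: power_one_over intro: less_imp_le)
  then obtain K where K: "1 / 2 ^ K \<le> d" and Kmin: "\<And>j. j < K \<Longrightarrow> \<not> 1 / 2 ^ j \<le> d"
    using exists_least_iff[of "\<lambda>k. 1 / 2 ^ k \<le> d"] by metis
  \<comment> \<open>For K = 0 minimality says nothing about d from above, but then the first part of
    the sum is empty.\<close>
  have near: "p ^ K * d \<le> 2 * d powr \<alpha> \<or> K = 0"
  proof (cases K)
    case (Suc j)
    have "1 / 2 ^ j > d" using Kmin[of j] Suc by auto
    then have "2 ^ K \<le> 2 / d" using Suc \<open>d > 0\<close> by (simp add: field_simps)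
    have "p ^ K = (2 ^ K) powr (1 - \<alpha>)"
      by (simp add: p_def powr_powr mult.commute flip: powr_realpow)
    also have "\<dots> \<le> (2 / d) powr (1 - \<alpha>)"
      using \<open>2 ^ K \<le> 2 / d\<close> assms by (intro powr_mono2) auto
    also have "\<dots> = p * d powr \<alpha> / d"
      using \<open>d > 0\<close> by (simp add: powr_divide p_def powr_diff)
    finally have "p ^ K * d \<le> p * d powr \<alpha>" using \<open>d > 0\<close> by (simp add: field_simps)
    also have "\<dots> \<le> 2 * d powr \<alpha>" using p q01 by (intro mult_right_mono) auto
    finally show ?thesis by simp
  qed simp
  have gp: "(\<Sum>k<j. p ^ k) * d \<le> p ^ j * d / (p - 1)" for j
  proof -
    have "(\<Sum>k<j. p ^ k) \<le> p ^ j / (p - 1)"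
      using p1 by (simp add: geometric_sum divide_right_mono)
    from mult_right_mono[OF this, of d] \<open>d > 0\<close> show ?thesis by simp
  qed
  have near': "(\<Sum>k<K. p ^ k) * d \<le> 2 / (p - 1) * d powr \<alpha>"
  proof (cases "K = 0")
    case False
    with near have "p ^ K * d / (p - 1) \<le> 2 * d powr \<alpha> / (p - 1)"
      using p1 by (intro divide_right_mono) auto
    with gp[of K] show ?thesis by simp
  qed (use p1 in auto)
  have far: "(\<Sum>k\<in>{K..<m}. q ^ k) \<le> 1 / (1 - q) * d powr \<alpha>"
  proof -
    have "(\<Sum>k\<in>{K..<m}. q ^ k) \<le> q ^ K / (1 - q)"
    proof -
      have "(1 - q) * (\<Sum>k\<in>{K..<m}. q ^ k) = (if K \<le> m then q ^ K - q ^ m else 0)"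
        by (induction m) (auto simp: algebra_simps le_Suc_eq)
      also have "\<dots> \<le> q ^ K" using q01 by auto
      finally show ?thesis using q01 by (simp add: field_simps)
    qed
    also have "\<dots> \<le> d powr \<alpha> / (1 - q)"
      unfolding qpow using q01 K assms by (intro divide_right_mono powr_mono2) auto
    finally show ?thesis by simp
  qed
  have "(\<Sum>k<m. D k) = (\<Sum>k\<in>{..<m} \<inter> {..<K}. D k) + (\<Sum>k\<in>{..<m} - {..<K}. D k)"
    by (rule sum.Int_Diff) simp
  also have "{..<m} - {..<K} = {K..<m}" by auto
  also have "(\<Sum>k\<in>{..<m} \<inter> {..<K}. D k) \<le> (\<Sum>k\<in>{..<m} \<inter> {..<K}. C * (p ^ k * d))"
    using D2 by (intro sum_mono) (simp add: p q_def power_mult_distrib mult_ac)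
  also have "\<dots> \<le> (\<Sum>k<K. C * (p ^ k * d))"
    using assms p1 by (intro sum_mono2) auto
  also have "\<dots> = C * ((\<Sum>k<K. p ^ k) * d)" by (simp add: sum_distrib_left sum_distrib_right)
  also have "\<dots> \<le> C * (2 / (p - 1) * d powr \<alpha>)" using near' \<open>C \<ge> 0\<close> by (intro mult_left_mono)
  also have "(\<Sum>k\<in>{K..<m}. D k) \<le> (\<Sum>k\<in>{K..<m}. C * q ^ k)"
    using D1 by (intro sum_mono) (simp add: q_def)
  also have "\<dots> \<le> C * (1 / (1 - q) * d powr \<alpha>)"
    using mult_left_mono[OF far \<open>C \<ge> 0\<close>] by (simp add: sum_distrib_left)
  finally show ?thesis by (simp add: p_def q_def algebra_simps)
qed

locale hoelder_data =
  fixes f :: "real^'n \<Rightarrow> real" and M \<alpha> :: real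
  assumes alpha: "0 < \<alpha>" "\<alpha> < 1"
    and bounded: "\<And>x. \<bar>f x\<bar> \<le> M"
    and hoelder: "\<And>x y. \<bar>f x - f y\<bar> \<le> M * norm (x - y) powr \<alpha>"
begin

lemma M_nonneg: "M \<ge> 0"
  using bounded[of 0] by linarith

lemma continuous: "continuous_on UNIV f"
proof (intro continuous_at_imp_continuous_on ballI)
  fix x :: "real^'n"
  have "((\<lambda>y. norm (y - x)) \<longlongrightarrow> 0) (at x)"
    by (rule tendsto_norm_zero[OF LIM_zero[OF tendsto_ident_at]])
  then have "((\<lambda>y. norm (y - x) powr \<alpha>) \<longlongrightarrow> 0) (at x)"
    by (rule tendsto_zero_powrI[OF _ tendsto_const]) (use alpha in auto)
  then have "((\<lambda>y. M * norm (y - x) powr \<alpha>) \<longlongrightarrow> 0) (at x)"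
    by (rule tendsto_mult_right_zero)
  then have "((\<lambda>y. f y - f x) \<longlongrightarrow> 0) (at x)"
    by (rule Lim_null_comparison[rotated]) (simp add: hoelder)
  then show "isCont f x" by (simp add: isCont_def LIM_zero_iff)
qed

lemma conv_diff_const:
  fixes k :: "real^'n \<Rightarrow> real"
  assumes "continuous_on UNIV k"
  shows "conv k f x - c * conv k (\<lambda>_. 1) x = integral box3 (\<lambda>y. (f y - c) * k (x - y))"
proof -
  have "integral box3 (\<lambda>y. (f y - c) *\<^sub>R k (x - y)) = conv k f x - conv k (\<lambda>_. c) x"
    using conv_diff[OF assms continuous continuous_on_const] by (simp add: conv_def)
  also have "conv k (\<lambda>_. c) x = c * conv k (\<lambda>_. 1) x"
    by (simp add: conv_def)
  finally show ?thesis by simp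
qed

lemma continuous_incr2_nth: "continuous_on UNIV (\<lambda>z. incr2 k z $ i $ j)"
  by (intro continuous_intros continuous_incr2)

lemma conv_incr2_nth: "conv (incr2 k) f x $ i $ j = conv (\<lambda>z. incr2 k z $ i $ j) f x"
proof -
  have "continuous_on UNIV (\<lambda>z. incr2 k z $ i)"
    by (intro continuous_intros continuous_incr2)
  then show ?thesis by (simp add: conv_nth continuous_incr2 continuous)
qed

text \<open>Since the increment annihilates constants, any c may be subtracted from f. With c = f x,
  the Hoelder condition gains a factor 2^(-k\<alpha>) on the support of the kernel.\<close>

lemma integral_incr2:
  assumes "norm x < 2"
  shows "conv (incr2 k) f x $ i $ j = integral box3 (\<lambda>y. (f y - c) * incr2 k (x - y) $ i $ j)"
proof -
  have "conv (\<lambda>z. incr2 k z $ i $ j) (\<lambda>_. 1) x = 0"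
    using conv_incr2_one[OF assms, of k] 
    by (metis (no_types) conv_nth continuous_incr2 continuous_on_const continuous_on_component zero_index)
  then show ?thesis
    using conv_diff_const[OF continuous_incr2_nth, of k i j x c] by (simp add: conv_incr2_nth)
qed

lemma hoelder_le: "norm (x - y) \<le> r \<Longrightarrow> \<bar>f x - f y\<bar> \<le> M * r powr \<alpha>"
  using hoelder[of x y] mult_left_mono[OF powr_mono2[of \<alpha> "norm (x - y)" r] M_nonneg] alpha by auto

text \<open>The constants are parameters of the context, rather than obtained in it, because they must not
  depend on \<open>f\<close>.\<close>

context
  fixes B :: real
  assumes B0: "B > 0" 
    and B1: "\<And>k (z :: real^'n) i j. \<bar>incr2 k z $ i $ j\<bar> \<le> B * (2 ^ k) ^ CARD('n)"
    and B2: "\<And>k (z :: real^'n) w i j. \<bar>incr2 k z $ i $ j - incr2 k w $ i $ j\<bar> \<le> B * (2 ^ k) ^ CARD('n) * (2 ^ k * norm (z - w))"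
begin

text \<open>Kernel size times volume of its support is bounded independently of k, so only the
  oscillation of f on a ball of radius 2^(-k) remains.\<close>

lemma increment_bound:
  assumes "norm x < 2"
  shows "\<bar>conv (incr2 k) f x $ i $ j\<bar> \<le> (B * 2 ^ CARD('n) * M) * (2 powr - \<alpha>) ^ k"
proof -
  have "\<bar>integral box3 (\<lambda>y. (f y - f x) * incr2 k (x - y) $ i $ j)\<bar>
     \<le> (M * (1 / 2 ^ k) powr \<alpha> * (B * (2 ^ k) ^ CARD('n))) * (2 * (1 / 2 ^ k)) ^ CARD('n)"
  proof (rule integral_local_bound[where x = x])
    show "continuous_on UNIV (\<lambda>y. (f y - f x) * incr2 k (x - y) $ i $ j)"
      by (intro continuous_intros continuous continuous_on_compose2[OF continuous_incr2[of UNIV]]) auto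
    have far: "incr2 k (x - y) = 0" if "norm (x - y) \<ge> 1 / 2 ^ k" for y
      using that by (intro incr2_far) (simp add: field_simps)
    show "(f y - f x) * incr2 k (x - y) $ i $ j = 0" if "norm (x - y) \<ge> 1 / 2 ^ k" for y
      using far[OF that] by simp
    show "\<bar>(f y - f x) * incr2 k (x - y) $ i $ j\<bar> \<le> M * (1 / 2 ^ k) powr \<alpha> * (B * (2 ^ k) ^ CARD('n))" for y
    proof (cases "norm (x - y) \<ge> 1 / 2 ^ k")
      case True
      then show ?thesis using far[OF True] M_nonneg B0 by simp
    next
      case False
      then have "\<bar>f y - f x\<bar> \<le> M * (1 / 2 ^ k) powr \<alpha>"
        by (intro hoelder_le) (auto simp: norm_minus_commute)
      then show ?thesis using B1[of k "x - y" i j] B0 by (auto simp: abs_mult intro!: mult_mono)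
    qed
  qed auto
  also have "\<dots> = B * 2 ^ CARD('n) * M * (2 powr - \<alpha>) ^ k"
    unfolding powr_dyadic by (simp add: power_mult_distrib power_divide)
  finally show ?thesis using integral_incr2[OF assms, of k i j "f x"] by simp
qed

lemma increment_Lipschitz:
  assumes "norm x < 2" "norm x' < 2"
  shows "\<bar>conv (incr2 k) f x $ i $ j - conv (incr2 k) f x' $ i $ j\<bar> \<le> (2 * B * 4 ^ CARD('n) * M) * (2 powr - \<alpha>) ^ k"
    "\<bar>conv (incr2 k) f x $ i $ j - conv (incr2 k) f x' $ i $ j\<bar> \<le> (2 * B * 4 ^ CARD('n) * M) * ((2 powr - \<alpha>) ^ k * (2 ^ k * norm (x - x')))"
proof -
  have "(2::real) ^ CARD('n) \<le> 4 ^ CARD('n)" by (intro power_mono) auto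
  then have "B * 2 ^ CARD('n) * M * (2 powr - \<alpha>) ^ k \<le> B * 4 ^ CARD('n) * M * (2 powr - \<alpha>) ^ k"
    using B0 M_nonneg by (intro mult_right_mono mult_left_mono) auto
  then show 1: "\<bar>conv (incr2 k) f x $ i $ j - conv (incr2 k) f x' $ i $ j\<bar> \<le> (2 * B * 4 ^ CARD('n) * M) * (2 powr - \<alpha>) ^ k"
    using increment_bound[OF assms(1), of k i j] increment_bound[OF assms(2), of k i j] by linarith
  show "\<bar>conv (incr2 k) f x $ i $ j - conv (incr2 k) f x' $ i $ j\<bar> \<le> (2 * B * 4 ^ CARD('n) * M) * ((2 powr - \<alpha>) ^ k * (2 ^ k * norm (x - x')))"
  proof (cases "norm (x - x') \<le> 1 / 2 ^ k")
    case False
    then have "1 \<le> 2 ^ k * norm (x - x')" by (simp add: field_simps)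
    then have "(2 * B * 4 ^ CARD('n) * M) * ((2 powr - \<alpha>) ^ k * 1) \<le> (2 * B * 4 ^ CARD('n) * M) * ((2 powr - \<alpha>) ^ k * (2 ^ k * norm (x - x')))"
      using B0 M_nonneg by (intro mult_left_mono) auto
    with 1 show ?thesis by simp
  next
    case True
    \<comment> \<open>The same constant \<open>f x\<close> is subtracted at both points, so the
      integrands differ only in the kernel, and its Lipschitz bound supplies the factor
      \<open>2 ^ k * norm (x - x')\<close>. Both supports lie in the ball of radius
      \<open>2 / 2 ^ k\<close> about x, which is where the power of 4 comes from.\<close>
    let ?F = "\<lambda>y. (f y - f x) * incr2 k (x - y) $ i $ j - (f y - f x) * incr2 k (x' - y) $ i $ j"
    let ?B = "M * (2 / 2 ^ k) powr \<alpha> * (B * (2 ^ k) ^ CARD('n) * (2 ^ k * norm (x - x')))"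
    have c: "continuous_on UNIV (\<lambda>y. (f y - f x) * incr2 k (z - y) $ i $ j)" for z
      by (intro continuous_intros continuous continuous_on_compose2[OF continuous_incr2[of UNIV]]) auto
    have "\<bar>integral box3 ?F\<bar> \<le> ?B * (2 * (2 / 2 ^ k)) ^ CARD('n)"
    proof (rule integral_local_bound[where x = x])
      show "continuous_on UNIV ?F" by (intro continuous_intros c)
      have far: "incr2 k (x - y) = 0" "incr2 k (x' - y) = 0" if "norm (x - y) \<ge> 2 / 2 ^ k" for y
      proof -
        have "norm (x - y) \<le> norm (x' - y) + norm (x - x')"
          using norm_triangle_ineq[of "x - x'" "x' - y"] by simp
        with that True have "norm (x' - y) \<ge> 1 / 2 ^ k" by simp
        then show "incr2 k (x' - y) = 0" by (intro incr2_far) (simp add: field_simps)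
        have "1 / (2::real) ^ k \<le> 2 / 2 ^ k" by (simp add: divide_right_mono)
        with that have "norm (x - y) \<ge> 1 / 2 ^ k" by linarith
        then show "incr2 k (x - y) = 0" by (intro incr2_far) (simp add: field_simps)
      qed
      show "?F y = 0" if "norm (x - y) \<ge> 2 / 2 ^ k" for y
        using far[OF that] by simp
      show "\<bar>?F y\<bar> \<le> ?B" for y
      proof (cases "norm (x - y) \<ge> 2 / 2 ^ k")
        case True
        then show ?thesis using far[OF True] M_nonneg B0 by simp
      next
        case False
        then have "\<bar>f y - f x\<bar> \<le> M * (2 / 2 ^ k) powr \<alpha>"
          by (intro hoelder_le) (auto simp: norm_minus_commute)
        then show ?thesis using B2[of k "x - y" i j "x' - y"] B0
          unfolding right_diff_distrib [symmetric] abs_mult by (intro mult_mono) auto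
      qed
    qed auto
    also have "\<dots> = (2 powr \<alpha>) * (B * 4 ^ CARD('n) * M) * ((2 powr - \<alpha>) ^ k * (2 ^ k * norm (x - x')))"
    proof -
      have "(2 / 2 ^ k) powr \<alpha> = 2 powr \<alpha> * (2 powr - \<alpha>) ^ k"
        unfolding powr_dyadic [symmetric] by (simp add: powr_divide)
      then show ?thesis by (simp add: power_mult_distrib power_divide)
    qed
    also have "\<dots> \<le> 2 * (B * 4 ^ CARD('n) * M) * ((2 powr - \<alpha>) ^ k * (2 ^ k * norm (x - x')))"
      using B0 M_nonneg alpha powr_mono[of \<alpha> 1 2] by (intro mult_right_mono) auto
    also have "integral box3 ?F = conv (incr2 k) f x $ i $ j - conv (incr2 k) f x' $ i $ j"
      unfolding integral_incr2[OF assms(1), of k i j "f x"] integral_incr2[OF assms(2), of k i j "f x"]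
      by (rule integral_diff integrable_box3 c)+
    finally show ?thesis by (simp add: mult.assoc)
  qed
qed

end

end

section \<open>The potentials as limits, and bounds for the kernel at scale one\<close>

definition newton2 :: "(real^'n \<Rightarrow> real) \<Rightarrow> real^'n \<Rightarrow> real^'n^'n" where
  "newton2 f x = lim (\<lambda>k. conv (ker2 (2 ^ k)) f x)"

definition newton1 :: "(real^'n \<Rightarrow> real) \<Rightarrow> real^'n \<Rightarrow> real^'n" where
  "newton1 f x = lim (\<lambda>k. conv (ker1 (2 ^ k)) f x - conv (ker1 (2 ^ k)) f 0)"

text \<open>Away from the origin the kernels \<open>ker0\<close> of different scales differ by
  constants, which need not converge; subtracting the value at 0 removes them. Subtracting the
  linear part as well makes the gradient vanish at 0.\<close>

definition newton0 :: "(real^'n \<Rightarrow> real) \<Rightarrow> real^'n \<Rightarrow> real" where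
  "newton0 f x = lim (\<lambda>k. conv (ker0 (2 ^ k)) f x - conv (ker0 (2 ^ k)) f 0 - conv (ker1 (2 ^ k)) f 0 \<bullet> x)"

lemma norm_box3: "y \<in> box3 \<Longrightarrow> norm (y :: real^'n) \<le> 3 * real CARD('n)"
proof -
  assume "y \<in> box3"
  then have "\<bar>y $ i\<bar> \<le> 3" for i by (auto simp: box3_def mem_box_cart abs_le_iff minus_le_iff)
  then have "(\<Sum>i\<in>UNIV. \<bar>y $ i\<bar>) \<le> (\<Sum>i\<in>(UNIV::'n set). 3)" by (intro sum_mono)
  then show ?thesis using norm_le_l1_cart[of y] by simp
qed

lemma integral_box3_bound:
  fixes F :: "real^'n \<Rightarrow> real"
  assumes "continuous_on UNIV F" "\<And>y. y \<in> box3 \<Longrightarrow> \<bar>F y\<bar> \<le> B" "B \<ge> 0"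
  shows "\<bar>integral box3 F\<bar> \<le> B * measure lborel (box3 :: (real^'n) set)"
  using has_integral_bound[OF assms(3) integrable_integral[OF integrable_box3[OF assms(1), unfolded box3_def]]] assms(2)
  by (simp add: box3_def)

text \<open>The kernel at which the telescoping starts is not compactly supported, so it is
  controlled only on a ball large enough for all differences of points of the unit ball and of the
  box.\<close>

lemma ker2_bounds:
  obtains B where "B > 0" 
    "\<And>(z :: real^'n) i j. norm z \<le> r \<Longrightarrow> \<bar>ker2 1 z $ i $ j\<bar> \<le> B"
    "\<And>(z :: real^'n) w i j. norm z \<le> r \<Longrightarrow> norm w \<le> r \<Longrightarrow> \<bar>ker2 1 z $ i $ j - ker2 1 w $ i $ j\<bar> \<le> B * norm (z - w)"
proof -
  have "\<forall>i j. \<exists>b. (\<forall>z\<in>cball 0 r. \<bar>ker2 1 (z::real^'n) $ i $ j\<bar> \<le> b) \<and>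
    (\<forall>z\<in>cball 0 r. \<forall>w\<in>cball 0 r. \<bar>ker2 1 z $ i $ j - ker2 1 w $ i $ j\<bar> \<le> b * norm (z - w))"
    using bdd_lipschitz_ker2[of r 1] unfolding bdd_lipschitz_def dist_norm by blast
  then obtain b where b: "\<And>i j (z::real^'n). norm z \<le> r \<Longrightarrow> \<bar>ker2 1 z $ i $ j\<bar> \<le> b i j"
    "\<And>i j (z::real^'n) w. norm z \<le> r \<Longrightarrow> norm w \<le> r \<Longrightarrow> \<bar>ker2 1 z $ i $ j - ker2 1 w $ i $ j\<bar> \<le> b i j * norm (z - w)"
    by (simp add: Ball_def) metis
  define B where "B = 1 + (\<Sum>i\<in>UNIV. \<Sum>j\<in>UNIV. \<bar>b i j\<bar>)"
  have B: "b i j \<le> B" for i j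
  proof -
    have "b i j \<le> \<bar>b i j\<bar>" by simp
    also have "\<dots> \<le> (\<Sum>j\<in>UNIV. \<bar>b i j\<bar>)" by (rule member_le_sum) auto
    also have "\<dots> \<le> (\<Sum>i\<in>UNIV. \<Sum>j\<in>UNIV. \<bar>b i j\<bar>)"
      by (rule member_le_sum[where f = "\<lambda>i. \<Sum>j\<in>UNIV. \<bar>b i j\<bar>"]) (auto intro: sum_nonneg)
    finally show ?thesis by (simp add: B_def)
  qed
  show ?thesis
  proof
    show "B > 0" unfolding B_def by (intro add_pos_nonneg sum_nonneg) auto
    show "\<bar>ker2 1 z $ i $ j\<bar> \<le> B" if "norm z \<le> r" for z :: "real^'n" and i j
      using b(1)[OF that, of i j] B[of i j] by linarith
    show "\<bar>ker2 1 z $ i $ j - ker2 1 w $ i $ j\<bar> \<le> B * norm (z - w)" if "norm z \<le> r" "norm w \<le> r" for z w :: "real^'n" and i j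
      using b(2)[OF that, of i j] mult_right_mono[OF B[of i j], of "norm (z - w)"] by simp
  qed
qed

lemma trace_conv:
  fixes K :: "real^'n \<Rightarrow> real^'n^'n"
  assumes "continuous_on UNIV K" "continuous_on UNIV f"
  shows "trace (conv K f x) = conv (\<lambda>z. trace (K z)) f x"
proof -
  have c: "continuous_on UNIV (\<lambda>z. K z $ i)" for i
    by (intro continuous_intros assms)
  then show ?thesis unfolding trace_def
    by (subst conv_kernel_sum) (auto intro!: continuous_intros assms simp: conv_nth assms)
qed

text \<open>The mass is the same at every scale because the increments integrate to zero, and
  positive because the trace is continuous, nonnegative and nonzero at the origin. Division by it
  normalises the right inverse of the Laplacian.\<close>

lemma kernel_mass:
  obtains c where "c > 0" "\<And>k (x :: real^'n). norm x < 2 \<Longrightarrow> conv (\<lambda>z. trace (ker2 (2 ^ k) z)) (\<lambda>_. 1) x = c"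
proof -
  let ?\<phi> = "\<lambda>z::real^'n. trace (ker2 1 z)"
  let ?c = "integral (cbox (vec (-1)) (vec 1)) ?\<phi>"
  have tc: "continuous_on S (\<lambda>z::real^'n. trace (ker2 s z))" for S s
    unfolding trace_def by (intro continuous_intros continuous_ker2)
  have far: "?\<phi> z = 0" if "norm z \<ge> 1" for z
  proof -
    have "1 \<le> z \<bullet> z" using that by (simp add: dot_square_norm)
    then show ?thesis by (simp add: trace_ker2)
  qed
  have nonneg: "?\<phi> z \<ge> 0" for z
    by (simp add: trace_ker2)
  have i: "(?\<phi> has_integral ?c) (cbox (vec (-1)) (vec 1))"
    by (intro integrable_integral integrable_continuous tc)
  have "?c \<ge> 0"
    by (rule has_integral_nonneg[OF i]) (use nonneg in auto)
  moreover have "?c \<noteq> 0"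
  proof
    assume "?c = 0"
    have "(0 :: real^'n) \<in> box (vec (-1)) (vec 1)" by (simp add: mem_box_cart)
    then have ne: "box (vec (-1)) (vec 1 :: real^'n) \<noteq> {}" by blast
    have i0: "(?\<phi> has_integral 0) (cbox (vec (-1)) (vec 1))"
      using i unfolding \<open>?c = 0\<close> .
    have "(0 :: real^'n) \<in> cbox (vec (-1)) (vec 1)" by (simp add: mem_box_cart)
    from has_integral_0_cbox_imp_0[OF tc nonneg i0 ne this] have "?\<phi> 0 = 0" .
    then show False by (simp add: trace_ker2)
  qed
  ultimately have "?c > 0" by simp
  moreover have "conv (\<lambda>z. trace (ker2 (2 ^ k) z)) (\<lambda>_. 1) x = ?c" if "norm x < 2" for k and x :: "real^'n"
  proof (induction k)
    case 0
    then show ?case using conv_one_near[of ?\<phi> x, OF far tc that] by simp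
  next
    case (Suc k)
    have "trace (conv (incr2 k) (\<lambda>_. 1) x) = 0"
      using conv_incr2_one[OF that] by (simp add: trace_def)
    moreover have "conv (incr2 k) (\<lambda>_. 1) x = conv (ker2 (2 ^ Suc k)) (\<lambda>_. 1) x - conv (ker2 (2 ^ k)) (\<lambda>_. 1) x"
      unfolding incr2_def [abs_def] by (rule conv_kernel_diff) (auto intro: continuous_ker2)
    ultimately have "trace (conv (ker2 (2 ^ Suc k)) (\<lambda>_. 1) x) = trace (conv (ker2 (2 ^ k)) (\<lambda>_. 1) x)"
      by (simp add: trace_def sum_subtractf)
    with Suc show ?case by (simp add: trace_conv continuous_ker2)
  qed
  ultimately show ?thesis using that by blast
qed

lemma le_two_powr:
  fixes d \<alpha> :: real
  assumes "0 \<le> d" "d \<le> 2" "0 < \<alpha>" "\<alpha> < 1"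
  shows "d \<le> 2 * d powr \<alpha>"
proof (cases "d = 0")
  case False
  have "d = d powr (1 - \<alpha>) * d powr \<alpha>" using assms False by (simp flip: powr_add)
  also have "d powr (1 - \<alpha>) \<le> 2 powr (1 - \<alpha>)" using assms by (intro powr_mono2) auto
  also have "(2::real) powr (1 - \<alpha>) \<le> 2 powr 1" using assms by (intro powr_mono) auto
  finally show ?thesis by (simp add: mult_right_mono)
qed simp

section \<open>Hoelder bounds for the Hessian of the potential\<close>

context hoelder_data
begin

lemma conv_ker2_nth: "conv (ker2 s) f x $ i $ j = conv (\<lambda>z. ker2 s z $ i $ j) f x"
proof -
  have "continuous_on UNIV (\<lambda>z::real^'n. ker2 s z $ i)"
    by (intro continuous_intros continuous_ker2)
  then show ?thesis by (simp add: conv_nth continuous_ker2 continuous)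
qed

context
  fixes A r :: real
  assumes r: "r = 3 * real CARD('n) + 1" and A0: "A > 0"
    and A1: "\<And>(z :: real^'n) i j. norm z \<le> r \<Longrightarrow> \<bar>ker2 1 z $ i $ j\<bar> \<le> A"
    and A2: "\<And>(z :: real^'n) w i j. norm z \<le> r \<Longrightarrow> norm w \<le> r \<Longrightarrow> \<bar>ker2 1 z $ i $ j - ker2 1 w $ i $ j\<bar> \<le> A * norm (z - w)"
begin

lemma conv_ker2_integral: "conv (ker2 s) f x $ i $ j = integral box3 (\<lambda>y. f y * ker2 s (x - y) $ i $ j)"
  unfolding conv_ker2_nth by (simp add: conv_def)

lemma continuous_conv_ker2_integrand: "continuous_on UNIV (\<lambda>y. f y * ker2 s (x - y) $ i $ j)"
  by (intro continuous_intros continuous continuous_on_compose2[OF continuous_ker2[of UNIV]]) auto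

lemma norm_diff_box3: "norm (x :: real^'n) \<le> 1 \<Longrightarrow> y \<in> box3 \<Longrightarrow> norm (x - y) \<le> r"
  using norm_triangle_ineq4[of x y] norm_box3[of y] by (simp add: r)

lemma conv_ker2_bound:
  assumes "norm x \<le> 1"
  shows "\<bar>conv (ker2 1) f x $ i $ j\<bar> \<le> M * A * measure lborel (box3 :: (real^'n) set)"
proof -
  have "\<bar>integral box3 (\<lambda>y. f y * ker2 1 (x - y) $ i $ j)\<bar> \<le> M * A * measure lborel (box3 :: (real^'n) set)"
    by (rule integral_box3_bound[OF continuous_conv_ker2_integrand])
      (use bounded A1 norm_diff_box3[OF assms] M_nonneg A0 in \<open>auto simp: abs_mult intro!: mult_mono\<close>)
  then show ?thesis by (simp add: conv_ker2_integral)
qed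

lemma conv_ker2_Lipschitz:
  assumes "norm x \<le> 1" "norm x' \<le> 1"
  shows "\<bar>conv (ker2 1) f x $ i $ j - conv (ker2 1) f x' $ i $ j\<bar> \<le>
    M * (A * norm (x - x')) * measure lborel (box3 :: (real^'n) set)"
proof -
  let ?F = "\<lambda>y. f y * ker2 1 (x - y) $ i $ j - f y * ker2 1 (x' - y) $ i $ j"
  have "\<bar>integral box3 ?F\<bar> \<le> M * (A * norm (x - x')) * measure lborel (box3 :: (real^'n) set)"
  proof (rule integral_box3_bound)
    show "continuous_on UNIV ?F" by (intro continuous_intros continuous_conv_ker2_integrand)
    fix y :: "real^'n" assume "y \<in> box3"
    then have "\<bar>ker2 1 (x - y) $ i $ j - ker2 1 (x' - y) $ i $ j\<bar> \<le> A * norm (x - x')"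
      using A2[of "x - y" "x' - y" i j] norm_diff_box3 assms by simp
    then show "\<bar>?F y\<bar> \<le> M * (A * norm (x - x'))"
      unfolding right_diff_distrib [symmetric] abs_mult using bounded A0 M_nonneg by (intro mult_mono) auto
  qed (use A0 M_nonneg in auto)
  moreover have "integral box3 ?F = conv (ker2 1) f x $ i $ j - conv (ker2 1) f x' $ i $ j"
    unfolding conv_ker2_integral
    by (rule integral_diff integrable_box3 continuous_conv_ker2_integrand)+
  ultimately show ?thesis by simp
qed

context
  fixes B q C1 :: real
  assumes q: "q = 2 powr - \<alpha>" and C1: "C1 = B * 2 ^ CARD('n) * M / (1 - q)"
    and B0: "B > 0" 
    and B1: "\<And>k (z :: real^'n) i j. \<bar>incr2 k z $ i $ j\<bar> \<le> B * (2 ^ k) ^ CARD('n)"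
    and B2: "\<And>k (z :: real^'n) w i j. \<bar>incr2 k z $ i $ j - incr2 k w $ i $ j\<bar> \<le> B * (2 ^ k) ^ CARD('n) * (2 ^ k * norm (z - w))"
begin

lemma conv_ker2_telescope:
  "conv (ker2 (2 ^ (k + m))) f x = conv (ker2 (2 ^ k)) f x + (\<Sum>j<m. conv (incr2 (k + j)) f x)"
proof (induction m)
  case (Suc m)
  have "conv (incr2 (k + m)) f x = conv (ker2 (2 ^ Suc (k + m))) f x - conv (ker2 (2 ^ (k + m))) f x"
    unfolding incr2_def [abs_def] by (intro conv_kernel_diff continuous_ker2 continuous)
  with Suc show ?case by simp
qed simp

lemma q01: "0 < q" "q < 1"
  using alpha by (auto simp: q powr_less_one)

lemma C1_nonneg: "C1 \<ge> 0"
  using q01 M_nonneg B0 by (simp add: C1)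

lemma conv_ker2_Cauchy:
  assumes "norm x < 2"
  shows "\<bar>conv (ker2 (2 ^ (k + m))) f x $ i $ j - conv (ker2 (2 ^ k)) f x $ i $ j\<bar> \<le> C1 * q ^ k"
proof -
  have "\<bar>\<Sum>l<m. conv (incr2 (k + l)) f x $ i $ j\<bar> \<le> (\<Sum>l<m. \<bar>conv (incr2 (k + l)) f x $ i $ j\<bar>)"
    by (rule sum_abs)
  also have "\<dots> \<le> (\<Sum>l<m. (B * 2 ^ CARD('n) * M) * q ^ k * q ^ l)"
    by (intro sum_mono order_trans[OF increment_bound[OF B0 B1 B2 assms]]) (simp add: power_add mult.assoc q)
  also have "\<dots> = (B * 2 ^ CARD('n) * M) * q ^ k * (\<Sum>l<m. q ^ l)"
    by (simp add: sum_distrib_left)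
  also have "(\<Sum>l<m. q ^ l) \<le> 1 / (1 - q)"
    using q01 by (simp add: sum_gp_strict divide_right_mono)
  also have "B * 2 ^ CARD('n) * M * q ^ k * (1 / (1 - q)) = C1 * q ^ k" by (simp add: C1)
  finally show ?thesis
    using B0 M_nonneg q01 by (simp add: conv_ker2_telescope mult_left_mono)
qed

lemma newton2_limit:
  assumes x: "norm x < 2"
  shows "(\<lambda>k. conv (ker2 (2 ^ k)) f x) \<longlonglongrightarrow> newton2 f x"
proof -
  have "convergent (\<lambda>k. conv (ker2 (2 ^ k)) f x $ i $ j)" for i j
  proof (rule Cauchy_convergent, rule metric_CauchyI)
    fix e :: real assume "e > 0"
    have "(\<lambda>k. C1 * q ^ k) \<longlonglongrightarrow> C1 * 0"
      using q01 by (intro tendsto_intros LIMSEQ_power_zero) auto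
    then have "\<forall>\<^sub>F k in sequentially. C1 * q ^ k < e / 2"
      using \<open>e > 0\<close> by (intro order_tendstoD(2)) auto
    then obtain K where K: "C1 * q ^ K < e / 2" by (auto simp: eventually_sequentially)
    have near: "\<bar>conv (ker2 (2 ^ m)) f x $ i $ j - conv (ker2 (2 ^ K)) f x $ i $ j\<bar> < e / 2" if "m \<ge> K" for m
      using conv_ker2_Cauchy[OF x, of K "m - K" i j] K that by simp
    show "\<exists>K. \<forall>m\<ge>K. \<forall>n\<ge>K. dist (conv (ker2 (2 ^ m)) f x $ i $ j) (conv (ker2 (2 ^ n)) f x $ i $ j) < e"
      unfolding dist_real_def
      using abs_triangle_half_l[OF near near] by blast
  qed
  then have "(\<lambda>k. conv (ker2 (2 ^ k)) f x $ i $ j) \<longlonglongrightarrow> lim (\<lambda>k. conv (ker2 (2 ^ k)) f x $ i $ j)" for i j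
    by (simp add: convergent_LIMSEQ_iff)
  then have "(\<lambda>k. conv (ker2 (2 ^ k)) f x) \<longlonglongrightarrow> (\<chi> i j. lim (\<lambda>k. conv (ker2 (2 ^ k)) f x $ i $ j))"
    by (intro vec_tendstoI) simp
  then show ?thesis unfolding newton2_def by (metis limI)
qed

lemma newton2_limit_nth:
  "norm x < 2 \<Longrightarrow> (\<lambda>k. conv (ker2 (2 ^ k)) f x $ i $ j) \<longlonglongrightarrow> newton2 f x $ i $ j"
  by (intro tendsto_vec_nth newton2_limit)

lemma newton2_approx:
  assumes "norm x < 2"
  shows "\<bar>newton2 f x $ i $ j - conv (ker2 (2 ^ k)) f x $ i $ j\<bar> \<le> C1 * q ^ k"
proof (rule tendsto_upperbound)
  show "(\<lambda>m. \<bar>conv (ker2 (2 ^ (k + m))) f x $ i $ j - conv (ker2 (2 ^ k)) f x $ i $ j\<bar>)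
     \<longlonglongrightarrow> \<bar>newton2 f x $ i $ j - conv (ker2 (2 ^ k)) f x $ i $ j\<bar>"
    using LIMSEQ_ignore_initial_segment[OF newton2_limit_nth[OF assms, of i j], of k]
    by (intro tendsto_rabs tendsto_diff tendsto_const) (simp add: add.commute)
qed (use conv_ker2_Cauchy[OF assms] in auto)

lemma newton2_bound:
  assumes "norm x \<le> 1"
  shows "\<bar>newton2 f x $ i $ j\<bar> \<le> (A * measure lborel (box3 :: (real^'n) set) + B * 2 ^ CARD('n) / (1 - q)) * M"
  using newton2_approx[of x i j 0] conv_ker2_bound[OF assms, of i j] assms by (simp add: algebra_simps C1)

text \<open>The kernel at scale one contributes a Lipschitz function. The increments, each bounded
  in two ways by \<open>increment_Lipschitz\<close>, are summed by
  \<open>sum_min_powr_bound\<close>. The bound is uniform in the number of increments, so it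
  survives the limit.\<close>

lemma newton2_hoelder:
  assumes x: "norm x \<le> 1" "norm x' \<le> 1"
  shows "\<bar>newton2 f x $ i $ j - newton2 f x' $ i $ j\<bar> \<le>
    (2 * A * measure lborel (box3 :: (real^'n) set) +
     2 * B * 4 ^ CARD('n) * (2 / (2 powr (1 - \<alpha>) - 1) + 1 / (1 - q))) * M * norm (x - x') powr \<alpha>"
proof (cases "x = x'")
  case False
  define d where "d = norm (x - x')"
  have d: "d > 0" "d \<le> 2" using False norm_triangle_ineq4[of x x'] x by (auto simp: d_def)
  let ?V = "measure lborel (box3 :: (real^'n) set)"
  let ?D = "\<lambda>k. conv (ker2 (2 ^ k)) f x $ i $ j - conv (ker2 (2 ^ k)) f x' $ i $ j"
  let ?E = "\<lambda>k. conv (incr2 k) f x $ i $ j - conv (incr2 k) f x' $ i $ j"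
  have bd: "\<bar>?D m\<bar> \<le> (2 * A * ?V + 2 * B * 4 ^ CARD('n) * (2 / (2 powr (1 - \<alpha>) - 1) + 1 / (1 - q))) * M * d powr \<alpha>" for m
  proof -
    have "?D m = ?D 0 + (\<Sum>k<m. ?E k)"
      using conv_ker2_telescope[of 0 m x] conv_ker2_telescope[of 0 m x'] by (simp add: sum_subtractf)
    then have "\<bar>?D m\<bar> \<le> \<bar>?D 0\<bar> + \<bar>\<Sum>k<m. ?E k\<bar>" by (simp only: abs_triangle_ineq)
    also have "\<bar>\<Sum>k<m. ?E k\<bar> \<le> (\<Sum>k<m. \<bar>?E k\<bar>)" by (rule sum_abs)
    also have "\<dots> \<le> (2 * B * 4 ^ CARD('n) * M) * (2 / (2 powr (1 - \<alpha>) - 1) + 1 / (1 - q)) * d powr \<alpha>"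
      using increment_Lipschitz[OF B0 B1 B2, of x x'] alpha d x B0 M_nonneg
      unfolding q by (intro sum_min_powr_bound) (auto simp: d_def)
    also have "\<bar>?D 0\<bar> \<le> M * (A * d) * ?V"
      using conv_ker2_Lipschitz[OF x, of i j] by (simp add: d_def)
    also have "\<dots> \<le> M * (A * (2 * d powr \<alpha>)) * ?V"
      using le_two_powr[of d \<alpha>] d alpha M_nonneg A0 by (intro mult_right_mono mult_left_mono) auto
    finally show ?thesis by (simp add: algebra_simps)
  qed
  have "(\<lambda>m. \<bar>?D m\<bar>) \<longlonglongrightarrow> \<bar>newton2 f x $ i $ j - newton2 f x' $ i $ j\<bar>"
    using x by (intro tendsto_intros newton2_limit_nth) auto
  from tendsto_upperbound[OF this] bd show ?thesis by (simp add: d_def)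
qed simp

end

end

end

section \<open>The Newton potential\<close>

context hoelder_data
begin

text \<open>For the convergence arguments the constant may depend on f, so the parameters of the
  contexts are instantiated and forgotten here.\<close>

lemma newton2_uniform:
  obtains C q where "C \<ge> 0" "0 < q" "q < 1"
    "\<And>x k i j. norm x < 2 \<Longrightarrow> \<bar>newton2 f x $ i $ j - conv (ker2 (2 ^ k)) f x $ i $ j\<bar> \<le> C * q ^ k"
proof -
  obtain A where A: "A > 0"
    "\<And>(z :: real^'n) i j. norm z \<le> 3 * real CARD('n) + 1 \<Longrightarrow> \<bar>ker2 1 z $ i $ j\<bar> \<le> A"
    "\<And>(z :: real^'n) w i j. norm z \<le> 3 * real CARD('n) + 1 \<Longrightarrow> norm w \<le> 3 * real CARD('n) + 1 \<Longrightarrow>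
       \<bar>ker2 1 z $ i $ j - ker2 1 w $ i $ j\<bar> \<le> A * norm (z - w)"
    using ker2_bounds by blast
  obtain B where B: "B > 0" "\<And>k (z :: real^'n) i j. \<bar>incr2 k z $ i $ j\<bar> \<le> B * (2 ^ k) ^ CARD('n)"
    "\<And>k (z :: real^'n) w i j. \<bar>incr2 k z $ i $ j - incr2 k w $ i $ j\<bar> \<le> B * (2 ^ k) ^ CARD('n) * (2 ^ k * norm (z - w))"
    using incr2_bounds by blast
  show ?thesis
    by (rule that[OF C1_nonneg[OF refl A refl refl B] q01[OF refl A refl refl B] newton2_approx[OF refl A refl refl B]])
qed

lemma conv_ker2_tendsto:
  assumes "norm x < 2"
  shows "(\<lambda>k. conv (ker2 (2 ^ k)) f x) \<longlonglongrightarrow> newton2 f x"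
proof (intro vec_tendstoI)
  fix i j
  obtain C q where C: "0 < q" "q < 1"
    "\<And>k. \<bar>newton2 f x $ i $ j - conv (ker2 (2 ^ k)) f x $ i $ j\<bar> \<le> C * q ^ k"
    using newton2_uniform assms by metis
  have "(\<lambda>k. C * q ^ k) \<longlonglongrightarrow> 0"
    using C by (intro tendsto_mult_right_zero LIMSEQ_power_zero) auto
  then have "(\<lambda>k. newton2 f x $ i $ j - conv (ker2 (2 ^ k)) f x $ i $ j) \<longlonglongrightarrow> 0"
    by (rule Lim_null_comparison[rotated]) (use C in simp)
  then have "(\<lambda>k. newton2 f x $ i $ j - (newton2 f x $ i $ j - conv (ker2 (2 ^ k)) f x $ i $ j)) \<longlonglongrightarrow> newton2 f x $ i $ j - 0"
    by (intro tendsto_diff tendsto_const)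
  then show "(\<lambda>k. conv (ker2 (2 ^ k)) f x $ i $ j) \<longlonglongrightarrow> newton2 f x $ i $ j"
    by simp
qed

abbreviation approx1 :: "nat \<Rightarrow> real^'n \<Rightarrow> real^'n" where
  "approx1 k x \<equiv> conv (ker1 (2 ^ k)) f x - conv (ker1 (2 ^ k)) f 0"

abbreviation approx0 :: "nat \<Rightarrow> real^'n \<Rightarrow> real" where
  "approx0 k x \<equiv> conv (ker0 (2 ^ k)) f x - conv (ker0 (2 ^ k)) f 0 - conv (ker1 (2 ^ k)) f 0 \<bullet> x"

lemma has_derivative_approx1:
  "(approx1 k has_derivative (\<lambda>h. conv (ker2 (2 ^ k)) f x *v h)) (at x within S)"
proof -
  have "(conv (ker1 (2 ^ k)) f has_derivative (\<lambda>h. conv (ker2 (2 ^ k)) f x *v h)) (at x within S)"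
  proof (rule has_derivative_cart)
    fix i
    have c: "continuous_on UNIV (\<lambda>z::real^'n. ker2 (2 ^ k) z $ i)"
      by (intro continuous_intros continuous_ker2)
    have "(conv (\<lambda>z. ker1 (2 ^ k) z $ i) f has_derivative (\<lambda>h. conv (\<lambda>z. ker2 (2 ^ k) z $ i) f x \<bullet> h)) (at x)"
      by (rule has_derivative_conv[OF has_derivative_ker1 c continuous]) simp
    then have "((\<lambda>x. conv (ker1 (2 ^ k)) f x $ i) has_derivative (\<lambda>h. conv (ker2 (2 ^ k)) f x $ i \<bullet> h)) (at x)"
      by (simp add: conv_nth continuous continuous_ker2 continuous_ker1)
    then show "((\<lambda>x. conv (ker1 (2 ^ k)) f x $ i) has_derivative (\<lambda>h. (conv (ker2 (2 ^ k)) f x *v h) $ i)) (at x within S)"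
      by (simp add: matrix_vector_mult_def inner_vec_def has_derivative_at_withinI)
  qed
  then show ?thesis by (auto intro!: derivative_eq_intros)
qed

lemma has_derivative_approx0:
  "(approx0 k has_derivative (\<lambda>h. approx1 k x \<bullet> h)) (at x within S)"
proof -
  have "(conv (ker0 (2 ^ k)) f has_derivative (\<lambda>h. conv (ker1 (2 ^ k)) f x \<bullet> h)) (at x)"
    by (rule has_derivative_conv[OF has_derivative_ker0 continuous_ker1 continuous]) simp
  then have "(conv (ker0 (2 ^ k)) f has_derivative (\<lambda>h. conv (ker1 (2 ^ k)) f x \<bullet> h)) (at x within S)"
    by (rule has_derivative_at_withinI)
  then show ?thesis by (auto intro!: derivative_eq_intros simp: inner_diff_left)
qed

lemma approx2_uniform:
  assumes "e > 0"
  shows "\<forall>\<^sub>F k in sequentially. \<forall>x\<in>cball 0 1. \<forall>h. norm (conv (ker2 (2 ^ k)) f x *v h - newton2 f x *v h) \<le> e * norm h"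
proof -
  let ?n = "real CARD('n)"
  obtain C q where C: "C \<ge> 0" "0 < q" "q < 1"
    "\<And>x k i j. norm x < 2 \<Longrightarrow> \<bar>newton2 f x $ i $ j - conv (ker2 (2 ^ k)) f x $ i $ j\<bar> \<le> C * q ^ k"
    using newton2_uniform by metis
  have "(\<lambda>k. ?n * ?n * (C * q ^ k)) \<longlonglongrightarrow> 0"
    using C by (intro tendsto_mult_right_zero LIMSEQ_power_zero) auto
  then have "\<forall>\<^sub>F k in sequentially. ?n * ?n * (C * q ^ k) < e"
    using \<open>e > 0\<close> by (rule order_tendstoD(2))
  then show ?thesis
  proof eventually_elim
    case (elim k)
    show ?case
    proof (intro ballI allI)
      fix x h :: "real^'n" assume "x \<in> cball 0 1"
      then have "\<And>i j. \<bar>(conv (ker2 (2 ^ k)) f x - newton2 f x) $ i $ j\<bar> \<le> C * q ^ k"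
        using C(4)[of x] by (simp add: abs_minus_commute)
      then have "onorm ((*v) (conv (ker2 (2 ^ k)) f x - newton2 f x)) \<le> ?n * ?n * (C * q ^ k)"
        by (rule onorm_le_matrix_component)
      then have "onorm ((*v) (conv (ker2 (2 ^ k)) f x - newton2 f x)) \<le> e"
        using elim by linarith
      then have "norm ((conv (ker2 (2 ^ k)) f x - newton2 f x) *v h) \<le> e * norm h"
        by (rule order_trans[OF onorm[OF matrix_vector_mul_bounded_linear] mult_right_mono]) simp
      then show "norm (conv (ker2 (2 ^ k)) f x *v h - newton2 f x *v h) \<le> e * norm h"
        by (simp add: matrix_vector_mult_diff_rdistrib)
    qed
  qed
qed

text \<open>Termwise differentiation: the derivatives converge uniformly on the unit ball and all
  \<open>approx1\<close> vanish at the origin. Convexity is all that is required of the domain, so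
  the derivative exists up to the boundary.\<close>

lemma newton1:
  assumes "x \<in> cball 0 1"
  shows "(\<lambda>k. approx1 k x) \<longlonglongrightarrow> newton1 f x"
    and "(newton1 f has_derivative (\<lambda>h. newton2 f x *v h)) (at x within cball 0 1)"
proof -
  have "\<exists>g. \<forall>x\<in>cball 0 1. (\<lambda>k. approx1 k x) \<longlonglongrightarrow> g x \<and>
      (g has_derivative (\<lambda>h. newton2 f x *v h)) (at x within cball 0 1)"
    by (rule has_derivative_sequence[OF convex_cball has_derivative_approx1 approx2_uniform, where ?x0.0 = 0 and l = 0])
      auto
  then obtain g where g: "\<And>x. x \<in> cball 0 1 \<Longrightarrow> (\<lambda>k. approx1 k x) \<longlonglongrightarrow> g x"
      "\<And>x. x \<in> cball 0 1 \<Longrightarrow> (g has_derivative (\<lambda>h. newton2 f x *v h)) (at x within cball 0 1)"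
    by blast
  have eq: "newton1 f x = g x" if "x \<in> cball 0 1" for x
    using limI[OF g(1)[OF that]] by (simp add: newton1_def)
  show "(\<lambda>k. approx1 k x) \<longlonglongrightarrow> newton1 f x"
    using g(1)[OF assms] eq[OF assms] by simp
  show "(newton1 f has_derivative (\<lambda>h. newton2 f x *v h)) (at x within cball 0 1)"
    by (rule has_derivative_transform[OF assms _ g(2)[OF assms]]) (rule eq)
qed

text \<open>Uniform convergence one order lower comes from the Lipschitz bound for differences of
  the approximations, compared with the origin, where they all vanish.\<close>

lemma approx1_uniform:
  assumes "e > 0"
  shows "\<forall>\<^sub>F k in sequentially. \<forall>x\<in>cball 0 1. \<forall>h. norm (approx1 k x \<bullet> h - newton1 f x \<bullet> h) \<le> e * norm h"
proof -
  obtain N where N: "\<And>m n x y. m \<ge> N \<Longrightarrow> n \<ge> N \<Longrightarrow> x \<in> cball 0 1 \<Longrightarrow> y \<in> cball 0 1 \<Longrightarrow>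
    norm ((approx1 m x - approx1 n x) - (approx1 m y - approx1 n y)) \<le> e * norm (x - y)"
    using has_derivative_sequence_Lipschitz[OF convex_cball has_derivative_approx1 approx2_uniform assms] by metis
  show ?thesis
    unfolding eventually_sequentially
  proof (intro exI[of _ N] allI impI ballI)
    fix n x and h :: "real^'n" assume n: "n \<ge> N" and x: "x \<in> cball (0::real^'n) 1"
    have "norm (newton1 f x - approx1 n x) \<le> e"
    proof (rule tendsto_upperbound)
      show "(\<lambda>m. norm (approx1 m x - approx1 n x)) \<longlonglongrightarrow> norm (newton1 f x - approx1 n x)"
        by (intro tendsto_norm tendsto_diff newton1(1)[OF x] tendsto_const)
      have "norm (approx1 m x - approx1 n x) \<le> e" if "m \<ge> N" for m
      proof -
        have "norm (approx1 m x - approx1 n x) \<le> e * norm x"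
          using N[OF that n x, of 0] by simp
        also have "\<dots> \<le> e * 1" using x assms by (intro mult_left_mono) auto
        finally show ?thesis by simp
      qed
      then show "\<forall>\<^sub>F m in sequentially. norm (approx1 m x - approx1 n x) \<le> e"
        by (auto simp: eventually_sequentially)
    qed auto
    have "norm (approx1 n x \<bullet> h - newton1 f x \<bullet> h) = norm ((approx1 n x - newton1 f x) \<bullet> h)"
      by (simp add: inner_diff_left)
    also have "\<dots> \<le> norm (approx1 n x - newton1 f x) * norm h" by (simp add: Cauchy_Schwarz_ineq2)
    also have "\<dots> \<le> e * norm h"
      using \<open>norm (newton1 f x - approx1 n x) \<le> e\<close> by (intro mult_right_mono) (auto simp: norm_minus_commute)
    finally show "norm (approx1 n x \<bullet> h - newton1 f x \<bullet> h) \<le> e * norm h" .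
  qed
qed

lemma newton0:
  assumes "x \<in> cball 0 1"
  shows "(\<lambda>k. approx0 k x) \<longlonglongrightarrow> newton0 f x"
    and "(newton0 f has_derivative (\<lambda>h. newton1 f x \<bullet> h)) (at x within cball 0 1)"
proof -
  have "\<exists>g. \<forall>x\<in>cball 0 1. (\<lambda>k. approx0 k x) \<longlonglongrightarrow> g x \<and>
      (g has_derivative (\<lambda>h. newton1 f x \<bullet> h)) (at x within cball 0 1)"
    by (rule has_derivative_sequence[OF convex_cball has_derivative_approx0 approx1_uniform, where ?x0.0 = 0 and l = 0])
      auto
  then obtain g where g: "\<And>x. x \<in> cball 0 1 \<Longrightarrow> (\<lambda>k. approx0 k x) \<longlonglongrightarrow> g x"
      "\<And>x. x \<in> cball 0 1 \<Longrightarrow> (g has_derivative (\<lambda>h. newton1 f x \<bullet> h)) (at x within cball 0 1)"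
    by blast
  have eq: "newton0 f x = g x" if "x \<in> cball 0 1" for x
    using limI[OF g(1)[OF that]] by (simp add: newton0_def)
  show "(\<lambda>k. approx0 k x) \<longlonglongrightarrow> newton0 f x"
    using g(1)[OF assms] eq[OF assms] by simp
  show "(newton0 f has_derivative (\<lambda>h. newton1 f x \<bullet> h)) (at x within cball 0 1)"
    by (rule has_derivative_transform[OF assms _ g(2)[OF assms]]) (rule eq)
qed

lemma newton_at_0: "newton0 f 0 = 0" "newton1 f 0 = 0"
  by (simp_all add: newton0_def newton1_def)

lemma newton2_symmetric:
  assumes "norm x < 2"
  shows "transpose (newton2 f x) = newton2 f x"
proof -
  have "conv (ker2 s) f x $ i $ j = conv (ker2 s) f x $ j $ i" for s i j
  proof -
    have "ker2 s z $ i $ j = ker2 s z $ j $ i" for z :: "real^'n"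
      using ker2_symmetric[of s z] by (simp add: transpose_def vec_eq_iff)
    then show ?thesis by (simp add: conv_ker2_nth)
  qed
  then have "newton2 f x $ j $ i = newton2 f x $ i $ j" for i j
    by (intro LIMSEQ_unique[OF tendsto_vec_nth[OF tendsto_vec_nth[OF conv_ker2_tendsto[OF assms]]]])
      (simp add: tendsto_vec_nth conv_ker2_tendsto[OF assms])
  then show ?thesis by (simp add: transpose_def vec_eq_iff)
qed

text \<open>The traces form an approximate identity of mass c. Subtracting \<open>f x\<close> under
  the integral leaves an error of order 2^(-k\<alpha>).\<close>

lemma trace_newton2:
  assumes c: "\<And>k (x :: real^'n). norm x < 2 \<Longrightarrow> conv (\<lambda>z. trace (ker2 (2 ^ k) z)) (\<lambda>_. 1) x = c"
    and x: "norm x < 2"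
  shows "trace (newton2 f x) = c * f x"
proof -
  let ?n = "real CARD('n)"
  have tc: "continuous_on S (\<lambda>z::real^'n. trace (ker2 s z))" for S s
    unfolding trace_def by (intro continuous_intros continuous_ker2)
  have bd: "norm (trace (conv (ker2 (2 ^ k)) f x) - c * f x) \<le> M * ?n * (?n + 2) * 2 ^ CARD('n) * (2 powr - \<alpha>) ^ k" for k
  proof -
    let ?\<phi> = "\<lambda>z::real^'n. trace (ker2 (2 ^ k) z)"
    have far: "?\<phi> z = 0" if "norm z \<ge> 1 / 2 ^ k" for z
    proof -
      have "1 \<le> 2 ^ k * norm z" using that by (simp add: field_simps)
      then have "1 \<le> (2 ^ k * norm z)\<^sup>2" by (rule one_le_power)
      then show ?thesis by (simp add: trace_ker2 power_mult_distrib dot_square_norm)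
    qed
    have phi: "\<bar>?\<phi> z\<bar> \<le> (2 ^ k) ^ CARD('n) * (?n * (?n + 2))" for z
    proof -
      have "(2 ^ k) ^ CARD('n) * ?n * (?n + 2) * max (1 - (2 ^ k)\<^sup>2 * (z \<bullet> z)) 0 \<le> (2 ^ k) ^ CARD('n) * ?n * (?n + 2) * 1"
        by (intro mult_left_mono) auto
      then show ?thesis by (simp add: trace_ker2 mult.assoc abs_mult)
    qed
    have "trace (conv (ker2 (2 ^ k)) f x) - c * f x = conv ?\<phi> f x - f x * conv ?\<phi> (\<lambda>_. 1) x"
      using c[OF x] by (simp add: trace_conv continuous continuous_ker2)
    also have "\<dots> = integral box3 (\<lambda>y. (f y - f x) * ?\<phi> (x - y))"
      by (rule conv_diff_const[OF tc])
    also have "\<bar>\<dots>\<bar> \<le> (M * (1 / 2 ^ k) powr \<alpha> * ((2 ^ k) ^ CARD('n) * (?n * (?n + 2)))) * (2 * (1 / 2 ^ k)) ^ CARD('n)"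
    proof (rule integral_local_bound[where x = x])
      show "continuous_on UNIV (\<lambda>y. (f y - f x) * ?\<phi> (x - y))"
        by (intro continuous_intros continuous continuous_on_compose2[OF tc[of UNIV]]) auto
      show "(f y - f x) * ?\<phi> (x - y) = 0" if "norm (x - y) \<ge> 1 / 2 ^ k" for y
        using far[OF that] by simp
      show "\<bar>(f y - f x) * ?\<phi> (x - y)\<bar> \<le> M * (1 / 2 ^ k) powr \<alpha> * ((2 ^ k) ^ CARD('n) * (?n * (?n + 2)))" for y
      proof (cases "norm (x - y) \<ge> 1 / 2 ^ k")
        case True
        then show ?thesis using far[OF True] M_nonneg by simp
      next
        case False
        then have "\<bar>f y - f x\<bar> \<le> M * (1 / 2 ^ k) powr \<alpha>"
          by (intro hoelder_le) (auto simp: norm_minus_commute)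
        then show ?thesis using phi[of "x - y"] M_nonneg unfolding abs_mult by (intro mult_mono) auto
      qed
    qed auto
    also have "\<dots> = M * ?n * (?n + 2) * 2 ^ CARD('n) * (2 powr - \<alpha>) ^ k"
      unfolding powr_dyadic by (simp add: power_mult_distrib power_divide)
    finally show ?thesis by simp
  qed
  have "(\<lambda>k. M * ?n * (?n + 2) * 2 ^ CARD('n) * (2 powr - \<alpha>) ^ k) \<longlonglongrightarrow> 0"
    using alpha by (intro tendsto_mult_right_zero LIMSEQ_power_zero) (auto simp: powr_less_one)
  then have "(\<lambda>k. trace (conv (ker2 (2 ^ k)) f x) - c * f x) \<longlonglongrightarrow> 0"
    by (rule Lim_null_comparison[rotated]) (use bd in simp)
  then have "(\<lambda>k. trace (conv (ker2 (2 ^ k)) f x)) \<longlonglongrightarrow> c * f x"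
    by (rule LIM_zero_cancel)
  moreover have "(\<lambda>k. trace (conv (ker2 (2 ^ k)) f x)) \<longlonglongrightarrow> trace (newton2 f x)"
    unfolding trace_def by (intro tendsto_sum tendsto_vec_nth conv_ker2_tendsto[OF x])
  ultimately show ?thesis by (metis LIMSEQ_unique)
qed

end

section \<open>Hoelder bounds on the unit ball and the Schauder estimate\<close>

text \<open>A norm bound in the Hoelder space of the unit ball, kept as a predicate on total
  functions. Values outside the ball are ignored, and one M serves for the supremum and the
  seminorm.\<close>

definition hoelder_le :: "real \<Rightarrow> real \<Rightarrow> ('a::real_normed_vector \<Rightarrow> 'b::real_normed_vector) \<Rightarrow> bool" where
  "hoelder_le \<alpha> M f \<longleftrightarrow> (\<forall>x\<in>cball 0 1. norm (f x) \<le> M) \<and>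
     (\<forall>x\<in>cball 0 1. \<forall>y\<in>cball 0 1. norm (f x - f y) \<le> M * norm (x - y) powr \<alpha>)"

lemma hoelder_leI:
  assumes "\<And>x. norm x \<le> 1 \<Longrightarrow> norm (f x) \<le> M"
    "\<And>x y. norm x \<le> 1 \<Longrightarrow> norm y \<le> 1 \<Longrightarrow> norm (f x - f y) \<le> M * norm (x - y) powr \<alpha>"
  shows "hoelder_le \<alpha> M f"
  using assms by (simp add: hoelder_le_def)

lemma hoelder_leD:
  assumes "hoelder_le \<alpha> M f"
  shows "norm x \<le> 1 \<Longrightarrow> norm (f x) \<le> M"
    "norm x \<le> 1 \<Longrightarrow> norm y \<le> 1 \<Longrightarrow> norm (f x - f y) \<le> M * norm (x - y) powr \<alpha>"
  using assms by (simp_all add: hoelder_le_def)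

lemma hoelder_le_nonneg: "hoelder_le \<alpha> M f \<Longrightarrow> M \<ge> 0"
  using hoelder_leD(1)[of \<alpha> M f 0] order_trans[OF norm_ge_zero, of "f 0" M] by simp

lemma hoelder_le_mono:
  assumes "hoelder_le \<alpha> M f" "M \<le> N"
  shows "hoelder_le \<alpha> N f"
proof (rule hoelder_leI)
  show "norm (f x) \<le> N" if "norm x \<le> 1" for x
    using hoelder_leD(1)[OF assms(1) that] assms(2) by simp
  show "norm (f x - f y) \<le> N * norm (x - y) powr \<alpha>" if "norm x \<le> 1" "norm y \<le> 1" for x y
    using hoelder_leD(2)[OF assms(1) that] mult_right_mono[OF assms(2), of "norm (x - y) powr \<alpha>"] by simp
qed

lemma hoelder_le_cong:
  assumes "\<And>x. norm x \<le> 1 \<Longrightarrow> f x = g x"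
  shows "hoelder_le \<alpha> M f \<longleftrightarrow> hoelder_le \<alpha> M g"
  using assms by (simp add: hoelder_le_def)

lemma hoelder_le_add:
  assumes "hoelder_le \<alpha> M f" "hoelder_le \<alpha> N g"
  shows "hoelder_le \<alpha> (M + N) (\<lambda>x. f x + g x)"
proof (rule hoelder_leI)
  show "norm (f x + g x) \<le> M + N" if "norm x \<le> 1" for x
    using hoelder_leD(1)[OF assms(1) that] hoelder_leD(1)[OF assms(2) that] norm_triangle_ineq[of "f x" "g x"] by simp
  show "norm (f x + g x - (f y + g y)) \<le> (M + N) * norm (x - y) powr \<alpha>" if "norm x \<le> 1" "norm y \<le> 1" for x y
    using hoelder_leD(2)[OF assms(1) that] hoelder_leD(2)[OF assms(2) that] norm_triangle_ineq[of "f x - f y" "g x - g y"]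
    by (simp add: distrib_right algebra_simps)
qed

lemma hoelder_le_scaleR:
  assumes "hoelder_le \<alpha> M f"
  shows "hoelder_le \<alpha> (\<bar>c\<bar> * M) (\<lambda>x. c *\<^sub>R f x)"
proof (rule hoelder_leI)
  show "norm (c *\<^sub>R f x) \<le> \<bar>c\<bar> * M" if "norm x \<le> 1" for x
    using hoelder_leD(1)[OF assms that] by (simp add: mult_left_mono)
  show "norm (c *\<^sub>R f x - c *\<^sub>R f y) \<le> \<bar>c\<bar> * M * norm (x - y) powr \<alpha>" if "norm x \<le> 1" "norm y \<le> 1" for x y
    using mult_left_mono[OF hoelder_leD(2)[OF assms that], of "\<bar>c\<bar>"] by (simp add: mult.assoc flip: scaleR_diff_right)
qed

lemma hoelder_le_diff:
  assumes "hoelder_le \<alpha> M f" "hoelder_le \<alpha> N g"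
  shows "hoelder_le \<alpha> (M + N) (\<lambda>x. f x - g x)"
  using hoelder_le_add[OF assms(1) hoelder_le_scaleR[OF assms(2), of "-1"]] by simp

lemma hoelder_le_Pair:
  assumes "hoelder_le \<alpha> M f" "hoelder_le \<alpha> N g"
  shows "hoelder_le \<alpha> (M + N) (\<lambda>x. (f x, g x))"
proof (rule hoelder_leI)
  show "norm (f x, g x) \<le> M + N" if "norm x \<le> 1" for x
    using hoelder_leD(1)[OF assms(1) that] hoelder_leD(1)[OF assms(2) that] norm_Pair_le[of "f x" "g x"] by simp
  show "norm ((f x, g x) - (f y, g y)) \<le> (M + N) * norm (x - y) powr \<alpha>" if "norm x \<le> 1" "norm y \<le> 1" for x y
    using hoelder_leD(2)[OF assms(1) that] hoelder_leD(2)[OF assms(2) that] norm_Pair_le[of "f x - f y" "g x - g y"]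
    by (simp add: distrib_right)
qed

lemma norm_vec_le_sum:
  fixes v :: "'a::real_normed_vector^'m"
  shows "norm v \<le> (\<Sum>i\<in>UNIV. norm (v $ i))"
  by (simp add: norm_vec_def L2_set_le_sum)

lemma hoelder_le_vec:
  fixes f :: "'a::real_normed_vector \<Rightarrow> 'b::real_normed_vector^'m"
  assumes "\<And>i. hoelder_le \<alpha> M (\<lambda>x. f x $ i)"
  shows "hoelder_le \<alpha> (real CARD('m) * M) f"
proof (rule hoelder_leI)
  show "norm (f x) \<le> real CARD('m) * M" if "norm x \<le> 1" for x
    using norm_vec_le_sum[of "f x"] sum_mono[of "UNIV :: 'm set" "\<lambda>i. norm (f x $ i)" "\<lambda>i. M"]
      hoelder_leD(1)[OF assms that] by simp
  show "norm (f x - f y) \<le> real CARD('m) * M * norm (x - y) powr \<alpha>" if "norm x \<le> 1" "norm y \<le> 1" for x y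
    using norm_vec_le_sum[of "f x - f y"] hoelder_leD(2)[OF assms that]
      sum_mono[of "UNIV :: 'm set" "\<lambda>i. norm ((f x - f y) $ i)" "\<lambda>i. M * norm (x - y) powr \<alpha>"]
    by (simp add: mult.assoc)
qed

lemma hoelder_le_Lipschitz:
  assumes "0 < \<alpha>" "\<alpha> < 1" "L \<ge> 0"
    and "\<And>x. norm x \<le> 1 \<Longrightarrow> norm (f x) \<le> M"
    and "\<And>x y. norm x \<le> 1 \<Longrightarrow> norm y \<le> 1 \<Longrightarrow> norm (f x - f y) \<le> L * norm (x - y)"
    and "M \<le> 2 * L"
  shows "hoelder_le \<alpha> (2 * L) f"
proof (rule hoelder_leI)
  show "norm (f x) \<le> 2 * L" if "norm x \<le> 1" for x using assms(4)[OF that] assms(6) by simp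
  show "norm (f x - f y) \<le> 2 * L * norm (x - y) powr \<alpha>" if "norm x \<le> 1" "norm y \<le> 1" for x y
  proof -
    have "norm (x - y) \<le> 2" using norm_triangle_ineq4[of x y] that by simp
    then have "norm (x - y) \<le> 2 * norm (x - y) powr \<alpha>" using assms by (intro le_two_powr) auto
    from mult_left_mono[OF this \<open>L \<ge> 0\<close>] assms(5)[OF that] show ?thesis by simp
  qed
qed

text \<open>The mean value inequality on the ball, started at the origin where g vanishes, controls
  g by its derivative. Thus the lower-order parts of the Schauder estimate follow from the Hessian
  part.\<close>

lemma hoelder_le_derivative:
  fixes g :: "real^'n \<Rightarrow> real^'m" and A :: "real^'n \<Rightarrow> real^'n^'m"
  assumes \<alpha>: "0 < \<alpha>" "\<alpha> < 1"
    and d: "\<And>x. x \<in> cball 0 1 \<Longrightarrow> (g has_derivative (\<lambda>h. A x *v h)) (at x within cball 0 1)"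
    and A: "\<And>x. norm x \<le> 1 \<Longrightarrow> norm (A x) \<le> K" and "g 0 = 0"
  shows "hoelder_le \<alpha> (2 * (real CARD('m) * real CARD('n) * K)) g"
proof -
  let ?L = "real CARD('m) * real CARD('n) * K"
  have K: "K \<ge> 0" using A[of 0] order_trans[OF norm_ge_zero, of "A 0" K] by simp
  have L: "norm (g x - g y) \<le> ?L * norm (x - y)" if "norm x \<le> 1" "norm y \<le> 1" for x y
  proof (rule differentiable_bound[OF convex_cball d])
    fix x :: "real^'n" assume "x \<in> cball 0 1"
    then have "norm (A x) \<le> K" using A by simp
    then have "\<bar>A x $ i $ j\<bar> \<le> K" for i j
      using component_le_norm_cart[of "A x $ i" j] Finite_Cartesian_Product.norm_nth_le[of "A x" i] by linarith
    then show "onorm ((*v) (A x)) \<le> ?L" by (rule onorm_le_matrix_component)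
  qed (use that in auto)
  have "norm (g x) \<le> ?L" if "norm x \<le> 1" for x
  proof -
    have "norm (g x) \<le> ?L * norm x" using L[OF that, of 0] \<open>g 0 = 0\<close> by simp
    also have "\<dots> \<le> ?L * 1" using that K by (intro mult_left_mono) auto
    finally show ?thesis by simp
  qed
  with L show ?thesis using K by (intro hoelder_le_Lipschitz[OF \<alpha>, of _ _ ?L]) auto
qed

text \<open>The constants of the kernels are obtained before f appears. Hence C is uniform in f, as
  a contraction argument demands.\<close>

lemma newton2_estimate:
  assumes "0 < \<alpha>" "\<alpha> < 1"
  obtains C where "C > 0" "\<And>(f :: real^'n \<Rightarrow> real) M. hoelder_data f M \<alpha> \<Longrightarrow> hoelder_le \<alpha> (C * M) (newton2 f)"
proof -
  obtain A where A: "A > 0"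
    "\<And>(z :: real^'n) i j. norm z \<le> 3 * real CARD('n) + 1 \<Longrightarrow> \<bar>ker2 1 z $ i $ j\<bar> \<le> A"
    "\<And>(z :: real^'n) w i j. norm z \<le> 3 * real CARD('n) + 1 \<Longrightarrow> norm w \<le> 3 * real CARD('n) + 1 \<Longrightarrow>
       \<bar>ker2 1 z $ i $ j - ker2 1 w $ i $ j\<bar> \<le> A * norm (z - w)"
    using ker2_bounds by blast
  obtain B where B: "B > 0" "\<And>k (z :: real^'n) i j. \<bar>incr2 k z $ i $ j\<bar> \<le> B * (2 ^ k) ^ CARD('n)"
    "\<And>k (z :: real^'n) w i j. \<bar>incr2 k z $ i $ j - incr2 k w $ i $ j\<bar> \<le> B * (2 ^ k) ^ CARD('n) * (2 ^ k * norm (z - w))"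
    using incr2_bounds by blast
  define C1 where "C1 = A * measure lborel (box3 :: (real^'n) set) + B * 2 ^ CARD('n) / (1 - 2 powr - \<alpha>)"
  define C2 where "C2 = 2 * A * measure lborel (box3 :: (real^'n) set) +
     2 * B * 4 ^ CARD('n) * (2 / (2 powr (1 - \<alpha>) - 1) + 1 / (1 - 2 powr - \<alpha>))"
  have q: "2 powr - \<alpha> < 1" using assms by (auto simp: powr_less_one)
  have C1: "C1 > 0" unfolding C1_def using A(1) B(1) q by (intro add_nonneg_pos) auto
  let ?C = "real CARD('n) * (real CARD('n) * max C1 C2)"
  show ?thesis
  proof
    show "?C > 0" using C1 by auto
    fix f :: "real^'n \<Rightarrow> real" and M assume "hoelder_data f M \<alpha>"
    then interpret hoelder_data f M \<alpha> .
    have "hoelder_le \<alpha> (real CARD('n) * (real CARD('n) * (max C1 C2 * M))) (newton2 f)"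
    proof (intro hoelder_le_vec hoelder_leI)
      fix i j and x y :: "real^'n" assume x: "norm x \<le> 1"
      have "\<bar>newton2 f x $ i $ j\<bar> \<le> C1 * M"
        unfolding C1_def by (rule newton2_bound[OF refl A refl refl B x])
      also have "\<dots> \<le> max C1 C2 * M" using M_nonneg by (intro mult_right_mono) auto
      finally show "norm (newton2 f x $ i $ j) \<le> max C1 C2 * M" by simp
      assume y: "norm y \<le> 1"
      have "\<bar>newton2 f x $ i $ j - newton2 f y $ i $ j\<bar> \<le> C2 * M * norm (x - y) powr \<alpha>"
        unfolding C2_def by (rule newton2_hoelder[OF refl A refl refl B x y])
      also have "\<dots> \<le> max C1 C2 * M * norm (x - y) powr \<alpha>" using M_nonneg by (intro mult_right_mono) auto
      finally show "norm (newton2 f x $ i $ j - newton2 f y $ i $ j) \<le> max C1 C2 * M * norm (x - y) powr \<alpha>" by simp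
    qed
    then show "hoelder_le \<alpha> (?C * M) (newton2 f)" by (simp add: mult.assoc)
  qed
qed

lemma newton_diff:
  assumes f: "hoelder_data f M \<alpha>" and g: "hoelder_data g M' \<alpha>" and fg: "hoelder_data (\<lambda>y. f y - g y) M'' \<alpha>"
    and x: "x \<in> cball 0 1"
  shows "newton2 (\<lambda>y. f y - g y) x = newton2 f x - newton2 g x"
    and "newton1 (\<lambda>y. f y - g y) x = newton1 f x - newton1 g x"
    and "newton0 (\<lambda>y. f y - g y) x = newton0 f x - newton0 g x"
proof -
  have c: "continuous_on UNIV f" "continuous_on UNIV g"
    using f g hoelder_data.continuous by auto
  note cd = conv_diff[OF _ c]
  have x2: "norm x < 2" using x by simp
  show "newton2 (\<lambda>y. f y - g y) x = newton2 f x - newton2 g x"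
    using tendsto_diff[OF hoelder_data.conv_ker2_tendsto[OF f x2] hoelder_data.conv_ker2_tendsto[OF g x2]]
    by (intro LIMSEQ_unique[OF hoelder_data.conv_ker2_tendsto[OF fg x2]]) (simp add: cd continuous_ker2)
  show "newton1 (\<lambda>y. f y - g y) x = newton1 f x - newton1 g x"
    using tendsto_diff[OF hoelder_data.newton1(1)[OF f x] hoelder_data.newton1(1)[OF g x]]
    by (intro LIMSEQ_unique[OF hoelder_data.newton1(1)[OF fg x]]) (simp add: cd continuous_ker1 algebra_simps)
  show "newton0 (\<lambda>y. f y - g y) x = newton0 f x - newton0 g x"
    using tendsto_diff[OF hoelder_data.newton0(1)[OF f x] hoelder_data.newton0(1)[OF g x]]
    by (intro LIMSEQ_unique[OF hoelder_data.newton0(1)[OF fg x]])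
      (simp add: cd continuous_ker1 continuous_ker0 algebra_simps inner_diff_left)
qed

section \<open>Extension from the ball and the right inverse of the Laplacian\<close>

definition clamp_ball :: "(real^'n \<Rightarrow> real^'m) \<Rightarrow> 'm \<Rightarrow> real^'n \<Rightarrow> real" where
  "clamp_ball f j y = f (closest_point (cball 0 1) y) $ j"

lemma clamp_ball_self: "norm x \<le> 1 \<Longrightarrow> clamp_ball f j x = f x $ j"
  by (simp add: clamp_ball_def closest_point_self)

lemma clamp_ball_diff: "clamp_ball (\<lambda>y. f y - g y) j = (\<lambda>y. clamp_ball f j y - clamp_ball g j y)"
  by (simp add: clamp_ball_def fun_eq_iff)

text \<open>The nearest point projection is 1-Lipschitz, so the extension keeps the constant
  M.\<close>

lemma hoelder_data_clamp_ball:
  fixes f :: "real^'n \<Rightarrow> real^'m"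
  assumes "hoelder_le \<alpha> M f" "0 < \<alpha>" "\<alpha> < 1"
  shows "hoelder_data (clamp_ball f j) M \<alpha>"
proof
  let ?P = "closest_point (cball 0 (1::real)) :: real^'n \<Rightarrow> real^'n"
  have P: "norm (?P y) \<le> 1" for y
    using closest_point_in_set[of "cball 0 (1::real)" y] by simp
  show "\<bar>clamp_ball f j x\<bar> \<le> M" for x
    using component_le_norm_cart[of "f (?P x)" j] hoelder_leD(1)[OF assms(1) P, of x] by (simp add: clamp_ball_def)
  show "\<bar>clamp_ball f j x - clamp_ball f j y\<bar> \<le> M * norm (x - y) powr \<alpha>" for x y
  proof -
    have "\<bar>clamp_ball f j x - clamp_ball f j y\<bar> \<le> norm (f (?P x) - f (?P y))"
      using component_le_norm_cart[of "f (?P x) - f (?P y)" j] by (simp add: clamp_ball_def)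
    also have "\<dots> \<le> M * norm (?P x - ?P y) powr \<alpha>" by (rule hoelder_leD(2)[OF assms(1) P P])
    also have "\<dots> \<le> M * norm (x - y) powr \<alpha>"
      using closest_point_lipschitz[of "cball 0 (1::real)" x y] assms hoelder_le_nonneg[OF assms(1)]
      by (intro mult_left_mono powr_mono2) (auto simp: dist_norm)
    finally show ?thesis .
  qed
qed (use assms in auto)

text \<open>Gradient and Hessian are returned as operators of their own, since the iteration handles
  the whole jet as one triple. Of linearity only compatibility with differences is recorded, which
  is what the contraction needs.\<close>

theorem Schauder_right_inverse:
  assumes \<alpha>: "0 < \<alpha>" "\<alpha> < 1"
  obtains C and T0 :: "(real^'n \<Rightarrow> real^'m) \<Rightarrow> real^'n \<Rightarrow> real^'m" and T1 T2 where "C > 0"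
    "\<And>f M x. hoelder_le \<alpha> M f \<Longrightarrow> x \<in> cball 0 1 \<Longrightarrow> (T0 f has_derivative (\<lambda>h. T1 f x *v h)) (at x within cball 0 1)"
    "\<And>f M x j. hoelder_le \<alpha> M f \<Longrightarrow> x \<in> cball 0 1 \<Longrightarrow>
       ((\<lambda>x. T1 f x $ j) has_derivative (\<lambda>h. T2 f x $ j *v h)) (at x within cball 0 1)"
    "\<And>f M. hoelder_le \<alpha> M f \<Longrightarrow> T0 f 0 = 0" "\<And>f M. hoelder_le \<alpha> M f \<Longrightarrow> T1 f 0 = 0"
    "\<And>f M x j. hoelder_le \<alpha> M f \<Longrightarrow> x \<in> cball 0 1 \<Longrightarrow> transpose (T2 f x $ j) = T2 f x $ j"
    "\<And>f M x j. hoelder_le \<alpha> M f \<Longrightarrow> x \<in> cball 0 1 \<Longrightarrow> trace (T2 f x $ j) = f x $ j"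
    "\<And>f M. hoelder_le \<alpha> M f \<Longrightarrow> hoelder_le \<alpha> (C * M) (\<lambda>x. (T0 f x, T1 f x, T2 f x))"
    "\<And>f M g N x. hoelder_le \<alpha> M f \<Longrightarrow> hoelder_le \<alpha> N g \<Longrightarrow> x \<in> cball 0 1 \<Longrightarrow>
      (T0 (\<lambda>y. f y - g y) x, T1 (\<lambda>y. f y - g y) x, T2 (\<lambda>y. f y - g y) x) = (T0 f x, T1 f x, T2 f x) - (T0 g x, T1 g x, T2 g x)"
proof -
  obtain c where "c > 0" and c: "\<And>k (x :: real^'n). norm x < 2 \<Longrightarrow> conv (\<lambda>z. trace (ker2 (2 ^ k) z)) (\<lambda>_. 1) x = c"
    using kernel_mass by blast
  obtain C where "C > 0" and C: "\<And>(f :: real^'n \<Rightarrow> real) M. hoelder_data f M \<alpha> \<Longrightarrow> hoelder_le \<alpha> (C * M) (newton2 f)"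
    using newton2_estimate[OF \<alpha>] by blast
  define T0 :: "(real^'n \<Rightarrow> real^'m) \<Rightarrow> real^'n \<Rightarrow> real^'m"
    where "T0 f x = (\<chi> j. newton0 (clamp_ball f j) x / c)" for f x
  define T1 :: "(real^'n \<Rightarrow> real^'m) \<Rightarrow> real^'n \<Rightarrow> real^'n^'m"
    where "T1 f x = (\<chi> j. (1 / c) *\<^sub>R newton1 (clamp_ball f j) x)" for f x
  define T2 :: "(real^'n \<Rightarrow> real^'m) \<Rightarrow> real^'n \<Rightarrow> real^'n^'n^'m"
    where "T2 f x = (\<chi> j. (1 / c) *\<^sub>R newton2 (clamp_ball f j) x)" for f x
  let ?n = "real CARD('n)" and ?m = "real CARD('m)"
  \<comment> \<open>The Hessian is bounded first; \<open>D1\<close> and \<open>D0\<close> then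
    follow by \<open>hoelder_le_derivative\<close>, because \<open>T1 f\<close> and
    \<open>T0 f\<close> vanish at the origin.\<close>
  define D2 where "D2 = ?m * (1 / c * C)"
  define D1 where "D1 = ?m * (2 * (?n * ?n * D2))"
  define D0 where "D0 = 2 * (?m * ?n * D1)"
  have D: "D2 > 0" "D1 > 0" "D0 > 0"
    using \<open>c > 0\<close> \<open>C > 0\<close> by (simp_all add: D0_def D1_def D2_def)
  note hd = hoelder_data_clamp_ball[OF _ \<alpha>]
  have d0: "(T0 f has_derivative (\<lambda>h. T1 f x *v h)) (at x within cball 0 1)"
    if "hoelder_le \<alpha> M f" "x \<in> cball 0 1" for f M x
  proof (rule has_derivative_cart)
    fix j
    have "((\<lambda>x. (1 / c) *\<^sub>R newton0 (clamp_ball f j) x) has_derivative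
       (\<lambda>h. (1 / c) *\<^sub>R (newton1 (clamp_ball f j) x \<bullet> h))) (at x within cball 0 1)"
      by (rule has_derivative_scaleR_right hoelder_data.newton0(2)[OF hd] that)+
    then show "((\<lambda>x. T0 f x $ j) has_derivative (\<lambda>h. (T1 f x *v h) $ j)) (at x within cball 0 1)"
      by (simp add: T0_def T1_def matrix_vector_mult_def inner_vec_def sum_divide_distrib)
  qed
  have d1: "((\<lambda>x. T1 f x $ j) has_derivative (\<lambda>h. T2 f x $ j *v h)) (at x within cball 0 1)"
    if "hoelder_le \<alpha> M f" "x \<in> cball 0 1" for f M x j
  proof -
    have "((\<lambda>x. (1 / c) *\<^sub>R newton1 (clamp_ball f j) x) has_derivative
       (\<lambda>h. (1 / c) *\<^sub>R (newton2 (clamp_ball f j) x *v h))) (at x within cball 0 1)"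
      by (rule has_derivative_scaleR_right hoelder_data.newton1(2)[OF hd] that)+
    then show ?thesis by (simp add: T1_def T2_def scaleR_matrix_vector_assoc)
  qed
  have z0: "T0 f 0 = 0" and z1: "T1 f 0 = 0" if "hoelder_le \<alpha> M f" for f M
    using hoelder_data.newton_at_0[OF hd[OF that]] by (simp_all add: T0_def T1_def vec_eq_iff)
  have sy: "transpose (T2 f x $ j) = T2 f x $ j" if "hoelder_le \<alpha> M f" "x \<in> cball 0 1" for f M x j
    using hoelder_data.newton2_symmetric[OF hd[OF that(1)], of x j] that(2)
    by (simp add: T2_def transpose_scalar)
  have tr: "trace (T2 f x $ j) = f x $ j" if "hoelder_le \<alpha> M f" "x \<in> cball 0 1" for f M x j
    using hoelder_data.trace_newton2[OF hd[OF that(1)] c, of x j] that(2) \<open>c > 0\<close>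
    by (simp add: T2_def trace_def clamp_ball_self flip: sum_divide_distrib)
  have b2: "hoelder_le \<alpha> (D2 * M) (T2 f)" if "hoelder_le \<alpha> M f" for f M
  proof -
    have "hoelder_le \<alpha> (?m * (\<bar>1 / c\<bar> * (C * M))) (T2 f)"
      unfolding T2_def by (rule hoelder_le_vec) (simp, rule hoelder_le_scaleR[OF C[OF hd[OF that]], of "1 / c", simplified])
    then show ?thesis using \<open>c > 0\<close> by (simp add: D2_def mult.assoc)
  qed
  have b1: "hoelder_le \<alpha> (D1 * M) (T1 f)" if "hoelder_le \<alpha> M f" for f M
  proof -
    have "hoelder_le \<alpha> (?m * (2 * (?n * ?n * (D2 * M)))) (T1 f)"
    proof (rule hoelder_le_vec, rule hoelder_le_derivative[OF \<alpha> d1[OF that]])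
      show "norm (T2 f x $ j) \<le> D2 * M" if "norm x \<le> 1" for x j
        using hoelder_leD(1)[OF b2[OF \<open>hoelder_le \<alpha> M f\<close>] that] Finite_Cartesian_Product.norm_nth_le[of "T2 f x" j] by simp
    qed (use z1[OF that] in auto)
    then show ?thesis by (simp add: D1_def mult.assoc)
  qed
  have b0: "hoelder_le \<alpha> (D0 * M) (T0 f)" if "hoelder_le \<alpha> M f" for f M
  proof -
    have "hoelder_le \<alpha> (2 * (?m * ?n * (D1 * M))) (T0 f)"
      by (rule hoelder_le_derivative[OF \<alpha> d0[OF that] hoelder_leD(1)[OF b1[OF that]] z0[OF that]])
    then show ?thesis by (simp add: D0_def mult.assoc)
  qed
  show ?thesis
  proof (rule that[OF _ d0 d1 z0 z1 sy tr])
    show "D0 + (D1 + D2) > 0" using D by simp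
    show "hoelder_le \<alpha> ((D0 + (D1 + D2)) * M) (\<lambda>x. (T0 f x, T1 f x, T2 f x))" if "hoelder_le \<alpha> M f" for f M
      using hoelder_le_Pair[OF b0[OF that] hoelder_le_Pair[OF b1[OF that] b2[OF that]]] by (simp add: distrib_right)
    show "(T0 (\<lambda>y. f y - g y) x, T1 (\<lambda>y. f y - g y) x, T2 (\<lambda>y. f y - g y) x) = (T0 f x, T1 f x, T2 f x) - (T0 g x, T1 g x, T2 g x)"
      if "hoelder_le \<alpha> M f" "hoelder_le \<alpha> N g" "x \<in> cball 0 1" for f M g N x
      using newton_diff[OF hd[OF that(1)] hd[OF that(2)] hd[OF hoelder_le_diff[OF that(1,2)], unfolded clamp_ball_diff] that(3)]
      by (simp add: T0_def T1_def T2_def vec_eq_iff clamp_ball_diff diff_divide_distrib)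
  qed
qed

section \<open>The nonlinear term\<close>

definition symmetrize :: "real^'n^'n^'m \<Rightarrow> real^'n^'n^'m" where
  "symmetrize r = (\<chi> j. (1/2) *\<^sub>R (r $ j + transpose (r $ j)))"

lemma linear_symmetrize: "linear symmetrize"
  by (rule linearI) (simp_all add: vec_eq_iff symmetrize_def transpose_def field_simps)

lemma symmetrize_in: "symmetrize r \<in> sym_tuples"
  by (simp add: sym_tuples_def symmetrize_def vec_eq_iff transpose_def)

lemma symmetrize_self: "r \<in> sym_tuples \<Longrightarrow> symmetrize r = r"
  by (simp add: sym_tuples_def symmetrize_def vec_eq_iff)

type_synonym ('n, 'm) jet = "(real^'m) \<times> (real^'n^'m) \<times> (real^'n^'n^'m)"

definition jet_proj :: "(real^'n::finite) \<times> ('n, 'm::finite) jet \<Rightarrow> (real^'n) \<times> ('n, 'm) jet" where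
  "jet_proj z = (fst z, fst (snd z), fst (snd (snd z)), symmetrize (snd (snd (snd z))))"

lemma linear_jet_proj: "linear jet_proj"
  by (rule linearI) (simp_all add: jet_proj_def linear_add[OF linear_symmetrize] linear_cmul[OF linear_symmetrize])

lemma bounded_linear_jet_proj: "bounded_linear jet_proj"
  by (simp add: linear_jet_proj linear_conv_bounded_linear[symmetric])

lemma jets_eq: "(jets :: ((real^'n::finite) \<times> ('n, 'm::finite) jet) set) = {z. jet_proj z = z}"
proof -
  have "r \<in> sym_tuples \<longleftrightarrow> symmetrize r = r" for r :: "real^'n^'n^'m"
    using symmetrize_in[of r] symmetrize_self[of r] by auto
  then show ?thesis
    by (simp add: set_eq_iff jets_def jet_proj_def prod_eq_iff mem_Times_iff)
qed

lemma jet_proj_in: "jet_proj z \<in> jets"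
  by (simp add: jets_def jet_proj_def symmetrize_in)

lemma closed_jets: "closed jets"
  unfolding jets_eq
  by (intro closed_Collect_eq continuous_on_id linear_continuous_on bounded_linear_jet_proj)

lemma convex_jets: "convex jets"
  unfolding jets_eq
  by (rule convexI) (simp add: linear_add[OF linear_jet_proj] linear_cmul[OF linear_jet_proj])

text \<open>Precomposing with the linear projection onto \<open>jets\<close> gives a function
  differentiable on the whole space, so derivatives within a subspace disappear from the later
  estimates. On a compact convex set of jets the second derivative is bounded, and the mean value
  inequality makes the first one Lipschitz.\<close>

lemma nonlinearity_extension:
  fixes a :: "(real^'n::finite) \<times> ('n, 'm::finite) jet \<Rightarrow> real^'m"
  assumes "C2_on jets a" and "grad_r_zero a"
  obtains b b' L where "\<And>z. z \<in> jets \<Longrightarrow> b z = a z"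
    "\<And>z. (b has_derivative blinfun_apply (b' z)) (at z)" "L \<ge> 0"
    "\<And>z w. norm z \<le> 1 \<Longrightarrow> norm w \<le> 1 \<Longrightarrow> norm (b' z - b' w) \<le> L * norm (z - w)"
    "\<And>r. b' 0 (0, 0, 0, r) = 0"
proof -
  obtain f' f'' where f': "\<And>z. z \<in> jets \<Longrightarrow> (a has_derivative blinfun_apply (f' z)) (at z within jets)"
    and f'': "\<And>z. z \<in> jets \<Longrightarrow> (f' has_derivative blinfun_apply (f'' z)) (at z within jets)"
    and cont: "continuous_on jets f''"
    using assms(1) unfolding C2_on_def by blast
  define P :: "((real^'n) \<times> ('n, 'm) jet) \<Rightarrow>\<^sub>L ((real^'n) \<times> ('n, 'm) jet)" where "P = Blinfun jet_proj"
  have P: "blinfun_apply P = jet_proj"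
    unfolding P_def by (rule bounded_linear_Blinfun_apply[OF bounded_linear_jet_proj])
  define b where "b z = a (jet_proj z)" for z
  define b' where "b' z = f' (jet_proj z) o\<^sub>L P" for z
  \<comment> \<open>The radius \<open>norm P\<close> lets K contain the projections of all points of
    the unit ball.\<close>
  define K where "K = jets \<inter> cball (0 :: (real^'n) \<times> ('n, 'm) jet) (norm P)"
  have K: "compact K" "convex K"
    unfolding K_def by (intro closed_Int_compact closed_jets compact_cball convex_Int convex_jets convex_cball)+
  have "bounded (f'' ` K)"
    by (intro compact_imp_bounded compact_continuous_image continuous_on_subset[OF cont] K) (auto simp: K_def)
  then obtain B where B: "B > 0" "\<And>z. z \<in> K \<Longrightarrow> norm (f'' z) \<le> B"
    unfolding bounded_pos by auto
  have Lip: "norm (f' z - f' w) \<le> B * norm (z - w)" if "z \<in> K" "w \<in> K" for z w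
  proof (rule differentiable_bound[OF K(2)])
    show "(f' has_derivative blinfun_apply (f'' z)) (at z within K)" if "z \<in> K" for z
      using f''[of z] that by (auto simp: K_def intro: has_derivative_subset)
    show "onorm (blinfun_apply (f'' z)) \<le> B" if "z \<in> K" for z
      using B(2)[OF that] by (simp add: norm_blinfun.rep_eq)
  qed (use that in auto)
  have PK: "jet_proj z \<in> K" if "norm z \<le> 1" for z
    using norm_blinfun[of P z] mult_left_mono[OF that, of "norm P"] jet_proj_in[of z]
    by (simp add: K_def P)
  have z1: "(b has_derivative blinfun_apply (b' z)) (at z)" for z
  proof -
    have p: "(jet_proj has_derivative jet_proj) (at z)"
      by (rule bounded_linear_imp_has_derivative[OF bounded_linear_jet_proj])
    have "((\<lambda>z. a (jet_proj z)) has_derivative (\<lambda>h. f' (jet_proj z) (jet_proj h))) (at z within UNIV)"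
      by (rule has_derivative_in_compose2[OF f' _ _ p[THEN has_derivative_at_withinI]])
       (auto simp: jet_proj_in)
    then show ?thesis
      unfolding b_def [abs_def] b'_def by (rule has_derivative_eq_rhs) (auto simp: P fun_eq_iff)
  qed
  have z2: "norm (b' z - b' w) \<le> (B * norm P * norm P) * norm (z - w)" if "norm z \<le> 1" "norm w \<le> 1" for z w
  proof -
    have "b' z - b' w = (f' (jet_proj z) - f' (jet_proj w)) o\<^sub>L P"
      by (rule blinfun_eqI) (simp add: b'_def blinfun.diff_left)
    then have "norm (b' z - b' w) \<le> norm (f' (jet_proj z) - f' (jet_proj w)) * norm P"
      by (simp add: norm_blinfun_compose)
    also have "\<dots> \<le> (B * norm (jet_proj z - jet_proj w)) * norm P"
      by (intro mult_right_mono Lip PK that) auto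
    also have "norm (jet_proj z - jet_proj w) \<le> norm P * norm (z - w)"
      using norm_blinfun[of P "z - w"] by (simp add: P linear_diff[OF linear_jet_proj])
    finally show ?thesis using B(1) by (simp add: mult_left_mono mult_right_mono mult_ac)
  qed
  have z3: "b' 0 (0, 0, 0, r) = 0" for r
  proof -
    define s where "s = symmetrize r"
    have s: "t *\<^sub>R s \<in> sym_tuples" for t :: real
      using symmetrize_in[of "t *\<^sub>R r"] by (simp add: s_def linear_cmul[OF linear_symmetrize])
    \<comment> \<open>Derivatives within a proper subspace are not unique, so \<open>f' 0\<close> is
      compared with the zero derivative only along the real line through s.\<close>
    have "((\<lambda>t::real. (\<lambda>r. a (0, 0, 0, r)) (t *\<^sub>R s)) has_derivative (\<lambda>h. (\<lambda>_. 0) (h *\<^sub>R s))) (at 0 within UNIV)"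
    proof (rule has_derivative_in_compose[where g = "\<lambda>r. a (0, 0, 0, r)"])
      show "((\<lambda>t::real. t *\<^sub>R s) has_derivative (\<lambda>h. h *\<^sub>R s)) (at 0 within UNIV)"
        by (auto intro!: derivative_eq_intros)
      have "((\<lambda>r. a (0, 0, 0, r)) has_derivative (\<lambda>_. 0)) (at 0 within sym_tuples)"
        using assms(2) by (simp add: grad_r_zero_def)
      then show "((\<lambda>r. a (0, 0, 0, r)) has_derivative (\<lambda>_. 0)) (at (0 *\<^sub>R s) within range (\<lambda>t. t *\<^sub>R s))"
        by (auto intro: has_derivative_subset s)
    qed
    moreover have "((\<lambda>t::real. a (0, 0, 0, t *\<^sub>R s)) has_derivative (\<lambda>h. f' 0 (0, 0, 0, h *\<^sub>R s))) (at 0 within UNIV)"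
    proof (rule has_derivative_in_compose[where g = a and f = "\<lambda>t. (0, 0, 0, t *\<^sub>R s)"])
      show "((\<lambda>t::real. (0, 0, 0, t *\<^sub>R s)) has_derivative (\<lambda>h. (0, 0, 0, h *\<^sub>R s))) (at 0 within UNIV)"
        by (auto intro!: derivative_eq_intros)
      have "0 \<in> (jets :: ((real^'n) \<times> ('n, 'm) jet) set)"
        by (simp add: jets_eq linear_0[OF linear_jet_proj])
      from f'[OF this] have a0: "(a has_derivative blinfun_apply (f' 0)) (at 0 within jets)" .
      have eq: "((0, 0, 0, 0 *\<^sub>R s) :: (real^'n) \<times> ('n, 'm) jet) = 0" by (simp add: zero_prod_def)
      from a0 show "(a has_derivative blinfun_apply (f' 0)) (at (0, 0, 0, 0 *\<^sub>R s) within range (\<lambda>t. (0, 0, 0, t *\<^sub>R s)))"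
        unfolding eq by (rule has_derivative_subset) (auto simp: jets_def s)
    qed
    ultimately have "(\<lambda>h. f' 0 (0, 0, 0, h *\<^sub>R s)) = (\<lambda>h. 0)"
      by (auto intro: has_derivative_unique)
    from fun_cong[OF this, of 1] have "f' 0 (0, 0, 0, s) = 0" by simp
    moreover have "jet_proj (0, 0, 0, r) = (0, 0, 0, s)" by (simp add: jet_proj_def s_def)
    ultimately show ?thesis by (simp add: b'_def P linear_0[OF linear_jet_proj])
  qed
  show ?thesis
    by (rule that[of b b' "B * norm P * norm P"])
      (use z1 z2 z3 B(1) in \<open>auto simp: b_def jets_eq\<close>)
qed

section \<open>The rescaled nonlinear term as an operator on Hoelder functions\<close>

definition jet_scale :: "real \<Rightarrow> ('n::finite, 'm::finite) jet \<Rightarrow> ('n, 'm) jet" where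
  "jet_scale R e = (R\<^sup>2 *\<^sub>R fst e, R *\<^sub>R fst (snd e), snd (snd e))"

lemma bounded_linear_jet_scale: "bounded_linear (jet_scale R)"
  unfolding jet_scale_def [abs_def]
  by (intro bounded_linear_Pair bounded_linear_const_scaleR bounded_linear_fst_comp bounded_linear_snd_comp
      bounded_linear_ident)

lemmas linear_jet_scale = bounded_linear.linear[OF bounded_linear_jet_scale]

lemma norm_jet_scale:
  assumes "0 \<le> R" "R \<le> 1"
  shows "norm (jet_scale R e) \<le> norm e"
proof -
  obtain p q r where e: "e = (p, q, r)" by (cases e) auto
  have R2: "R\<^sup>2 \<le> 1" using assms by (simp add: power_le_one)
  have "(R\<^sup>2 * norm p)\<^sup>2 + (\<bar>R\<bar> * norm q)\<^sup>2 \<le> (norm p)\<^sup>2 + (norm q)\<^sup>2"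
    using mult_right_mono[OF R2, of "norm p"] mult_right_mono[OF assms(2), of "norm q"] assms
    by (intro add_mono power_mono) auto
  then show ?thesis by (simp add: e jet_scale_def norm_Pair)
qed

context
  fixes b :: "(real^'n::finite) \<times> ('n, 'm::finite) jet \<Rightarrow> real^'m"
    and b' :: "(real^'n) \<times> ('n, 'm) jet \<Rightarrow> ((real^'n) \<times> ('n, 'm) jet) \<Rightarrow>\<^sub>L (real^'m)"
    and L \<alpha> :: real
  assumes deriv: "\<And>z. (b has_derivative blinfun_apply (b' z)) (at z)" and L: "L \<ge> 0"
    and Lip: "\<And>z w. norm z \<le> 1 \<Longrightarrow> norm w \<le> 1 \<Longrightarrow> norm (b' z - b' w) \<le> L * norm (z - w)"
    and b'_r: "\<And>r. b' 0 (0, 0, 0, r) = 0"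
    and \<alpha>: "0 < \<alpha>" "\<alpha> < 1"
begin

text \<open>At the origin \<open>b'\<close> ignores the Hessian slot, and the other two slots carry
  R^2 and R, both at most R. What remains is the change of \<open>b'\<close> between 0 and z, of
  order \<rho>. So the derivative is small once both R and \<rho> are.\<close>

lemma derivative_jet_scale_bound:
  assumes R: "0 \<le> R" "R \<le> 1" and z: "norm z \<le> \<rho>" "\<rho> \<le> 1"
  shows "norm (b' z (0, jet_scale R e)) \<le> (L * \<rho> + 2 * norm (b' 0) * R) * norm e"
proof -
  obtain p q r where e: "e = (p, q, r)" by (cases e) auto
  have pq: "norm p \<le> norm e" "norm q \<le> norm e"
    using norm_fst_le[of p "(q, r)"] norm_snd_le[of "(q, r)" p] norm_fst_le[of q r] by (auto simp: e)
  have "b' z (0, jet_scale R e) = (b' z - b' 0) (0, jet_scale R e) + b' 0 (0, R\<^sup>2 *\<^sub>R p, R *\<^sub>R q, 0) + b' 0 (0, 0, 0, r)"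
    by (simp add: blinfun.diff_left e jet_scale_def flip: blinfun.add_right)
  also have "\<dots> = (b' z - b' 0) (0, jet_scale R e) + b' 0 (0, R\<^sup>2 *\<^sub>R p, R *\<^sub>R q, 0)"
    by (simp add: b'_r)
  also have "norm \<dots> \<le> norm ((b' z - b' 0) (0, jet_scale R e)) + norm (b' 0 (0, R\<^sup>2 *\<^sub>R p, R *\<^sub>R q, 0))"
    by (rule norm_triangle_ineq)
  also have "norm ((b' z - b' 0) (0, jet_scale R e)) \<le> norm (b' z - b' 0) * norm ((0 :: real^'n, jet_scale R e))"
    by (rule norm_blinfun)
  also have "\<dots> \<le> (L * \<rho>) * norm e"
  proof (rule mult_mono)
    have "norm (b' z - b' 0) \<le> L * norm z" using Lip[of z 0] z by simp
    also have "\<dots> \<le> L * \<rho>" using z L by (intro mult_left_mono)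
    finally show "norm (b' z - b' 0) \<le> L * \<rho>" .
    show "norm ((0 :: real^'n, jet_scale R e)) \<le> norm e"
      using norm_jet_scale[OF R, of e] by (simp add: norm_Pair)
    show "0 \<le> L * \<rho>" using L z norm_ge_zero[of z] by (intro mult_nonneg_nonneg) linarith+
  qed simp
  also have "norm (b' 0 (0, R\<^sup>2 *\<^sub>R p, R *\<^sub>R q, 0)) \<le> norm (b' 0) * norm ((0 :: real^'n, R\<^sup>2 *\<^sub>R p, R *\<^sub>R q, 0 :: real^'n^'n^'m))"
    by (rule norm_blinfun)
  also have "\<dots> \<le> norm (b' 0) * (2 * R * norm e)"
  proof (rule mult_left_mono)
    have "norm ((0 :: real^'n, R\<^sup>2 *\<^sub>R p, R *\<^sub>R q, 0 :: real^'n^'n^'m)) = norm (R\<^sup>2 *\<^sub>R p, R *\<^sub>R q)"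
      by (simp add: norm_Pair)
    also have "\<dots> \<le> R\<^sup>2 * norm p + R * norm q"
      using norm_Pair_le[of "R\<^sup>2 *\<^sub>R p" "R *\<^sub>R q"] R by simp
    also have "\<dots> \<le> R * norm e + R * norm e"
    proof (rule add_mono)
      have "R\<^sup>2 \<le> R" using R by (simp add: power2_eq_square mult_left_le)
      then show "R\<^sup>2 * norm p \<le> R * norm e" using pq R by (intro mult_mono) auto
      show "R * norm q \<le> R * norm e" using pq R by (intro mult_left_mono)
    qed
    finally show "norm ((0 :: real^'n, R\<^sup>2 *\<^sub>R p, R *\<^sub>R q, 0 :: real^'n^'n^'m)) \<le> 2 * R * norm e" by simp
  qed simp
  finally show ?thesis by (simp add: algebra_simps)
qed

text \<open>The second differences of \<open>b\<close> are controlled by applying the mean value inequality along the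
  segment between the two jets.\<close>

lemma nemytskii_contraction:
  assumes R: "0 < R" and \<rho>: "R + \<rho> \<le> 1"
    and e1: "hoelder_le \<alpha> \<rho> e1" and e2: "hoelder_le \<alpha> \<rho> e2"
    and d: "hoelder_le \<alpha> M (\<lambda>y. e1 y - e2 y)"
  shows "hoelder_le \<alpha> ((3 * L + 2 * norm (b' 0)) * (R + \<rho>) * M)
    (\<lambda>y. b (R *\<^sub>R y, jet_scale R (e1 y)) - b (R *\<^sub>R y, jet_scale R (e2 y)))"
proof -
  let ?B = "norm (b' 0)"
  define \<kappa> where "\<kappa> = L * (R + \<rho>) + 2 * ?B * R"
  define e where "e t y = e2 y + t *\<^sub>R (e1 y - e2 y)" for t y
  define Z where "Z t y = (R *\<^sub>R y, jet_scale R (e t y))" for t y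
  have nn: "\<rho> \<ge> 0" "M \<ge> 0" using hoelder_le_nonneg e1 d by auto
  then have R1: "0 \<le> R" "R \<le> 1" using R \<rho> by auto
  have ecomb: "e t y = (1 - t) *\<^sub>R e2 y + t *\<^sub>R e1 y" for t y
    by (simp add: e_def algebra_simps)
  have et: "hoelder_le \<alpha> \<rho> (e t)" if "t \<in> {0..1}" for t
  proof -
    have "hoelder_le \<alpha> (\<bar>1 - t\<bar> * \<rho> + \<bar>t\<bar> * \<rho>) (\<lambda>y. (1 - t) *\<^sub>R e2 y + t *\<^sub>R e1 y)"
      by (intro hoelder_le_add hoelder_le_scaleR e1 e2)
    then show ?thesis using that by (simp add: ecomb [abs_def] algebra_simps)
  qed
  have nZ: "norm (Z t y) \<le> R + \<rho>" if "t \<in> {0..1}" "norm y \<le> 1" for t y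
  proof -
    have "norm (Z t y) \<le> norm (R *\<^sub>R y) + norm (jet_scale R (e t y))"
      unfolding Z_def by (rule norm_Pair_le)
    also have "norm (R *\<^sub>R y) \<le> R * 1" using R that by (simp add: mult_left_mono)
    also have "norm (jet_scale R (e t y)) \<le> \<rho>"
      using norm_jet_scale[OF R1, of "e t y"] hoelder_leD(1)[OF et[OF that(1)] that(2)] by linarith
    finally show ?thesis by simp
  qed
  have dZ: "norm (Z t y - Z t y') \<le> (2 * R + \<rho>) * norm (y - y') powr \<alpha>"
    if "t \<in> {0..1}" "norm y \<le> 1" "norm y' \<le> 1" for t y y'
  proof -
    have "Z t y - Z t y' = (R *\<^sub>R (y - y'), jet_scale R (e t y - e t y'))"
      by (simp add: Z_def linear_diff[OF linear_jet_scale] scaleR_diff_right)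
    then have "norm (Z t y - Z t y') \<le> norm (R *\<^sub>R (y - y')) + norm (jet_scale R (e t y - e t y'))"
      by (metis norm_Pair_le)
    also have "norm (jet_scale R (e t y - e t y')) \<le> norm (e t y - e t y')"
      by (rule norm_jet_scale[OF R1])
    also have "\<dots> \<le> \<rho> * norm (y - y') powr \<alpha>" by (rule hoelder_leD(2)[OF et]) (use that in auto)
    also have "norm (R *\<^sub>R (y - y')) \<le> R * (2 * norm (y - y') powr \<alpha>)"
    proof -
      have "norm (y - y') \<le> 2" using norm_triangle_ineq4[of y y'] that by simp
      then show ?thesis using le_two_powr[of "norm (y - y')" \<alpha>] \<alpha> R by (simp add: mult_left_mono)
    qed
    finally show ?thesis by (simp add: algebra_simps)
  qed
  have derZ: "((\<lambda>t. b (Z t y)) has_derivative (\<lambda>s. s *\<^sub>R b' (Z t y) (0, jet_scale R (e1 y - e2 y)))) (at t within S)" for t y S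
  proof -
    have "Z t y = (R *\<^sub>R y, jet_scale R (e2 y)) + t *\<^sub>R (0, jet_scale R (e1 y - e2 y))" for t
      by (simp add: Z_def e_def linear_add[OF linear_jet_scale] linear_cmul[OF linear_jet_scale])
    then have "((\<lambda>t. Z t y) has_derivative (\<lambda>s. s *\<^sub>R (0, jet_scale R (e1 y - e2 y)))) (at t)"
      by (auto intro!: derivative_eq_intros)
    from has_derivative_compose[OF this deriv] have
      "((\<lambda>t. b (Z t y)) has_derivative (\<lambda>s. b' (Z t y) (s *\<^sub>R (0, jet_scale R (e1 y - e2 y))))) (at t)" .
    then show ?thesis
      by (simp only: blinfun.scaleR_right) (rule has_derivative_at_withinI)
  qed
  have b'Z: "norm (b' (Z t y) (0, jet_scale R v)) \<le> \<kappa> * norm v" if "t \<in> {0..1}" "norm y \<le> 1" for t y v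
    unfolding \<kappa>_def by (rule derivative_jet_scale_bound[OF R1 nZ[OF that] \<rho>])
  have on: "onorm (\<lambda>s::real. s *\<^sub>R v) \<le> norm v" for v :: "real^'m"
    by (rule onorm_le) (simp add: mult.commute)
  have \<kappa>: "\<kappa> \<ge> 0" using L nn R by (simp add: \<kappa>_def)
  define D where "D y = b (Z 1 y) - b (Z 0 y)" for y
  have "hoelder_le \<alpha> ((3 * L + 2 * ?B) * (R + \<rho>) * M) D"
  proof (rule hoelder_leI)
    have "\<kappa> * M \<le> ((3 * L + 2 * ?B) * (R + \<rho>)) * M"
      unfolding \<kappa>_def using L nn R by (intro mult_right_mono) (auto simp: algebra_simps)
    moreover have "norm (D y) \<le> \<kappa> * M" if y: "norm y \<le> 1" for y
    proof -
      have "norm (b (Z 1 y) - b (Z 0 y)) \<le> \<kappa> * M * norm (1 - 0 :: real)"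
      proof (rule differentiable_bound[of "{0..1::real}", OF _ derZ])
        fix t :: real assume t: "t \<in> {0..1}"
        have "norm (b' (Z t y) (0, jet_scale R (e1 y - e2 y))) \<le> \<kappa> * norm (e1 y - e2 y)"
          by (rule b'Z[OF t y])
        also have "\<dots> \<le> \<kappa> * M" using \<kappa> hoelder_leD(1)[OF d y] by (intro mult_left_mono)
        finally show "onorm (\<lambda>s. s *\<^sub>R b' (Z t y) (0, jet_scale R (e1 y - e2 y))) \<le> \<kappa> * M"
          using on order_trans by blast
      qed auto
      then show ?thesis by (simp add: D_def)
    qed
    ultimately show "norm (D y) \<le> (3 * L + 2 * ?B) * (R + \<rho>) * M" if "norm y \<le> 1" for y
      using that order_trans by blast
  next
    fix y y' :: "real^'n" assume y: "norm y \<le> 1" "norm y' \<le> 1"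
    let ?h = "norm (y - y') powr \<alpha>"
    \<comment> \<open>The first summand stems from the Hoelder bound of the jets Z, with 2R because
      the Lipschitz dependence on y is converted on a set of diameter 2. Together with \<kappa> it
      is at most \<open>(3 * L + 2 * norm (b' 0)) * (R + \<rho>)\<close>.\<close>
    let ?K = "(L * (2 * R + \<rho>) + \<kappa>) * M * ?h"
    let ?g = "\<lambda>t y. b' (Z t y) (0, jet_scale R (e1 y - e2 y))"
    have "norm ((b (Z 1 y) - b (Z 1 y')) - (b (Z 0 y) - b (Z 0 y'))) \<le> ?K * norm (1 - 0 :: real)"
    proof (rule differentiable_bound[of "{0..1::real}", OF _ has_derivative_diff[OF derZ derZ]])
      fix t :: real assume t: "t \<in> {0..1}"
      let ?v = "e1 y - e2 y" and ?v' = "e1 y' - e2 y'"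
      have eq: "(0, jet_scale R (?v - ?v')) = (0 :: real^'n, jet_scale R ?v) - (0, jet_scale R ?v')"
        by (simp add: linear_diff[OF linear_jet_scale, of _ ?v ?v'])
      \<comment> \<open>Discrete product rule: either \<open>b'\<close> moves and the difference of
        the jets is bounded by M, or that difference moves and \<open>b'\<close> is bounded by
        \<kappa>. The first term needs \<open>b'\<close> to be Lipschitz.\<close>
      have "?g t y - ?g t y' = (b' (Z t y) - b' (Z t y')) (0, jet_scale R ?v) + b' (Z t y') (0, jet_scale R (?v - ?v'))"
        unfolding eq blinfun.diff_left blinfun.diff_right by simp
      then have "norm (?g t y - ?g t y') \<le> norm ((b' (Z t y) - b' (Z t y')) (0, jet_scale R ?v)) + norm (b' (Z t y') (0, jet_scale R (?v - ?v')))"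
        by (metis norm_triangle_ineq)
      also have "norm (b' (Z t y') (0, jet_scale R (?v - ?v'))) \<le> \<kappa> * norm (?v - ?v')"
        by (rule b'Z[OF t y(2)])
      also have "\<dots> \<le> \<kappa> * (M * ?h)" using \<kappa> hoelder_leD(2)[OF d y] by (intro mult_left_mono)
      also have "norm ((b' (Z t y) - b' (Z t y')) (0, jet_scale R ?v)) \<le> norm (b' (Z t y) - b' (Z t y')) * norm ((0 :: real^'n, jet_scale R ?v))"
        by (rule norm_blinfun)
      also have "\<dots> \<le> (L * ((2 * R + \<rho>) * ?h)) * M"
      proof (rule mult_mono)
        have "norm (b' (Z t y) - b' (Z t y')) \<le> L * norm (Z t y - Z t y')"
          using nZ[OF t y(1)] nZ[OF t y(2)] \<rho> by (intro Lip) auto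
        also have "\<dots> \<le> L * ((2 * R + \<rho>) * ?h)" using dZ[OF t y] L by (intro mult_left_mono)
        finally show "norm (b' (Z t y) - b' (Z t y')) \<le> L * ((2 * R + \<rho>) * ?h)" .
        show "norm ((0 :: real^'n, jet_scale R ?v)) \<le> M"
          using norm_jet_scale[OF R1, of ?v] hoelder_leD(1)[OF d y(1)] by (simp add: norm_Pair)
        show "0 \<le> L * ((2 * R + \<rho>) * ?h)" using L R nn by simp
      qed simp
      finally have "norm (?g t y - ?g t y') \<le> ?K" by (simp add: algebra_simps)
      moreover have "(\<lambda>s. s *\<^sub>R ?g t y - s *\<^sub>R ?g t y') = (\<lambda>s. s *\<^sub>R (?g t y - ?g t y'))"
        by (simp add: scaleR_diff_right)
      ultimately show "onorm (\<lambda>s. s *\<^sub>R ?g t y - s *\<^sub>R ?g t y') \<le> ?K"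
        using on[of "?g t y - ?g t y'"] by simp
    qed auto
    also have "(b (Z 1 y) - b (Z 1 y')) - (b (Z 0 y) - b (Z 0 y')) = D y - D y'"
      by (simp add: D_def)
    also have "?K * norm (1 - 0 :: real) \<le> (3 * L + 2 * ?B) * (R + \<rho>) * M * ?h"
      unfolding \<kappa>_def using L nn R by (simp, intro mult_right_mono) (auto simp: algebra_simps)
    finally show "norm (D y - D y') \<le> (3 * L + 2 * ?B) * (R + \<rho>) * M * ?h" .
  qed
  moreover have "D = (\<lambda>y. b (R *\<^sub>R y, jet_scale R (e1 y)) - b (R *\<^sub>R y, jet_scale R (e2 y)))"
    by (simp add: D_def Z_def e_def fun_eq_iff)
  ultimately show ?thesis by simp
qed

text \<open>At the zero jet only the explicit dependence on x is left, and over a ball of radius R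
  it is of order R since b vanishes at the origin. This is the starting error of the
  iteration.\<close>

lemma nemytskii_zero:
  assumes R: "0 < R" "R \<le> 1" and b0: "b 0 = 0"
  shows "hoelder_le \<alpha> (2 * ((L + norm (b' 0)) * R)) (\<lambda>y. b (R *\<^sub>R y, 0))"
proof -
  let ?B = "norm (b' 0)"
  have lip: "norm (b z - b w) \<le> (L + ?B) * norm (z - w)" if "norm z \<le> 1" "norm w \<le> 1" for z w
  proof (rule differentiable_bound[of "cball 0 1", OF convex_cball])
    show "(b has_derivative blinfun_apply (b' x)) (at x within cball 0 1)" for x
      by (rule has_derivative_at_withinI[OF deriv])
    show "onorm (blinfun_apply (b' x)) \<le> L + ?B" if "x \<in> cball 0 1" for x
    proof -
      have "norm (b' x) \<le> norm (b' x - b' 0) + ?B" using norm_triangle_ineq[of "b' x - b' 0" "b' 0"] by simp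
      also have "norm (b' x - b' 0) \<le> L * norm x" using Lip[of x 0] that by simp
      also have "\<dots> \<le> L * 1" using that L by (intro mult_left_mono) auto
      finally show ?thesis by (simp add: norm_blinfun.rep_eq)
    qed
  qed (use that in auto)
  have n: "norm ((R *\<^sub>R y, 0) :: (real^'n) \<times> ('n, 'm) jet) = R * norm y" for y
    using R by (simp add: norm_Pair)
  have le: "R * norm y \<le> R" if "norm y \<le> 1" for y :: "real^'n" using R that by (simp add: mult_left_le)
  have l: "norm (b (R *\<^sub>R y, 0) - b (R *\<^sub>R y', 0)) \<le> (L + ?B) * R * norm (y - y')"
    if "norm y \<le> 1" "norm y' \<le> 1" for y y'
  proof -
    have "norm ((R *\<^sub>R y, 0) - (R *\<^sub>R y', 0) :: (real^'n) \<times> ('n, 'm) jet) = R * norm (y - y')"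
      using n[of "y - y'"] by (simp add: scaleR_diff_right)
    then show ?thesis
      using lip[of "(R *\<^sub>R y, 0)" "(R *\<^sub>R y', 0)"] n[of y] n[of y'] le[OF that(1)] le[OF that(2)] R
      by (simp add: mult.assoc)
  qed
  show ?thesis
  proof (rule hoelder_le_Lipschitz[OF \<alpha> _ _ l])
    show "norm (b (R *\<^sub>R y, 0)) \<le> (L + ?B) * R" if "norm y \<le> 1" for y
    proof -
      have "norm (b (R *\<^sub>R y, 0)) \<le> (L + ?B) * R * norm y"
        using l[OF that, of 0] b0 by (simp add: zero_prod_def)
      also have "\<dots> \<le> (L + ?B) * R * 1" using that L R by (intro mult_left_mono) auto
      finally show ?thesis by simp
    qed
  qed (use L R in auto)
qed

end

section \<open>A contraction principle in Hoelder balls\<close>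

lemma hoelder_le_LIMSEQ:
  assumes "\<And>k. k \<ge> K \<Longrightarrow> hoelder_le \<alpha> M (f k)" "\<And>x. norm x \<le> 1 \<Longrightarrow> (\<lambda>k. f k x) \<longlonglongrightarrow> g x"
  shows "hoelder_le \<alpha> M g"
proof (rule hoelder_leI)
  fix x y :: 'a assume x: "norm x \<le> 1"
  show "norm (g x) \<le> M"
    using hoelder_leD(1)[OF assms(1) x]
    by (intro tendsto_upperbound[OF tendsto_norm[OF assms(2)[OF x]]] eventually_sequentiallyI[of K]) auto
  assume y: "norm y \<le> 1"
  show "norm (g x - g y) \<le> M * norm (x - y) powr \<alpha>"
    using hoelder_leD(2)[OF assms(1) x y]
    by (intro tendsto_upperbound[OF tendsto_norm[OF tendsto_diff[OF assms(2)[OF x] assms(2)[OF y]]]] eventually_sequentiallyI[of K]) auto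
qed

text \<open>Picard iteration from zero, carried out with the predicate instead of a complete normed
  space. The functions are total but controlled only on the unit ball, so the fixed point equation
  holds just there.\<close>

lemma hoelder_le_fixpoint:
  fixes F :: "('a::real_normed_vector \<Rightarrow> 'b::banach) \<Rightarrow> 'a \<Rightarrow> 'b"
  assumes self: "\<And>f. hoelder_le \<alpha> \<delta> f \<Longrightarrow> hoelder_le \<alpha> \<delta> (F f)" and "\<delta> \<ge> 0"
    and contr: "\<And>f g M. hoelder_le \<alpha> \<delta> f \<Longrightarrow> hoelder_le \<alpha> \<delta> g \<Longrightarrow> hoelder_le \<alpha> M (\<lambda>y. f y - g y) \<Longrightarrow>
      hoelder_le \<alpha> (M / 2) (\<lambda>y. F f y - F g y)"
  obtains f where "hoelder_le \<alpha> \<delta> f" "\<And>y. norm y \<le> 1 \<Longrightarrow> F f y = f y"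
proof -
  define u where "u k = (F ^^ k) (\<lambda>_. 0)" for k
  have u0: "u 0 = (\<lambda>_. 0)" and uS: "u (Suc k) = F (u k)" for k by (simp_all add: u_def)
  have bd: "hoelder_le \<alpha> \<delta> (u k)" for k
    by (induction k) (use \<open>\<delta> \<ge> 0\<close> self in \<open>auto simp: u0 uS intro!: hoelder_leI\<close>)
  have inc: "hoelder_le \<alpha> (2 * \<delta> / 2 ^ k) (\<lambda>y. u (Suc k) y - u k y)" for k
  proof (induction k)
    case 0
    show ?case using hoelder_le_diff[OF bd bd, of 1 0] by simp
  next
    case (Suc k)
    from contr[OF bd bd Suc] show ?case by (simp add: uS)
  qed
  \<comment> \<open>The exact partial sum of the geometric series is kept so that the induction
    closes; the subtracted term is dropped afterwards.\<close>
  have tel: "hoelder_le \<alpha> (4 * \<delta> / 2 ^ k - 4 * \<delta> / 2 ^ (k + m)) (\<lambda>y. u (k + m) y - u k y)" for k m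
  proof (induction m)
    case 0
    show ?case by (simp add: hoelder_le_def)
  next
    case (Suc m)
    from hoelder_le_add[OF inc[of "k + m"] Suc] show ?case by (simp add: field_simps)
  qed
  have cau: "hoelder_le \<alpha> (4 * \<delta> / 2 ^ k) (\<lambda>y. u m y - u k y)" if "m \<ge> k" for k m
    using hoelder_le_mono[OF tel[of k "m - k"], of "4 * \<delta> / 2 ^ k"] that \<open>\<delta> \<ge> 0\<close> by simp
  have lim0: "(\<lambda>k. 4 * \<delta> / 2 ^ k) \<longlonglongrightarrow> 0"
    using LIMSEQ_divide_realpow_zero[of 2 "4 * \<delta>"] by simp
  define f where "f y = lim (\<lambda>k. u k y)" for y
  have f: "(\<lambda>k. u k y) \<longlonglongrightarrow> f y" if y: "norm y \<le> 1" for y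
  proof -
    have "Cauchy (\<lambda>k. u k y)"
    proof (rule metric_CauchyI)
      fix e :: real assume "e > 0"
      then have "\<forall>\<^sub>F k in sequentially. 4 * \<delta> / 2 ^ k < e / 2"
        by (intro order_tendstoD(2)[OF lim0]) simp
      then obtain K where K: "4 * \<delta> / 2 ^ K < e / 2" by (auto simp: eventually_sequentially)
      have near: "dist (u m y) (u K y) < e / 2" if "m \<ge> K" for m
        using hoelder_leD(1)[OF cau[OF that] y] K by (simp add: dist_norm)
      show "\<exists>K. \<forall>m\<ge>K. \<forall>n\<ge>K. dist (u m y) (u n y) < e"
        using dist_triangle_half_l[OF near near] by blast
    qed
    then show ?thesis by (simp add: f_def Cauchy_convergent_iff convergent_LIMSEQ_iff)
  qed
  have fb: "hoelder_le \<alpha> \<delta> f" by (rule hoelder_le_LIMSEQ[OF bd f])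
  have fu: "hoelder_le \<alpha> (4 * \<delta> / 2 ^ k) (\<lambda>y. f y - u k y)" for k
    by (rule hoelder_le_LIMSEQ[OF cau tendsto_diff[OF f tendsto_const]])
  have "F f y = f y" if y: "norm y \<le> 1" for y
  proof -
    have "norm (F f y - u (Suc k) y) \<le> 4 * \<delta> / 2 ^ k / 2" for k
      using hoelder_leD(1)[OF contr[OF fb bd fu] y, of k] by (simp add: uS)
    then have "(\<lambda>k. F f y - u (Suc k) y) \<longlonglongrightarrow> 0"
      by (intro Lim_null_comparison[OF always_eventually tendsto_divide_zero[OF lim0, of 2]] allI)
    then have "(\<lambda>k. F f y - (F f y - u (Suc k) y)) \<longlonglongrightarrow> F f y - 0"
      by (intro tendsto_diff tendsto_const)
    then have "(\<lambda>k. u (Suc k) y) \<longlonglongrightarrow> F f y" by simp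
    then show ?thesis using LIMSEQ_unique[OF LIMSEQ_Suc[OF f[OF y]]] by simp
  qed
  with fb show ?thesis using that by blast
qed

section \<open>Quadratic harmonic polynomials and derivatives on closed balls\<close>

definition quad0 :: "'n \<Rightarrow> 'n \<Rightarrow> 'm \<Rightarrow> real^'n \<Rightarrow> real^'m::finite" where
  "quad0 i k l y = axis l (y $ i * y $ k)"

definition quad1 :: "'n \<Rightarrow> 'n \<Rightarrow> 'm \<Rightarrow> real^'n \<Rightarrow> real^'n^'m::finite" where
  "quad1 i k l y = axis l (y $ k *\<^sub>R axis i 1 + y $ i *\<^sub>R axis k 1)"

definition quad2 :: "'n \<Rightarrow> 'n \<Rightarrow> 'm \<Rightarrow> real^'n^'n^'m::finite" where
  "quad2 i k l = axis l (axis i (axis k 1) + axis k (axis i 1))"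

lemma has_derivative_nth: "((\<lambda>y. y $ i) has_derivative (\<lambda>h. h $ i)) (at y within S)" for y :: "real^'n"
  by (simp add: bounded_linear_imp_has_derivative bounded_linear_vec_nth)

lemma has_derivative_quad0:
  "(quad0 i k l has_derivative (\<lambda>h. quad1 i k l y *v h)) (at y within S)" for y :: "real^'n"
proof (rule has_derivative_cart)
  fix j
  have eq: "(quad1 i k l y *v h) $ j = (if j = l then y $ i * h $ k + h $ i * y $ k else 0)" for h
    by (simp add: quad1_def matrix_vector_mul_component inner_add_left inner_axis' axis_nth axis_def[of l])
  show "((\<lambda>y. quad0 i k l y $ j) has_derivative (\<lambda>h. (quad1 i k l y *v h) $ j)) (at y within S)"
    unfolding eq unfolding quad0_def axis_def
    by (cases "j = l") (auto intro!: has_derivative_mult has_derivative_nth)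
qed

lemma quad2_mult: "quad2 i k l $ j *v h = (if j = l then h $ k *\<^sub>R axis i 1 + h $ i *\<^sub>R axis k 1 else 0)"
proof (cases "j = l")
  case True
  have entry: "quad2 i k l $ l $ r $ c =
      (if r = i then (if c = k then 1 else 0) else 0) + (if r = k then (if c = i then 1 else 0) else 0)" for r c
    by (simp add: quad2_def axis_def)
  have "(quad2 i k l $ l *v h) $ r = (if r = i then h $ k else 0) + (if r = k then h $ i else 0)" for r
    unfolding matrix_vector_mult_def entry
    by (auto simp: distrib_right sum.distrib if_distrib[of "\<lambda>x. x * _"] cong: if_cong)
  with True show ?thesis by (simp add: vec_eq_iff axis_def)
next
  case False
  then show ?thesis by (simp add: quad2_def axis_def[of l] vec_eq_iff matrix_vector_mult_def)
qed

lemma has_derivative_quad1: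
  "((\<lambda>y. quad1 i k l y $ j) has_derivative (\<lambda>h. quad2 i k l $ j *v h)) (at y within S)" for y :: "real^'n"
proof (cases "j = l")
  case True
  have "((\<lambda>y. y $ k *\<^sub>R axis i 1 + y $ i *\<^sub>R axis k 1) has_derivative 
     (\<lambda>h. h $ k *\<^sub>R axis i 1 + h $ i *\<^sub>R axis k (1::real))) (at y within S)" for y :: "real^'n"
    by (intro has_derivative_add has_derivative_scaleR_left has_derivative_nth)
  with True show ?thesis by (simp add: quad2_mult quad1_def axis_def[of l])
next
  case False
  then show ?thesis by (simp add: quad2_mult quad1_def axis_def[of l])
qed

lemma quad_at_0: "quad0 i k l 0 = 0" "quad1 i k l 0 = 0"
  by (simp_all add: quad0_def quad1_def vec_eq_iff axis_def)

lemma quad2_symmetric: "transpose (quad2 i k l $ j) = quad2 i k l $ j"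
  by (auto simp: quad2_def transpose_def vec_eq_iff axis_def)

lemma trace_quad2: "i \<noteq> k \<Longrightarrow> trace (quad2 i k l $ j) = 0"
  by (auto simp: quad2_def trace_def axis_def intro!: sum.neutral)

lemma quad2_entry: "i \<noteq> k \<Longrightarrow> quad2 i k l $ l $ k $ i = 1"
  by (simp add: quad2_def axis_def)

lemma hoelder_le_quad:
  fixes i k :: "'n::finite" and l :: "'m::finite"
  assumes "0 < \<alpha>" "\<alpha> < 1"
  obtains C where "C > 0" "hoelder_le \<alpha> C (\<lambda>y :: real^'n. (quad0 i k l y, quad1 i k l y, quad2 i k l :: real^'n^'n^'m))"
proof -
  let ?q = "quad2 i k l :: real^'n^'n^'m"
  have 2: "hoelder_le \<alpha> (norm ?q) (\<lambda>y :: real^'n. ?q)"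
    by (auto simp: hoelder_le_def)
  obtain D where 1: "hoelder_le \<alpha> D (quad1 i k l :: real^'n \<Rightarrow> real^'n^'m)"
  proof
    show "hoelder_le \<alpha> (real CARD('m) * (2 * (real CARD('n) * real CARD('n) * norm ?q))) (quad1 i k l)"
      by (rule hoelder_le_vec, rule hoelder_le_derivative[OF assms has_derivative_quad1])
        (auto simp: quad_at_0 Finite_Cartesian_Product.norm_nth_le)
  qed
  have 0: "hoelder_le \<alpha> (2 * (real CARD('m) * real CARD('n) * D)) (quad0 i k l :: real^'n \<Rightarrow> real^'m)"
    by (rule hoelder_le_derivative[OF assms has_derivative_quad0 hoelder_leD(1)[OF 1] quad_at_0(1)])
  note * = hoelder_le_Pair[OF 0 hoelder_le_Pair[OF 1 2]]
  show ?thesis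
    by (rule that[OF _ hoelder_le_mono[OF *], of "2 * (real CARD('m) * real CARD('n) * D) + (D + norm ?q) + 1"])
      (use hoelder_le_nonneg[OF *] in auto)
qed

section \<open>Uniqueness of derivatives within closed balls, and radial symmetry\<close>

lemma has_derivative_cball_unique:
  fixes x :: "'a::real_normed_vector"
  assumes "R > 0" and x: "x \<in> cball 0 R"
    and f: "(f has_derivative D) (at x within cball 0 R)" "(f has_derivative D') (at x within cball 0 R)"
  shows "D = D'"
proof
  fix h :: 'a
  have bl: "bounded_linear D" "bounded_linear D'" using f has_derivative_bounded_linear by auto
  \<comment> \<open>The segment from x to w stays in the ball, also when x is a boundary point, so
    both derivatives agree with a one-sided derivative on the real line.\<close>
  have eq: "D (w - x) = D' (w - x)" if w: "w \<in> cball 0 R" for w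
  proof -
    let ?p = "\<lambda>t::real. x + t *\<^sub>R (w - x)"
    have sub: "?p ` {0..1} \<subseteq> cball 0 R"
    proof clarify
      fix t :: real assume "t \<in> {0..1}"
      then have "(1 - t) *\<^sub>R x + t *\<^sub>R w \<in> cball 0 R"
        using x w by (intro convexD[OF convex_cball]) auto
      then show "?p t \<in> cball 0 R" by (simp add: algebra_simps)
    qed
    have p: "(?p has_derivative (\<lambda>t. t *\<^sub>R (w - x))) (at 0 within {0..1})"
      by (auto intro!: derivative_eq_intros)
    have "((\<lambda>t. f (?p t)) has_vector_derivative E (w - x)) (at 0 within {0..1})"
      if E: "(f has_derivative E) (at x within cball 0 R)" for E
    proof -
      have "(f has_derivative E) (at (?p 0) within ?p ` {0..1})"
        using has_derivative_subset[OF E sub] by simp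
      from has_derivative_in_compose[OF p this]
      have "((\<lambda>t. f (?p t)) has_derivative (\<lambda>t. E (t *\<^sub>R (w - x)))) (at 0 within {0..1})" .
      then show ?thesis
        by (simp add: has_vector_derivative_def linear_cmul[OF bounded_linear.linear[OF has_derivative_bounded_linear[OF E]]])
    qed
    from this[OF f(1)] this[OF f(2)] show ?thesis
      by (intro vector_derivative_unique_within[of 0 "{0..1}"]) (auto simp: at_within_Icc_at_right)
  qed
  \<comment> \<open>An arbitrary direction h need not point into the ball. But c is small enough for
    \<open>c *\<^sub>R h\<close> to lie in it, and this vector is the difference of the admissible
    directions towards \<open>c *\<^sub>R h\<close> and towards 0.\<close>
  define c where "c = R / (norm h + 1)"
  have c: "c > 0" using \<open>R > 0\<close> by (simp add: c_def add_nonneg_pos)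
  have "norm h / (norm h + 1) \<le> 1" by (simp add: divide_le_eq add_nonneg_pos)
  from mult_left_mono[OF this, of R] have "c * norm h \<le> R"
    using \<open>R > 0\<close> by (simp add: c_def)
  then have "c *\<^sub>R h \<in> cball 0 R" using c by simp
  from eq[OF this] eq[of 0] have "D (c *\<^sub>R h) = D' (c *\<^sub>R h)"
    using \<open>R > 0\<close> by (simp add: bl[THEN bounded_linear.linear, THEN linear_diff] bl[THEN bounded_linear.linear, THEN linear_neg])
  then show "D h = D' h"
    using c by (simp add: bl[THEN bounded_linear.linear, THEN linear_cmul])
qed

lemma jacobian_cball:
  fixes u :: "real^'n \<Rightarrow> real^'m"
  assumes "R > 0" "x \<in> cball 0 R" "(u has_derivative (\<lambda>h. A *v h)) (at x within cball 0 R)"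
  shows "jacobian u (at x within cball 0 R) = A"
proof -
  have "u differentiable (at x within cball 0 R)" using assms(3) by (auto simp: differentiable_def)
  then have "(u has_derivative frechet_derivative u (at x within cball 0 R)) (at x within cball 0 R)"
    by (simp add: frechet_derivative_works)
  from has_derivative_cball_unique[OF assms(1,2) this assms(3)] show ?thesis
    by (simp add: jacobian_def)
qed

lemma vec_derivatives_cball:
  fixes u :: "real^'n \<Rightarrow> real^'m"
  assumes "R > 0"
    and 1: "\<And>x. x \<in> cball 0 R \<Longrightarrow> (u has_derivative (\<lambda>h. g x *v h)) (at x within cball 0 R)"
    and 2: "\<And>x j. x \<in> cball 0 R \<Longrightarrow> ((\<lambda>x. g x $ j) has_derivative (\<lambda>h. H x $ j *v h)) (at x within cball 0 R)"
    and x: "x \<in> cball 0 R"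
  shows "grad_on (cball 0 R) u x = g x" "hess_on (cball 0 R) u x = H x"
    "((\<lambda>x. grad_on (cball 0 R) u x $ j) has_derivative (\<lambda>h. H x $ j *v h)) (at x within cball 0 R)"
proof -
  have g: "grad_on (cball 0 R) u x = g x" if "x \<in> cball 0 R" for x
    unfolding grad_on_def by (rule jacobian_cball[OF assms(1) that 1[OF that]])
  have d: "((\<lambda>x. grad_on (cball 0 R) u x $ j) has_derivative (\<lambda>h. H x $ j *v h)) (at x within cball 0 R)" for j
    by (rule has_derivative_transform[OF x _ 2[OF x]]) (simp add: g)
  show "grad_on (cball 0 R) u x = g x" by (rule g[OF x])
  show "hess_on (cball 0 R) u x = H x"
    by (simp add: hess_on_def vec_eq_iff jacobian_cball[OF assms(1) x d])
  show "((\<lambda>x. grad_on (cball 0 R) u x $ j) has_derivative (\<lambda>h. H x $ j *v h)) (at x within cball 0 R)"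
    by (rule d)
qed

text \<open>Invariance under the reflection in the coordinate \<open>i\<close> makes the mixed second derivatives at the
  origin odd.\<close>

lemma radially_symmetric_hessian:
  fixes u :: "real^'n \<Rightarrow> real^'m"
  assumes "R > 0"
    and 1: "\<And>x. x \<in> cball 0 R \<Longrightarrow> (u has_derivative (\<lambda>h. g x *v h)) (at x within cball 0 R)"
    and 2: "\<And>x j. x \<in> cball 0 R \<Longrightarrow> ((\<lambda>x. g x $ j) has_derivative (\<lambda>h. H x $ j *v h)) (at x within cball 0 R)"
    and rad: "radially_symmetric_on (cball 0 R) u" and "i \<noteq> k"
  shows "H 0 $ l $ k $ i = 0"
proof -
  let ?S = "cball (0 :: real^'n) R"
  define \<rho> :: "real^'n \<Rightarrow> real^'n" where "\<rho> x = (\<chi> j. if j = i then - x $ j else x $ j)" for x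
  have lin: "bounded_linear \<rho>"
  proof -
    have "linear \<rho>" by (rule linearI) (simp_all add: \<rho>_def vec_eq_iff)
    then show ?thesis by (simp add: linear_conv_bounded_linear)
  qed
  have n: "norm (\<rho> x) = norm x" for x
    unfolding norm_vec_def by (rule L2_set_cong) (auto simp: \<rho>_def)
  then have S: "\<rho> ` ?S \<subseteq> ?S" by auto
  have d: "(\<rho> has_derivative \<rho>) (at x within ?S)" for x
    by (rule bounded_linear_imp_has_derivative[OF lin])
  have u: "u x = u (\<rho> x)" if "x \<in> ?S" for x
    by (rule rad[unfolded radially_symmetric_on_def, rule_format]) (use that n in auto)
  \<comment> \<open>The reflection fixes the direction \<open>axis k 1\<close>, so the k-th partial
    derivative is again invariant; differentiating this in the reversed direction
    \<open>axis i 1\<close> then produces the sign.\<close>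
  have g: "g x $ l $ k = g (\<rho> x) $ l $ k" if x: "x \<in> ?S" for x
  proof -
    have "\<rho> x \<in> ?S" using x n by simp
    have "((\<lambda>x. u (\<rho> x)) has_derivative (\<lambda>h. g (\<rho> x) *v \<rho> h)) (at x within ?S)"
      by (rule has_derivative_in_compose[OF d has_derivative_subset[OF 1[OF \<open>\<rho> x \<in> ?S\<close>] S]])
    then have "(u has_derivative (\<lambda>h. g (\<rho> x) *v \<rho> h)) (at x within ?S)"
      by (rule has_derivative_transform[OF x, rotated]) (rule u)
    from has_derivative_cball_unique[OF \<open>R > 0\<close> x 1[OF x] this]
    have "g x *v axis k 1 = g (\<rho> x) *v \<rho> (axis k 1)" by (rule fun_cong)
    also have "\<rho> (axis k 1) = axis k 1"
      using \<open>i \<noteq> k\<close> by (auto simp: \<rho>_def vec_eq_iff axis_def)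
    finally show ?thesis
      by (simp add: matrix_vector_mult_basis column_def vec_eq_iff)
  qed
  have 0: "(0 :: real^'n) \<in> ?S" using \<open>R > 0\<close> by simp
  have \<rho>0: "\<rho> 0 = 0" by (simp add: \<rho>_def vec_eq_iff)
  have 3: "((\<lambda>x. g x $ l $ k) has_derivative (\<lambda>h. H 0 $ l $ k \<bullet> h)) (at 0 within ?S)"
    using bounded_linear.has_derivative[OF bounded_linear_vec_nth 2[OF 0, of l], of k]
    by (simp add: matrix_vector_mul_component)
  have "((\<lambda>x. g (\<rho> x) $ l $ k) has_derivative (\<lambda>h. H 0 $ l $ k \<bullet> \<rho> h)) (at 0 within ?S)"
    by (rule has_derivative_in_compose[where g = "\<lambda>x. g x $ l $ k", OF d]) (use has_derivative_subset[OF 3 S] in \<open>simp add: \<rho>0\<close>)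
  then have "((\<lambda>x. g x $ l $ k) has_derivative (\<lambda>h. H 0 $ l $ k \<bullet> \<rho> h)) (at 0 within ?S)"
    by (rule has_derivative_transform[OF 0, rotated]) (rule g)
  from has_derivative_cball_unique[OF \<open>R > 0\<close> 0 3 this]
  have "H 0 $ l $ k \<bullet> axis i 1 = H 0 $ l $ k \<bullet> \<rho> (axis i 1)" by (rule fun_cong)
  also have "\<rho> (axis i 1) = - axis i 1"
    by (auto simp: \<rho>_def vec_eq_iff axis_def)
  finally show ?thesis by (simp add: inner_axis)
qed

section \<open>Solutions\<close>

text \<open>The derivatives are carried along as explicit data, so that \<open>grad_on\<close> and
  \<open>hess_on\<close> have to be computed only once, after scaling back.\<close>

definition rescaled_solution ::
  "((real^'n::finite) \<times> ('n, 'm::finite) jet \<Rightarrow> real^'m) \<Rightarrow> real \<Rightarrow> real \<Rightarrow>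
   (real^'n \<Rightarrow> real^'m) \<Rightarrow> (real^'n \<Rightarrow> real^'n^'m) \<Rightarrow> (real^'n \<Rightarrow> real^'n^'n^'m) \<Rightarrow> bool" where
  "rescaled_solution a \<alpha> R v0 v1 v2 \<longleftrightarrow>
     (\<forall>y\<in>cball 0 1. (v0 has_derivative (\<lambda>h. v1 y *v h)) (at y within cball 0 1)) \<and>
     (\<forall>y\<in>cball 0 1. \<forall>j. ((\<lambda>y. v1 y $ j) has_derivative (\<lambda>h. v2 y $ j *v h)) (at y within cball 0 1)) \<and>
     v0 0 = 0 \<and> v1 0 = 0 \<and> (\<exists>M. hoelder_le \<alpha> M v2) \<and>
     (\<forall>y\<in>cball 0 1. (\<chi> j. trace (v2 y $ j)) = a (R *\<^sub>R y, R\<^sup>2 *\<^sub>R v0 y, R *\<^sub>R v1 y, v2 y))"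

text \<open>For each R the solutions are parametrised by the whole interval from \<delta>/2 to
  \<delta>. Its lower end keeps the quadratic part larger than the correction at the origin, its
  upper end keeps the jets small.\<close>

lemma unit_ball_solutions:
  fixes a :: "(real^'n::finite) \<times> ('n, 'm::finite) jet \<Rightarrow> real^'m"
  assumes \<alpha>: "0 < \<alpha>" "\<alpha> < 1" and a: "C2_on jets a" "a (0, 0, 0, 0) = 0" "grad_r_zero a"
    and ik: "i \<noteq> (k :: 'n)"
  obtains R\<^sub>0 \<delta> :: real where "R\<^sub>0 > 0" "\<delta> > 0"
    "\<And>R. 0 < R \<Longrightarrow> R \<le> R\<^sub>0 \<Longrightarrow> \<exists>v0 v1 v2.
      (\<forall>\<epsilon>\<in>{\<delta>/2..\<delta>}. rescaled_solution a \<alpha> R (v0 \<epsilon>) (v1 \<epsilon>) (v2 \<epsilon>) \<and> v2 \<epsilon> 0 $ l $ k $ i \<noteq> 0) \<and>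
      (\<forall>\<epsilon>\<in>{\<delta>/2..\<delta>}. \<forall>\<epsilon>'\<in>{\<delta>/2..\<delta>}. (\<forall>y\<in>cball 0 1. v2 \<epsilon> y = v2 \<epsilon>' y) \<longrightarrow> \<epsilon> = \<epsilon>')"
proof -
  obtain b b' L where ba: "\<And>z. z \<in> jets \<Longrightarrow> b z = a z"
    and b: "\<And>z. (b has_derivative blinfun_apply (b' z)) (at z)" "L \<ge> 0"
    "\<And>z w. norm z \<le> 1 \<Longrightarrow> norm w \<le> 1 \<Longrightarrow> norm (b' z - b' w) \<le> L * norm (z - w)"
    "\<And>r. b' 0 (0, 0, 0, r) = 0"
    using nonlinearity_extension[OF a(1,3)] by blast
  have "0 \<in> (jets :: ((real^'n) \<times> ('n, 'm) jet) set)"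
    by (simp add: jets_eq linear_0[OF linear_jet_proj])
  then have b0: "b 0 = 0" using a(2) ba by (simp add: zero_prod_def)
  obtain C and T0 :: "(real^'n \<Rightarrow> real^'m) \<Rightarrow> real^'n \<Rightarrow> real^'m" and T1 T2 where "C > 0"
    and T0: "\<And>f M x. hoelder_le \<alpha> M f \<Longrightarrow> x \<in> cball 0 1 \<Longrightarrow> (T0 f has_derivative (\<lambda>h. T1 f x *v h)) (at x within cball 0 1)"
    and T1: "\<And>f M x j. hoelder_le \<alpha> M f \<Longrightarrow> x \<in> cball 0 1 \<Longrightarrow>
       ((\<lambda>x. T1 f x $ j) has_derivative (\<lambda>h. T2 f x $ j *v h)) (at x within cball 0 1)"
    and T_0: "\<And>f M. hoelder_le \<alpha> M f \<Longrightarrow> T0 f 0 = 0" "\<And>f M. hoelder_le \<alpha> M f \<Longrightarrow> T1 f 0 = 0"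
    and T2: "\<And>f M x j. hoelder_le \<alpha> M f \<Longrightarrow> x \<in> cball 0 1 \<Longrightarrow> transpose (T2 f x $ j) = T2 f x $ j"
    "\<And>f M x j. hoelder_le \<alpha> M f \<Longrightarrow> x \<in> cball 0 1 \<Longrightarrow> trace (T2 f x $ j) = f x $ j"
    and Tb: "\<And>f M. hoelder_le \<alpha> M f \<Longrightarrow> hoelder_le \<alpha> (C * M) (\<lambda>x. (T0 f x, T1 f x, T2 f x))"
    and Td: "\<And>f M g N x. hoelder_le \<alpha> M f \<Longrightarrow> hoelder_le \<alpha> N g \<Longrightarrow> x \<in> cball 0 1 \<Longrightarrow>
      (T0 (\<lambda>y. f y - g y) x, T1 (\<lambda>y. f y - g y) x, T2 (\<lambda>y. f y - g y) x) = (T0 f x, T1 f x, T2 f x) - (T0 g x, T1 g x, T2 g x)"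
    using Schauder_right_inverse[OF \<alpha>, where ?'n = 'n and ?'m = 'm] by blast
  obtain Q where Q: "Q > 0" "hoelder_le \<alpha> Q (\<lambda>y :: real^'n. (quad0 i k l y, quad1 i k l y, quad2 i k l :: real^'n^'n^'m))"
    using hoelder_le_quad[OF \<alpha>] by blast
  define E where "E f x = (T0 f x, T1 f x, T2 f x)" for f x
  define H where "H y = (quad0 i k l y, quad1 i k l y, quad2 i k l :: real^'n^'n^'m)" for y :: "real^'n"
  define B where "B = norm (b' 0)"
  define K where "K = 3 * L + 2 * B + 1"
  define D where "D = Q + C"
  \<comment> \<open>\<eta> yields C\<eta> < 1/2, so corrections with data of size \<eta>\<delta>
    have Hessians below \<delta>/2. The two summands in the denominator of \<delta> give separately
    the contraction and the confinement of the jets to the unit ball, where \<open>b'\<close> is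
    Lipschitz. \<open>R\<^sub>0\<close> makes the starting error at most half of
    \<eta>\<delta>.\<close>
  define \<eta> where "\<eta> = 1 / (4 * (C + 1))"
  define \<delta> where "\<delta> = \<eta> / (2 * K * (1 + D) * D + (1 + D))"
  define R\<^sub>0 where "R\<^sub>0 = \<eta> * \<delta> / (2 * K)"
  have pos: "K \<ge> 1" "D > 0" "C < D" "\<eta> > 0" "\<eta> \<le> 1" "C * \<eta> < 1 / 2"
    using \<open>C > 0\<close> Q(1) b(2) by (auto simp: K_def D_def \<eta>_def B_def field_simps)
  have den: "2 * K * (1 + D) * D + (1 + D) > 0" using pos by (intro add_pos_pos mult_pos_pos) auto
  have \<delta>: "\<delta> > 0" using pos den by (simp add: \<delta>_def)
  have \<delta>1: "2 * K * (1 + D) * D * \<delta> \<le> \<eta>" "(1 + D) * \<delta> \<le> 1"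
  proof -
    have "(2 * K * (1 + D) * D + (1 + D)) * \<delta> = \<eta>" using den by (simp add: \<delta>_def)
    moreover have "2 * K * (1 + D) * D * \<delta> \<ge> 0" "(1 + D) * \<delta> \<ge> 0" using pos \<delta> by auto
    ultimately show "2 * K * (1 + D) * D * \<delta> \<le> \<eta>" "(1 + D) * \<delta> \<le> 1"
      using \<open>\<eta> \<le> 1\<close> unfolding distrib_right[of "2 * K * (1 + D) * D"] by linarith+
  qed
  have R0: "R\<^sub>0 > 0" using pos \<delta> by (simp add: R\<^sub>0_def)
  have R0\<delta>: "R\<^sub>0 \<le> \<delta>"
  proof -
    have "\<eta> / (2 * K) \<le> 1" using pos by (simp add: divide_le_eq)
    then show ?thesis using mult_right_mono[of "\<eta> / (2 * K)" 1 \<delta>] \<delta> by (simp add: R\<^sub>0_def)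
  qed
  show ?thesis
  proof (rule that[OF R0 \<delta>])
    fix R :: real assume R: "0 < R" "R \<le> R\<^sub>0"
    have RD: "R + D * \<delta> \<le> (1 + D) * \<delta>" using R R0\<delta> by (simp add: distrib_right)
    then have RD1: "R + D * \<delta> \<le> 1" using \<delta>1(2) by linarith
    have "R \<le> 1" using RD1 pos \<delta> mult_pos_pos[of D \<delta>] by linarith
    have KR: "2 * K * R \<le> \<eta> * \<delta>"
      using mult_left_mono[OF R(2), of "2 * K"] pos by (simp add: R\<^sub>0_def)
    have \<theta>: "2 * (K * (R + D * \<delta>) * D) \<le> \<eta>"
    proof -
      have "2 * (K * (R + D * \<delta>) * D) \<le> 2 * (K * ((1 + D) * \<delta>) * D)"
        using RD pos by (intro mult_left_mono mult_right_mono) auto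
      then show ?thesis using \<delta>1(1) by (simp add: mult_ac)
    qed
    define e where "e \<epsilon> f y = \<epsilon> *\<^sub>R H y + E f y" for \<epsilon> f y
    define F where "F \<epsilon> f y = b (R *\<^sub>R y, jet_scale R (e \<epsilon> f y))" for \<epsilon> f y
    have Eb: "hoelder_le \<alpha> (C * M) (E f)" if "hoelder_le \<alpha> M f" for M f
      using Tb[OF that] by (simp add: E_def [abs_def])
    have Ed: "E (\<lambda>y. f y - g y) x = E f x - E g x" if "hoelder_le \<alpha> M f" "hoelder_le \<alpha> N g" "norm x \<le> 1" for f g M N x
      using Td[OF that(1,2)] that(3) by (simp add: E_def)
    have eb: "hoelder_le \<alpha> (D * \<delta>) (e \<epsilon> f)" if "hoelder_le \<alpha> \<delta> f" "\<epsilon> \<in> {\<delta>/2..\<delta>}" for \<epsilon> f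
    proof (rule hoelder_le_mono)
      show "hoelder_le \<alpha> (\<bar>\<epsilon>\<bar> * Q + C * \<delta>) (e \<epsilon> f)"
        unfolding e_def [abs_def] H_def by (intro hoelder_le_add hoelder_le_scaleR Q(2) Eb that)
      have "\<epsilon> * Q \<le> \<delta> * Q" using that Q(1) by (intro mult_right_mono) auto
      then show "\<bar>\<epsilon>\<bar> * Q + C * \<delta> \<le> D * \<delta>" using that \<delta> by (simp add: D_def algebra_simps)
    qed
    have contr: "hoelder_le \<alpha> (M / 2) (\<lambda>y. F \<epsilon> f y - F \<epsilon> g y)"
      if "hoelder_le \<alpha> \<delta> f" "hoelder_le \<alpha> \<delta> g" "hoelder_le \<alpha> M (\<lambda>y. f y - g y)" "\<epsilon> \<in> {\<delta>/2..\<delta>}" for \<epsilon> f g M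
    proof (rule hoelder_le_mono)
      have "hoelder_le \<alpha> (C * M) (\<lambda>y. e \<epsilon> f y - e \<epsilon> g y)"
        using Eb[OF that(3)] Ed[OF that(1,2)] by (subst hoelder_le_cong) (auto simp: e_def)
      then show "hoelder_le \<alpha> ((3 * L + 2 * norm (b' 0)) * (R + D * \<delta>) * (C * M)) (\<lambda>y. F \<epsilon> f y - F \<epsilon> g y)"
        unfolding F_def
        by (intro nemytskii_contraction[OF b \<alpha> R(1) RD1 eb eb] that)
      have M: "M \<ge> 0" by (rule hoelder_le_nonneg[OF that(3)])
      have "(3 * L + 2 * norm (b' 0)) * (R + D * \<delta>) * C \<le> K * (R + D * \<delta>) * D"
        using pos R \<delta> b(2) \<open>C > 0\<close> by (intro mult_mono) (auto simp: K_def B_def)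
      also have "\<dots> \<le> 1 / 2" using \<theta> pos by linarith
      finally show "(3 * L + 2 * norm (b' 0)) * (R + D * \<delta>) * (C * M) \<le> M / 2"
        using mult_right_mono[OF _ M, of "(3 * L + 2 * norm (b' 0)) * (R + D * \<delta>) * C" "1/2"] by (simp add: mult.assoc)
    qed
    \<comment> \<open>F is split into its difference from the zero jet, bounded by the contraction
      estimate with second jet 0, and the value at the zero jet. Each takes half of
      \<eta>\<delta>.\<close>
    have Fb: "hoelder_le \<alpha> (\<eta> * \<delta>) (F \<epsilon> f)" if "hoelder_le \<alpha> \<delta> f" "\<epsilon> \<in> {\<delta>/2..\<delta>}" for \<epsilon> f
    proof (rule hoelder_le_mono)
      have z: "hoelder_le \<alpha> (D * \<delta>) (\<lambda>y::real^'n. 0 :: ('n, 'm) jet)"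
        using pos \<delta> by (auto simp: hoelder_le_def)
      have "hoelder_le \<alpha> ((3 * L + 2 * norm (b' 0)) * (R + D * \<delta>) * (D * \<delta>))
          (\<lambda>y. b (R *\<^sub>R y, jet_scale R (e \<epsilon> f y)) - b (R *\<^sub>R y, jet_scale R 0))"
      proof (rule nemytskii_contraction[OF b \<alpha> R(1) RD1 eb[OF that] z])
        have "(\<lambda>y. e \<epsilon> f y - 0) = e \<epsilon> f" by (rule ext) (rule diff_zero)
        then show "hoelder_le \<alpha> (D * \<delta>) (\<lambda>y. e \<epsilon> f y - 0)" using eb[OF that] by simp
      qed
      from hoelder_le_add[OF this nemytskii_zero[OF b \<alpha> R(1) \<open>R \<le> 1\<close> b0]]
      show "hoelder_le \<alpha> ((3 * L + 2 * norm (b' 0)) * (R + D * \<delta>) * (D * \<delta>) + 2 * ((L + norm (b' 0)) * R)) (F \<epsilon> f)"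
        by (simp add: F_def [abs_def] linear_0[OF linear_jet_scale])
      have "(3 * L + 2 * norm (b' 0)) * (R + D * \<delta>) * (D * \<delta>) \<le> K * (R + D * \<delta>) * (D * \<delta>)"
        using pos R \<delta> by (intro mult_right_mono) (auto simp: K_def B_def)
      moreover have "2 * ((K * (R + D * \<delta>) * D) * \<delta>) \<le> \<eta> * \<delta>"
        using mult_right_mono[OF \<theta>, of \<delta>] \<delta> by simp
      moreover have "2 * ((L + norm (b' 0)) * R) \<le> K * R"
        using R b(2) unfolding mult.assoc[symmetric] by (intro mult_right_mono) (auto simp: K_def B_def)
      ultimately show "(3 * L + 2 * norm (b' 0)) * (R + D * \<delta>) * (D * \<delta>) + 2 * ((L + norm (b' 0)) * R) \<le> \<eta> * \<delta>"
        using KR by (simp add: mult.assoc)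
    qed
    have \<eta>\<delta>: "\<eta> * \<delta> \<le> \<delta>" using pos \<delta> by (simp add: mult_left_le_one_le)
    have "\<exists>f. hoelder_le \<alpha> (\<eta> * \<delta>) f \<and> (\<forall>y. norm y \<le> 1 \<longrightarrow> F \<epsilon> f y = f y)" if \<epsilon>: "\<epsilon> \<in> {\<delta>/2..\<delta>}" for \<epsilon>
    proof -
      obtain f where f: "hoelder_le \<alpha> \<delta> f" "\<And>y. norm y \<le> 1 \<Longrightarrow> F \<epsilon> f y = f y"
      proof (rule hoelder_le_fixpoint[of \<alpha> \<delta> "F \<epsilon>"])
        show "hoelder_le \<alpha> \<delta> (F \<epsilon> g)" if "hoelder_le \<alpha> \<delta> g" for g
          by (rule hoelder_le_mono[OF Fb[OF that \<epsilon>] \<eta>\<delta>])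
        show "hoelder_le \<alpha> (M / 2) (\<lambda>y. F \<epsilon> g y - F \<epsilon> h y)"
          if "hoelder_le \<alpha> \<delta> g" "hoelder_le \<alpha> \<delta> h" "hoelder_le \<alpha> M (\<lambda>y. g y - h y)" for g h M
          by (rule contr[OF that \<epsilon>])
      qed (use \<delta> in auto)
      \<comment> \<open>The iteration runs in the ball of radius \<delta>, but a fixed point is a
        value of F and so inherits the better bound \<eta>\<delta>. Without it the correction could
        cancel the quadratic part.\<close>
      have "hoelder_le \<alpha> (\<eta> * \<delta>) f"
        using Fb[OF f(1) \<epsilon>] f(2) by (subst (asm) hoelder_le_cong) auto
      with f(2) show ?thesis by blast
    qed
    then obtain f where f: "\<And>\<epsilon>. \<epsilon> \<in> {\<delta>/2..\<delta>} \<Longrightarrow> hoelder_le \<alpha> (\<eta> * \<delta>) (f \<epsilon>)"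
      "\<And>\<epsilon> y. \<epsilon> \<in> {\<delta>/2..\<delta>} \<Longrightarrow> norm y \<le> 1 \<Longrightarrow> F \<epsilon> (f \<epsilon>) y = f \<epsilon> y"
      by metis
    define v0 where "v0 \<epsilon> y = \<epsilon> *\<^sub>R quad0 i k l y + T0 (f \<epsilon>) y" for \<epsilon> y
    define v1 where "v1 \<epsilon> y = \<epsilon> *\<^sub>R quad1 i k l y + T1 (f \<epsilon>) y" for \<epsilon> y
    define v2 where "v2 \<epsilon> y = \<epsilon> *\<^sub>R quad2 i k l + T2 (f \<epsilon>) y" for \<epsilon> y
    have ev: "e \<epsilon> (f \<epsilon>) y = (v0 \<epsilon> y, v1 \<epsilon> y, v2 \<epsilon> y)" for \<epsilon> y
      by (simp add: e_def H_def E_def v0_def v1_def v2_def)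
    have tr: "(\<chi> j. trace (v2 \<epsilon> y $ j)) = f \<epsilon> y" if "\<epsilon> \<in> {\<delta>/2..\<delta>}" "y \<in> cball 0 1" for \<epsilon> y
    proof -
      have "trace (v2 \<epsilon> y $ j) = \<epsilon> * trace (quad2 i k l $ j :: real^'n^'n) + trace (T2 (f \<epsilon>) y $ j)" for j
        by (simp add: v2_def trace_def sum.distrib sum_distrib_left)
      then show ?thesis using T2(2)[OF f(1)[OF that(1)] that(2)] by (simp add: trace_quad2[OF ik] vec_eq_iff)
    qed
    have p1: "(v0 \<epsilon> has_derivative (\<lambda>h. v1 \<epsilon> y *v h)) (at y within cball 0 1)" if "\<epsilon> \<in> {\<delta>/2..\<delta>}" "y \<in> cball 0 1" for \<epsilon> y
      unfolding v0_def [abs_def] v1_def matrix_vector_mult_add_rdistrib scaleR_matrix_vector_assoc [symmetric]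
      by (intro has_derivative_add has_derivative_scaleR_right has_derivative_quad0 T0[OF f(1)] that)
    have p2: "((\<lambda>y. v1 \<epsilon> y $ j) has_derivative (\<lambda>h. v2 \<epsilon> y $ j *v h)) (at y within cball 0 1)" if "\<epsilon> \<in> {\<delta>/2..\<delta>}" "y \<in> cball 0 1" for \<epsilon> y j
      unfolding v1_def v2_def vector_add_component vector_scaleR_component matrix_vector_mult_add_rdistrib scaleR_matrix_vector_assoc [symmetric]
      by (intro has_derivative_add has_derivative_scaleR_right has_derivative_quad1 T1[OF f(1)] that)
    have p3: "v0 \<epsilon> 0 = 0" "v1 \<epsilon> 0 = 0" if "\<epsilon> \<in> {\<delta>/2..\<delta>}" for \<epsilon>
      using T_0[OF f(1)[OF that]] by (simp_all add: v0_def v1_def quad_at_0)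
    have p4: "v2 \<epsilon> 0 $ l $ k $ i \<noteq> 0" if "\<epsilon> \<in> {\<delta>/2..\<delta>}" for \<epsilon>
    proof -
      have "norm (T2 (f \<epsilon>) 0) \<le> norm (E (f \<epsilon>) 0)"
        unfolding E_def using norm_snd_le[of "(T1 (f \<epsilon>) 0, T2 (f \<epsilon>) 0)" "T0 (f \<epsilon>) 0"] norm_snd_le[of "T2 (f \<epsilon>) 0" "T1 (f \<epsilon>) 0"]
        by linarith
      also have "\<dots> \<le> C * (\<eta> * \<delta>)" using hoelder_leD(1)[OF Eb[OF f(1)[OF that]], of 0] by simp
      also have "\<dots> < 1 / 2 * \<delta>" using mult_strict_right_mono[OF pos(6) \<delta>] by (simp add: mult.assoc)
      finally have "norm (T2 (f \<epsilon>) 0) < \<delta> / 2" by simp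
      moreover have "\<bar>T2 (f \<epsilon>) 0 $ l $ k $ i\<bar> \<le> norm (T2 (f \<epsilon>) 0)"
        using component_le_norm_cart[of "T2 (f \<epsilon>) 0 $ l $ k" i] Finite_Cartesian_Product.norm_nth_le[of "T2 (f \<epsilon>) 0 $ l" k]
          Finite_Cartesian_Product.norm_nth_le[of "T2 (f \<epsilon>) 0" l] by linarith
      moreover have "v2 \<epsilon> 0 $ l $ k $ i = \<epsilon> + T2 (f \<epsilon>) 0 $ l $ k $ i"
        by (simp add: v2_def quad2_entry[OF ik])
      ultimately show ?thesis using that by auto
    qed
    have p5: "\<exists>M. hoelder_le \<alpha> M (v2 \<epsilon>)" if "\<epsilon> \<in> {\<delta>/2..\<delta>}" for \<epsilon>
    proof -
      have "hoelder_le \<alpha> (C * (\<eta> * \<delta>)) (T2 (f \<epsilon>))"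
      proof (rule hoelder_leI)
        fix x y :: "real^'n" assume x: "norm x \<le> 1"
        show "norm (T2 (f \<epsilon>) x) \<le> C * (\<eta> * \<delta>)"
          using hoelder_leD(1)[OF Eb[OF f(1)[OF that]] x] norm_snd_le[of "(T1 (f \<epsilon>) x, T2 (f \<epsilon>) x)" "T0 (f \<epsilon>) x"]
            norm_snd_le[of "T2 (f \<epsilon>) x" "T1 (f \<epsilon>) x"]
          unfolding E_def by linarith
        assume y: "norm y \<le> 1"
        show "norm (T2 (f \<epsilon>) x - T2 (f \<epsilon>) y) \<le> C * (\<eta> * \<delta>) * norm (x - y) powr \<alpha>"
          using hoelder_leD(2)[OF Eb[OF f(1)[OF that]] x y] 
            norm_snd_le[of "(T1 (f \<epsilon>) x - T1 (f \<epsilon>) y, T2 (f \<epsilon>) x - T2 (f \<epsilon>) y)" "T0 (f \<epsilon>) x - T0 (f \<epsilon>) y"]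
            norm_snd_le[of "T2 (f \<epsilon>) x - T2 (f \<epsilon>) y" "T1 (f \<epsilon>) x - T1 (f \<epsilon>) y"]
          unfolding E_def diff_Pair by linarith
      qed
      moreover have "hoelder_le \<alpha> (norm (\<epsilon> *\<^sub>R quad2 i k l :: real^'n^'n^'m)) (\<lambda>y::real^'n. \<epsilon> *\<^sub>R quad2 i k l :: real^'n^'n^'m)"
        by (auto simp: hoelder_le_def)
      ultimately show ?thesis
        unfolding v2_def [abs_def] using hoelder_le_add by blast
    qed
    have p6: "(\<chi> j. trace (v2 \<epsilon> y $ j)) = a (R *\<^sub>R y, R\<^sup>2 *\<^sub>R v0 \<epsilon> y, R *\<^sub>R v1 \<epsilon> y, v2 \<epsilon> y)"
      if "\<epsilon> \<in> {\<delta>/2..\<delta>}" "y \<in> cball 0 1" for \<epsilon> y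
    proof -
      have "v2 \<epsilon> y \<in> sym_tuples"
        using T2(1)[OF f(1)[OF that(1)] that(2)]
        by (auto simp: sym_tuples_def v2_def transpose_def vec_eq_iff quad2_symmetric[unfolded transpose_def vec_eq_iff, simplified])
      then have j: "(R *\<^sub>R y, R\<^sup>2 *\<^sub>R v0 \<epsilon> y, R *\<^sub>R v1 \<epsilon> y, v2 \<epsilon> y) \<in> jets" by (simp add: jets_def)
      have "(\<chi> j. trace (v2 \<epsilon> y $ j)) = F \<epsilon> (f \<epsilon>) y" using tr[OF that] f(2)[OF that(1)] that(2) by simp
      also have "\<dots> = a (R *\<^sub>R y, R\<^sup>2 *\<^sub>R v0 \<epsilon> y, R *\<^sub>R v1 \<epsilon> y, v2 \<epsilon> y)"
        using ba[OF j] by (simp add: F_def ev jet_scale_def)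
      finally show ?thesis .
    qed
    have p7: "\<epsilon> = \<epsilon>'" if \<epsilon>: "\<epsilon> \<in> {\<delta>/2..\<delta>}" "\<epsilon>' \<in> {\<delta>/2..\<delta>}" and eq: "\<And>y. y \<in> cball 0 1 \<Longrightarrow> v2 \<epsilon> y = v2 \<epsilon>' y" for \<epsilon> \<epsilon>'
    proof -
      \<comment> \<open>The trace recovers f from the Hessian. Equal f have equal corrections, so
        the quadratic parts agree as well and \<epsilon> can be read off from their mixed
        entry.\<close>
      have "f \<epsilon> y = f \<epsilon>' y" if "norm y \<le> 1" for y
        using tr[OF \<epsilon>(1), of y] tr[OF \<epsilon>(2), of y] eq[of y] that by simp
      then have "hoelder_le \<alpha> 0 (\<lambda>y. f \<epsilon> y - f \<epsilon>' y)" by (simp add: hoelder_le_def)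
      from hoelder_leD(1)[OF Eb[OF this], of 0] Ed[OF f(1)[OF \<epsilon>(1)] f(1)[OF \<epsilon>(2)], of 0]
      have "T2 (f \<epsilon>) 0 = T2 (f \<epsilon>') 0" by (simp add: E_def zero_prod_def)
      then have "\<epsilon> *\<^sub>R quad2 i k l = (\<epsilon>' *\<^sub>R quad2 i k l :: real^'n^'n^'m)"
        using eq[of 0] by (simp add: v2_def)
      then have "(\<epsilon> *\<^sub>R quad2 i k l :: real^'n^'n^'m) $ l $ k $ i = (\<epsilon>' *\<^sub>R quad2 i k l :: real^'n^'n^'m) $ l $ k $ i"
        by (rule arg_cong)
      then show ?thesis by (simp add: quad2_entry[OF ik])
    qed
    show "\<exists>v0 v1 v2.
      (\<forall>\<epsilon>\<in>{\<delta>/2..\<delta>}. rescaled_solution a \<alpha> R (v0 \<epsilon>) (v1 \<epsilon>) (v2 \<epsilon>) \<and> v2 \<epsilon> 0 $ l $ k $ i \<noteq> 0) \<and>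
      (\<forall>\<epsilon>\<in>{\<delta>/2..\<delta>}. \<forall>\<epsilon>'\<in>{\<delta>/2..\<delta>}. (\<forall>y\<in>cball 0 1. v2 \<epsilon> y = v2 \<epsilon>' y) \<longrightarrow> \<epsilon> = \<epsilon>')"
      unfolding rescaled_solution_def
      by (intro exI[of _ v0] exI[of _ v1] exI[of _ v2] conjI ballI allI impI p1 p2 p3 p4 p5 p6 p7) blast+
  qed
qed

lemma rescaled_derivatives:
  fixes v0 :: "real^'n \<Rightarrow> real^'m"
  assumes "R > 0"
    and 0: "\<And>y. y \<in> cball 0 1 \<Longrightarrow> (v0 has_derivative (\<lambda>h. v1 y *v h)) (at y within cball 0 1)"
    and 1: "\<And>y j. y \<in> cball 0 1 \<Longrightarrow> ((\<lambda>y. v1 y $ j) has_derivative (\<lambda>h. v2 y $ j *v h)) (at y within cball 0 1)"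
    and u: "\<And>x. x \<in> cball 0 R \<Longrightarrow> u x = R\<^sup>2 *\<^sub>R v0 ((1 / R) *\<^sub>R x)"
    and x: "x \<in> cball 0 R"
  shows "(u has_derivative (\<lambda>h. (R *\<^sub>R v1 ((1 / R) *\<^sub>R x)) *v h)) (at x within cball 0 R)"
    and "((\<lambda>x. (R *\<^sub>R v1 ((1 / R) *\<^sub>R x)) $ j) has_derivative (\<lambda>h. v2 ((1 / R) *\<^sub>R x) $ j *v h)) (at x within cball 0 R)"
proof -
  let ?s = "\<lambda>x :: real^'n. (1 / R) *\<^sub>R x"
  have s: "(?s has_derivative ?s) (at x within cball 0 R)"
    by (auto intro!: derivative_eq_intros)
  have sub: "?s ` cball 0 R \<subseteq> cball 0 1" using \<open>R > 0\<close> by (auto simp: divide_le_eq)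
  have sx: "?s x \<in> cball 0 1" using sub x by blast
  have "((\<lambda>x. v0 (?s x)) has_derivative (\<lambda>h. v1 (?s x) *v ?s h)) (at x within cball 0 R)"
    by (rule has_derivative_in_compose[OF s has_derivative_subset[OF 0[OF sx] sub]])
  from has_derivative_scaleR_right[OF this, of "R\<^sup>2"]
  have "((\<lambda>x. R\<^sup>2 *\<^sub>R v0 (?s x)) has_derivative (\<lambda>h. (R *\<^sub>R v1 (?s x)) *v h)) (at x within cball 0 R)"
    by (rule has_derivative_eq_rhs)
      (use \<open>R > 0\<close> in \<open>simp add: fun_eq_iff matrix_vector_mult_scaleR power2_eq_square flip: scaleR_matrix_vector_assoc\<close>)
  then show "(u has_derivative (\<lambda>h. (R *\<^sub>R v1 (?s x)) *v h)) (at x within cball 0 R)"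
    by (rule has_derivative_transform[OF x, rotated]) (rule u)
  have "((\<lambda>x. v1 (?s x) $ j) has_derivative (\<lambda>h. v2 (?s x) $ j *v ?s h)) (at x within cball 0 R)"
    by (rule has_derivative_in_compose[where g = "\<lambda>y. v1 y $ j", OF s has_derivative_subset[OF 1[OF sx] sub]])
  from has_derivative_scaleR_right[OF this, of R]
  show "((\<lambda>x. (R *\<^sub>R v1 (?s x)) $ j) has_derivative (\<lambda>h. v2 (?s x) $ j *v h)) (at x within cball 0 R)"
    unfolding vector_scaleR_component by (rule has_derivative_eq_rhs)
      (use \<open>R > 0\<close> in \<open>simp add: fun_eq_iff matrix_vector_mult_scaleR\<close>)
qed

theorem theorem1p1:
  fixes a :: "(real^'n) \<times> (real^'m) \<times> (real^'n^'m) \<times> (real^'n^'n^'m) \<Rightarrow> real^'m"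
    and \<alpha> :: real
  assumes "CARD('n) \<ge> 2"
    and "CARD('m) \<ge> 1"
    and "0 < \<alpha>" and "\<alpha> < 1"
    and "C2_on jets a"
    and "a (0, 0, 0, 0) = 0"
    and "grad_r_zero a"
    and "hess_r_zero a"
  shows "\<exists>R\<^sub>0>0. \<forall>R. 0 < R \<and> R \<le> R\<^sub>0 \<longrightarrow>
           infinite {u \<in> cball (0 :: real^'n) R \<rightarrow>\<^sub>E (UNIV :: (real^'m) set).
             C2_hoelder_on \<alpha> (cball 0 R) u \<and>
             solves_on a (cball 0 R) u \<and>
             vanishing_order_two_on (cball 0 R) u \<and>
             \<not> radially_symmetric_on (cball 0 R) u}"
proof -
  obtain i k :: 'n where ik: "i \<noteq> k"
    using assms(1) card_le_Suc0_iff_eq[of "UNIV :: 'n set"] by force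
  define l :: 'm where "l = undefined"
  obtain R\<^sub>0 \<delta> :: real where R0: "R\<^sub>0 > 0" and \<delta>: "\<delta> > 0" and
    *: "\<And>R. 0 < R \<Longrightarrow> R \<le> R\<^sub>0 \<Longrightarrow> \<exists>v0 v1 v2.
      (\<forall>\<epsilon>\<in>{\<delta>/2..\<delta>}. rescaled_solution a \<alpha> R (v0 \<epsilon>) (v1 \<epsilon>) (v2 \<epsilon>) \<and> v2 \<epsilon> 0 $ l $ k $ i \<noteq> 0) \<and>
      (\<forall>\<epsilon>\<in>{\<delta>/2..\<delta>}. \<forall>\<epsilon>'\<in>{\<delta>/2..\<delta>}. (\<forall>y\<in>cball 0 1. v2 \<epsilon> y = v2 \<epsilon>' y) \<longrightarrow> \<epsilon> = \<epsilon>')"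
    by (rule unit_ball_solutions[OF assms(3-7) ik, where l = l]) blast
  show ?thesis
  proof (intro exI[of _ R\<^sub>0] conjI R0 allI impI)
    fix R :: real assume "0 < R \<and> R \<le> R\<^sub>0"
    then have R: "0 < R" "R \<le> R\<^sub>0" by auto
    from *[OF R] obtain v0 v1 v2 where
      sol: "\<And>\<epsilon>. \<epsilon> \<in> {\<delta>/2..\<delta>} \<Longrightarrow> rescaled_solution a \<alpha> R (v0 \<epsilon>) (v1 \<epsilon>) (v2 \<epsilon>)"
      and entry: "\<And>\<epsilon>. \<epsilon> \<in> {\<delta>/2..\<delta>} \<Longrightarrow> v2 \<epsilon> 0 $ l $ k $ i \<noteq> 0"
      and inj: "\<And>\<epsilon> \<epsilon>'. \<epsilon> \<in> {\<delta>/2..\<delta>} \<Longrightarrow> \<epsilon>' \<in> {\<delta>/2..\<delta>} \<Longrightarrow> \<forall>y\<in>cball 0 1. v2 \<epsilon> y = v2 \<epsilon>' y \<Longrightarrow> \<epsilon> = \<epsilon>'"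
      by blast
    have v0: "(v0 \<epsilon> has_derivative (\<lambda>h. v1 \<epsilon> y *v h)) (at y within cball 0 1)"
      and v1: "((\<lambda>y. v1 \<epsilon> y $ j) has_derivative (\<lambda>h. v2 \<epsilon> y $ j *v h)) (at y within cball 0 1)"
      and eqn: "(\<chi> j. trace (v2 \<epsilon> y $ j)) = a (R *\<^sub>R y, R\<^sup>2 *\<^sub>R v0 \<epsilon> y, R *\<^sub>R v1 \<epsilon> y, v2 \<epsilon> y)"
      if "\<epsilon> \<in> {\<delta>/2..\<delta>}" "y \<in> cball 0 1" for \<epsilon> y j
      using sol[OF that(1)] that(2) unfolding rescaled_solution_def by blast+
    have at_0: "v0 \<epsilon> 0 = 0" "v1 \<epsilon> 0 = 0" and hoe: "\<exists>M. hoelder_le \<alpha> M (v2 \<epsilon>)"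
      if "\<epsilon> \<in> {\<delta>/2..\<delta>}" for \<epsilon>
      using sol[OF that] unfolding rescaled_solution_def by blast+
    let ?S = "cball (0 :: real^'n) R"
    let ?s = "\<lambda>x :: real^'n. (1 / R) *\<^sub>R x"
    \<comment> \<open>The restriction fixes the values outside the ball, so that the infinite set
      consists of functions on the ball and not of different extensions of one function.\<close>
    define u where "u \<epsilon> = restrict (\<lambda>x. R\<^sup>2 *\<^sub>R v0 \<epsilon> (?s x)) ?S" for \<epsilon>
    have ux: "u \<epsilon> x = R\<^sup>2 *\<^sub>R v0 \<epsilon> (?s x)" if "x \<in> ?S" for \<epsilon> x using that by (simp add: u_def)
    have sx: "?s x \<in> cball 0 1" if "x \<in> ?S" for x using that R by (simp add: divide_le_eq)
    have 0: "0 \<in> ?S" using R by simp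
    have d1: "(u \<epsilon> has_derivative (\<lambda>h. (R *\<^sub>R v1 \<epsilon> (?s x)) *v h)) (at x within ?S)"
      and d2: "((\<lambda>x. (R *\<^sub>R v1 \<epsilon> (?s x)) $ j) has_derivative (\<lambda>h. v2 \<epsilon> (?s x) $ j *v h)) (at x within ?S)"
      if "\<epsilon> \<in> {\<delta>/2..\<delta>}" "x \<in> ?S" for \<epsilon> x j
      using rescaled_derivatives[OF R(1) v0[OF that(1)] v1[OF that(1)] ux that(2)] by blast+
    have D: "grad_on ?S (u \<epsilon>) x = R *\<^sub>R v1 \<epsilon> (?s x)" "hess_on ?S (u \<epsilon>) x = v2 \<epsilon> (?s x)"
      "((\<lambda>x. grad_on ?S (u \<epsilon>) x $ j) has_derivative (\<lambda>h. v2 \<epsilon> (?s x) $ j *v h)) (at x within ?S)"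
      if "\<epsilon> \<in> {\<delta>/2..\<delta>}" "x \<in> ?S" for \<epsilon> x j
      using vec_derivatives_cball[OF R(1) d1[OF that(1)] d2[OF that(1)] that(2)] by blast+
    show "infinite {u \<in> ?S \<rightarrow>\<^sub>E (UNIV :: (real^'m) set).
        C2_hoelder_on \<alpha> ?S u \<and> solves_on a ?S u \<and> vanishing_order_two_on ?S u \<and> \<not> radially_symmetric_on ?S u}"
    proof (rule infinite_super)
      \<comment> \<open>Equal functions have equal \<open>hess_on\<close>, which is
        \<open>v2\<close> up to the dilation; the parameter is then determined by
        \<open>inj\<close>.\<close>
      have "inj_on u {\<delta>/2..\<delta>}"
      proof (rule inj_onI)
        fix \<epsilon> \<epsilon>' assume \<epsilon>: "\<epsilon> \<in> {\<delta>/2..\<delta>}" "\<epsilon>' \<in> {\<delta>/2..\<delta>}" and eq: "u \<epsilon> = u \<epsilon>'"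
        show "\<epsilon> = \<epsilon>'"
        proof (rule inj[OF \<epsilon>], rule)
          fix y :: "real^'n" assume "y \<in> cball 0 1"
          then have y: "R *\<^sub>R y \<in> ?S" using R by simp
          have "v2 \<epsilon> (?s (R *\<^sub>R y)) = v2 \<epsilon>' (?s (R *\<^sub>R y))"
            using D(2)[OF \<epsilon>(1) y] D(2)[OF \<epsilon>(2) y] eq by simp
          then show "v2 \<epsilon> y = v2 \<epsilon>' y" using R by simp
        qed
      qed
      then show "infinite (u ` {\<delta>/2..\<delta>})"
        using \<delta> by (simp add: finite_image_iff infinite_Icc)
      show "u ` {\<delta>/2..\<delta>} \<subseteq> {u \<in> ?S \<rightarrow>\<^sub>E (UNIV :: (real^'m) set).
        C2_hoelder_on \<alpha> ?S u \<and> solves_on a ?S u \<and> vanishing_order_two_on ?S u \<and> \<not> radially_symmetric_on ?S u}"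
      proof (clarify, intro conjI)
        fix \<epsilon> assume \<epsilon>: "\<epsilon> \<in> {\<delta>/2..\<delta>}"
        note D = D[OF \<epsilon>]
        show "u \<epsilon> \<in> ?S \<rightarrow>\<^sub>E UNIV" by (simp add: u_def)
        show "C2_hoelder_on \<alpha> ?S (u \<epsilon>)"
          unfolding C2_hoelder_on_def
        proof (intro conjI allI)
          show "u \<epsilon> differentiable_on ?S"
            using d1[OF \<epsilon>] unfolding differentiable_on_def differentiable_def by blast
          show "(\<lambda>x. grad_on ?S (u \<epsilon>) x $ j) differentiable_on ?S" for j
            using D(3) unfolding differentiable_on_def differentiable_def by blast
          obtain M where M: "hoelder_le \<alpha> M (v2 \<epsilon>)" using hoe[OF \<epsilon>] by blast
          show "hoelder_on \<alpha> ?S (hess_on ?S (u \<epsilon>))"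
            unfolding hoelder_on_def
          proof (intro exI[of _ "M * (1 / R) powr \<alpha>"] ballI)
            fix x y assume x: "x \<in> ?S" and y: "y \<in> ?S"
            have "norm (v2 \<epsilon> (?s x) - v2 \<epsilon> (?s y)) \<le> M * norm (?s x - ?s y) powr \<alpha>"
              using hoelder_leD(2)[OF M, of "?s x" "?s y"] sx[OF x] sx[OF y] by simp
            also have "norm (?s x - ?s y) = (1 / R) * norm (x - y)"
              using R by (simp flip: scaleR_diff_right)
            finally show "dist (hess_on ?S (u \<epsilon>) x) (hess_on ?S (u \<epsilon>) y) \<le> M * (1 / R) powr \<alpha> * dist x y powr \<alpha>"
              using R by (simp add: D(2)[OF x] D(2)[OF y] dist_norm powr_mult powr_divide)
          qed
        qed
        show "solves_on a ?S (u \<epsilon>)"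
          unfolding solves_on_def
        proof
          fix x assume x: "x \<in> ?S"
          show "laplacian_on ?S (u \<epsilon>) x = a (x, u \<epsilon> x, grad_on ?S (u \<epsilon>) x, hess_on ?S (u \<epsilon>) x)"
            using eqn[OF \<epsilon> sx[OF x]] R by (simp add: laplacian_on_def D(1,2)[OF x] ux[OF x])
        qed
        have nz: "v2 \<epsilon> (?s 0) $ l $ k $ i \<noteq> 0" using entry[OF \<epsilon>] by simp
        then show "vanishing_order_two_on ?S (u \<epsilon>)"
          using at_0[OF \<epsilon>] by (auto simp: vanishing_order_two_on_def D(1,2)[OF 0] ux[OF 0])
        show "\<not> radially_symmetric_on ?S (u \<epsilon>)"
          using radially_symmetric_hessian[OF R(1) d1[OF \<epsilon>] d2[OF \<epsilon>] _ ik] nz by blast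
      qed
    qed
  qed
qed

end
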